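(* Let $(V,V^+)$ be an $n$-dimensional ordered directed $\mathbb{Q}$-vector space with Riesz interpolation. Then there exists an inductive system of ordered groups (indexed by the positive integers) \[ (\mathbb{Z}^n,\mathbb{Z}_{\geq 0}^n) \xrightarrow{\phi_1^2} (\mathbb{Z}^n,\mathbb{Z}_{\geq 0}^n) \xrightarrow{\phi_2^3} \cdots \] whose inductive limit is $(V,V^+)$.
   Context: An ordered vector space over $\mathbb{Q}$ is a $\mathbb{Q}$-vector space $V$ with a subset $V^+\subseteq V$ (the positive cone) such that $V^+\cap(-V^+)=\{0\}$, $V^++V^+\subseteq V^+$, and $\lambda V^+\subseteq V^+$ for all $\lambda\in\mathbb{Q}_{\ge 0}$. The order is $x\le y$ iff $y-x\in V^+$. It is directed if for all $x,y\in V$ there is $z\in V$ with $x\le z$ and $y\le z$. It has Riesz interpolation if whenever $a_1,a_2,c_1,c_2\in V$ satisfy $a_i\le c_j$ for all $i,j\in\{1,2\}$, there is $b\in V$ with $a_i\le b\le c_j$ for all $i,j\in\{1,2\}$. An ordered (abelian) group is an abelian group $G$ with a subset $G^+\subseteq G$ such that $0 \in G^+$, $G^+\cap(-G^+)=\{0\}$ and $G^++G^+\subseteq G^+$. Arrows between ordered groups are the group homomorphisms sending positive cone into positive cone. The inductive limit of a system $((G_\alpha,G_\alpha^+),(\phi_\alpha^\beta))$ is $(G,G^+)$, where $G$ is the inductive limit of abelian groups with canonical maps $\phi_\alpha^\infty:G_\alpha\to G$, and $G^+=\bigcup_\alpha\phi_\alpha^\infty(G_\alpha^+)$. "Is" is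 understood up to isomorphism of ordered groups, with $(V,V^+)$ regarded as an ordered group. *)

theory Defs
  imports Complex_Main "HOL-Algebra.Product_Groups"
begin

locale ordered_rat_vector_space = vector_space scale
  for scale :: "rat \<Rightarrow> 'v::ab_group_add \<Rightarrow> 'v" +
  fixes pos :: "'v set"
  assumes pos_Int_neg: "pos \<inter> uminus ` pos = {0}"
    and pos_add: "x \<in> pos \<Longrightarrow> y \<in> pos \<Longrightarrow> x + y \<in> pos"
    and pos_scale: "0 \<le> r \<Longrightarrow> x \<in> pos \<Longrightarrow> scale r x \<in> pos"

definition cone_le :: "'v::ab_group_add set \<Rightarrow> 'v \<Rightarrow> 'v \<Rightarrow> bool"
  where "cone_le pos x y \<longleftrightarrow> y - x \<in> pos"

definition directed_cone :: "'v::ab_group_add set \<Rightarrow> bool"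
  where "directed_cone pos \<longleftrightarrow> (\<forall>x y. \<exists>z. cone_le pos x z \<and> cone_le pos y z)"

definition riesz_interpolation :: "'v::ab_group_add set \<Rightarrow> bool"
  where "riesz_interpolation pos \<longleftrightarrow>
    (\<forall>a1 a2 c1 c2.
       cone_le pos a1 c1 \<and> cone_le pos a1 c2 \<and> cone_le pos a2 c1 \<and> cone_le pos a2 c2 \<longrightarrow>
       (\<exists>b. cone_le pos a1 b \<and> cone_le pos a2 b \<and> cone_le pos b c1 \<and> cone_le pos b c2))"


locale ordered_group = comm_group G for G (structure) +
  fixes pos :: "'a set"
  assumes pos_subset: "pos \<subseteq> carrier G"
    and one_pos: "\<one> \<in> pos"
    and pos_Int_inv: "pos \<inter> m_inv G ` pos = {\<one>}"
    and pos_mult: "x \<in> pos \<Longrightarrow> y \<in> pos \<Longrightarrow> x \<otimes> y \<in> pos"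

definition ordered_hom ::
  "('a, 'c) monoid_scheme \<Rightarrow> 'a set \<Rightarrow> ('b, 'd) monoid_scheme \<Rightarrow> 'b set \<Rightarrow> ('a \<Rightarrow> 'b) set"
  where "ordered_hom G P H Q = {f \<in> hom G H. f ` P \<subseteq> Q}"

definition ordered_iso ::
  "('a, 'c) monoid_scheme \<Rightarrow> 'a set \<Rightarrow> ('b, 'd) monoid_scheme \<Rightarrow> 'b set \<Rightarrow> ('a \<Rightarrow> 'b) set"
  where "ordered_iso G P H Q = {f \<in> iso G H. f ` P = Q}"

definition additive_group :: "'v::ab_group_add monoid"
  where "additive_group = \<lparr>carrier = UNIV, monoid.mult = (+), one = 0\<rparr>"

definition int_power_group :: "nat \<Rightarrow> (nat \<Rightarrow> int) monoid"
  where "int_power_group n = product_group {..<n} (\<lambda>_. integer_group)"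

definition int_power_pos :: "nat \<Rightarrow> (nat \<Rightarrow> int) set"
  where "int_power_pos n = {x \<in> carrier (int_power_group n). \<forall>i<n. 0 \<le> x i}"


locale inductive_system =
  fixes I :: "'i::order set"
    and G :: "'i \<Rightarrow> ('a, 'c) monoid_scheme"
    and pos :: "'i \<Rightarrow> 'a set"
    and \<phi> :: "'i \<Rightarrow> 'i \<Rightarrow> 'a \<Rightarrow> 'a"
  assumes index_nonempty: "I \<noteq> {}"
    and index_directed: "i \<in> I \<Longrightarrow> j \<in> I \<Longrightarrow> \<exists>k\<in>I. i \<le> k \<and> j \<le> k"
    and ordered_group: "i \<in> I \<Longrightarrow> ordered_group (G i) (pos i)"
    and map_hom: "i \<in> I \<Longrightarrow> j \<in> I \<Longrightarrow> i \<le> j \<Longrightarrow> \<phi> i j \<in> ordered_hom (G i) (pos i) (G j) (pos j)"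
    and map_id: "i \<in> I \<Longrightarrow> x \<in> carrier (G i) \<Longrightarrow> \<phi> i i x = x"
    and map_comp: "i \<in> I \<Longrightarrow> j \<in> I \<Longrightarrow> k \<in> I \<Longrightarrow> i \<le> j \<Longrightarrow> j \<le> k \<Longrightarrow> x \<in> carrier (G i) \<Longrightarrow>
      \<phi> j k (\<phi> i j x) = \<phi> i k x"

text \<open>The limit group is the disjoint union of the groups \<open>G i\<close> modulo the relation of becoming
  equal at some later stage.\<close>

definition limit_rel ::
  "'i::order set \<Rightarrow> ('i \<Rightarrow> ('a, 'c) monoid_scheme) \<Rightarrow> ('i \<Rightarrow> 'i \<Rightarrow> 'a \<Rightarrow> 'a) \<Rightarrow> (('i \<times> 'a) \<times> ('i \<times> 'a)) set"
  where "limit_rel I G \<phi> =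
    {((i, x), (j, y)). i \<in> I \<and> j \<in> I \<and> x \<in> carrier (G i) \<and> y \<in> carrier (G j) \<and>
       (\<exists>k\<in>I. i \<le> k \<and> j \<le> k \<and> \<phi> i k x = \<phi> j k y)}"

definition limit_map ::
  "'i::order set \<Rightarrow> ('i \<Rightarrow> ('a, 'c) monoid_scheme) \<Rightarrow> ('i \<Rightarrow> 'i \<Rightarrow> 'a \<Rightarrow> 'a) \<Rightarrow> 'i \<Rightarrow> 'a \<Rightarrow> ('i \<times> 'a) set"
  where "limit_map I G \<phi> i x = limit_rel I G \<phi> `` {(i, x)}"

text \<open>In the operations below all members of each union coincide, as they do not depend on the
  chosen representatives; see \<open>limit_mult_map\<close> and \<open>limit_one_map\<close>.\<close>

definition limit_group ::
  "'i::order set \<Rightarrow> ('i \<Rightarrow> ('a, 'c) monoid_scheme) \<Rightarrow> ('i \<Rightarrow> 'i \<Rightarrow> 'a \<Rightarrow> 'a) \<Rightarrow> ('i \<times> 'a) set monoid"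
  where "limit_group I G \<phi> =
    \<lparr>carrier = (SIGMA i:I. carrier (G i)) // limit_rel I G \<phi>,
     monoid.mult = (\<lambda>A B. \<Union>(i, x)\<in>A. \<Union>(j, y)\<in>B. \<Union>k\<in>{k\<in>I. i \<le> k \<and> j \<le> k}.
       limit_map I G \<phi> k (\<phi> i k x \<otimes>\<^bsub>G k\<^esub> \<phi> j k y)),
     one = (\<Union>i\<in>I. limit_map I G \<phi> i \<one>\<^bsub>G i\<^esub>)\<rparr>"

definition limit_pos ::
  "'i::order set \<Rightarrow> ('i \<Rightarrow> ('a, 'c) monoid_scheme) \<Rightarrow> ('i \<Rightarrow> 'a set) \<Rightarrow> ('i \<Rightarrow> 'i \<Rightarrow> 'a \<Rightarrow> 'a) \<Rightarrow> ('i \<times> 'a) set set"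
  where "limit_pos I G pos \<phi> = (\<Union>i\<in>I. limit_map I G \<phi> i ` pos i)"

context inductive_system
begin

lemma map_carrier: "i \<in> I \<Longrightarrow> j \<in> I \<Longrightarrow> i \<le> j \<Longrightarrow> x \<in> carrier (G i) \<Longrightarrow> \<phi> i j x \<in> carrier (G j)"
  using map_hom[of i j] by (auto simp: ordered_hom_def hom_def)

lemma map_mult:
  "i \<in> I \<Longrightarrow> j \<in> I \<Longrightarrow> i \<le> j \<Longrightarrow> x \<in> carrier (G i) \<Longrightarrow> y \<in> carrier (G i) \<Longrightarrow>
    \<phi> i j (x \<otimes>\<^bsub>G i\<^esub> y) = \<phi> i j x \<otimes>\<^bsub>G j\<^esub> \<phi> i j y"
  using map_hom[of i j] by (auto simp: ordered_hom_def hom_def)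

lemma comm_group_G: "i \<in> I \<Longrightarrow> comm_group (G i)"
  using ordered_group ordered_group.axioms(1) by blast

lemma group_G: "i \<in> I \<Longrightarrow> group (G i)"
  using comm_group_G comm_group.axioms(2) by blast

lemma map_one: "i \<in> I \<Longrightarrow> j \<in> I \<Longrightarrow> i \<le> j \<Longrightarrow> \<phi> i j \<one>\<^bsub>G i\<^esub> = \<one>\<^bsub>G j\<^esub>"
  using map_hom[of i j] group_G[of i] group_G[of j] hom_one[of "\<phi> i j" "G i" "G j"]
  by (simp add: ordered_hom_def)

lemma equiv_limit_rel: "equiv (SIGMA i:I. carrier (G i)) (limit_rel I G \<phi>)"
proof (rule equivI)
  show "limit_rel I G \<phi> \<subseteq> (SIGMA i:I. carrier (G i)) \<times> (SIGMA i:I. carrier (G i))"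
    by (auto simp: limit_rel_def)
  show "refl_on (SIGMA i:I. carrier (G i)) (limit_rel I G \<phi>)"
    by (auto simp: refl_on_def limit_rel_def)
  show "sym (limit_rel I G \<phi>)"
    by (force simp: sym_def limit_rel_def)
  show "trans (limit_rel I G \<phi>)"
  proof (rule transI, clarify)
    fix i x j y l z
    assume 1: "((i, x), (j, y)) \<in> limit_rel I G \<phi>" and 2: "((j, y), (l, z)) \<in> limit_rel I G \<phi>"
    obtain k where k: "k \<in> I" "i \<le> k" "j \<le> k" "\<phi> i k x = \<phi> j k y"
      using 1 by (auto simp: limit_rel_def)
    obtain m where m: "m \<in> I" "j \<le> m" "l \<le> m" "\<phi> j m y = \<phi> l m z"
      using 2 by (auto simp: limit_rel_def)
    obtain p where p: "p \<in> I" "k \<le> p" "m \<le> p"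
      using index_directed k m by blast
    have I: "i \<in> I" "j \<in> I" "l \<in> I" "x \<in> carrier (G i)" "y \<in> carrier (G j)" "z \<in> carrier (G l)"
      using 1 2 by (auto simp: limit_rel_def)
    have "\<phi> i p x = \<phi> j p y"
      using map_comp[of i k p x] map_comp[of j k p y] I k p by simp
    also have "\<dots> = \<phi> l p z"
      using map_comp[of j m p y] map_comp[of l m p z] I m p by simp
    finally show "((i, x), (l, z)) \<in> limit_rel I G \<phi>"
      using I k m p by (auto simp: limit_rel_def intro!: bexI[of _ p])
  qed
qed

lemma limit_map_eq_iff:
  assumes "i \<in> I" "j \<in> I" "x \<in> carrier (G i)" "y \<in> carrier (G j)"
  shows "limit_map I G \<phi> i x = limit_map I G \<phi> j y \<longleftrightarrow>
    (\<exists>k\<in>I. i \<le> k \<and> j \<le> k \<and> \<phi> i k x = \<phi> j k y)"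
  using eq_equiv_class_iff[OF equiv_limit_rel, of "(i, x)" "(j, y)"] assms
  by (auto simp: limit_map_def limit_rel_def)

lemma limit_map_map:
  assumes "i \<in> I" "j \<in> I" "i \<le> j" "x \<in> carrier (G i)"
  shows "limit_map I G \<phi> j (\<phi> i j x) = limit_map I G \<phi> i x"
  using assms by (subst limit_map_eq_iff) (auto intro!: map_carrier bexI[of _ j] map_id)

lemma carrier_limit: "carrier (limit_group I G \<phi>) = (\<Union>i\<in>I. limit_map I G \<phi> i ` carrier (G i))"
  by (auto simp: limit_group_def quotient_def limit_map_def)

lemma one_carrier: "i \<in> I \<Longrightarrow> \<one>\<^bsub>G i\<^esub> \<in> carrier (G i)"
  using group_G[of i] by (simp add: group.is_monoid monoid.one_closed)

lemma mult_carrier: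
  "i \<in> I \<Longrightarrow> x \<in> carrier (G i) \<Longrightarrow> y \<in> carrier (G i) \<Longrightarrow> x \<otimes>\<^bsub>G i\<^esub> y \<in> carrier (G i)"
  using group_G[of i] by (simp add: group.is_monoid monoid.m_closed)

lemma limit_one_map:
  assumes "i \<in> I"
  shows "\<one>\<^bsub>limit_group I G \<phi>\<^esub> = limit_map I G \<phi> i \<one>\<^bsub>G i\<^esub>"
proof -
  have "limit_map I G \<phi> j \<one>\<^bsub>G j\<^esub> = limit_map I G \<phi> i \<one>\<^bsub>G i\<^esub>" if j: "j \<in> I" for j
  proof -
    obtain k where "k \<in> I" "i \<le> k" "j \<le> k"
      using index_directed[OF assms j] by blast
    then show ?thesis
      using assms j limit_map_map[of i k "\<one>\<^bsub>G i\<^esub>"] limit_map_map[of j k "\<one>\<^bsub>G j\<^esub>"]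
      by (simp add: map_one one_carrier)
  qed
  then have "(\<Union>j\<in>I. limit_map I G \<phi> j \<one>\<^bsub>G j\<^esub>) = (\<Union>j\<in>I. limit_map I G \<phi> i \<one>\<^bsub>G i\<^esub>)"
    by (rule SUP_cong[OF refl])
  also have "\<dots> = limit_map I G \<phi> i \<one>\<^bsub>G i\<^esub>"
    using assms by blast
  finally show ?thesis
    by (simp only: limit_group_def monoid.simps)
qed

lemma limit_mult_map:
  assumes "i \<in> I" "j \<in> I" "k \<in> I" "i \<le> k" "j \<le> k" "x \<in> carrier (G i)" "y \<in> carrier (G j)"
  shows "limit_map I G \<phi> i x \<otimes>\<^bsub>limit_group I G \<phi>\<^esub> limit_map I G \<phi> j y =
    limit_map I G \<phi> k (\<phi> i k x \<otimes>\<^bsub>G k\<^esub> \<phi> j k y)"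
proof -
  let ?c = "limit_map I G \<phi> k (\<phi> i k x \<otimes>\<^bsub>G k\<^esub> \<phi> j k y)"
  have *: "limit_map I G \<phi> k' (\<phi> i' k' x' \<otimes>\<^bsub>G k'\<^esub> \<phi> j' k' y') = ?c"
    if x': "((i, x), (i', x')) \<in> limit_rel I G \<phi>" and y': "((j, y), (j', y')) \<in> limit_rel I G \<phi>"
      and k': "k' \<in> I" "i' \<le> k'" "j' \<le> k'" for i' x' j' y' k'
  proof -
    obtain l where l: "l \<in> I" "i \<le> l" "i' \<le> l" "\<phi> i l x = \<phi> i' l x'"
      using x' by (auto simp: limit_rel_def)
    obtain m where m: "m \<in> I" "j \<le> m" "j' \<le> m" "\<phi> j m y = \<phi> j' m y'"
      using y' by (auto simp: limit_rel_def)
    have I: "i' \<in> I" "j' \<in> I" "x' \<in> carrier (G i')" "y' \<in> carrier (G j')"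
      using x' y' by (auto simp: limit_rel_def)
    obtain p where p: "p \<in> I" "l \<le> p" "m \<le> p"
      using index_directed l m by blast
    obtain q where q: "q \<in> I" "k \<le> q" "k' \<le> q"
      using index_directed assms k' by blast
    obtain r where r: "r \<in> I" "p \<le> r" "q \<le> r"
      using index_directed p q by blast
    have le: "l \<le> r" "m \<le> r" "k \<le> r" "k' \<le> r"
      using p q r by auto
    have "\<phi> i r x = \<phi> i' r x'"
      using map_comp[of i l r x] map_comp[of i' l r x'] I l r le assms by simp
    moreover have "\<phi> j r y = \<phi> j' r y'"
      using map_comp[of j m r y] map_comp[of j' m r y'] I m r le assms by simp
    ultimately have "\<phi> k' r (\<phi> i' k' x' \<otimes>\<^bsub>G k'\<^esub> \<phi> j' k' y') = \<phi> k r (\<phi> i k x \<otimes>\<^bsub>G k\<^esub> \<phi> j k y)"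
      using assms I k' r le by (simp add: map_mult map_carrier map_comp)
    then show ?thesis
      using assms I k' r le by (subst limit_map_eq_iff) (auto intro!: mult_carrier map_carrier)
  qed
  have self: "(i, x) \<in> limit_map I G \<phi> i x" "(j, y) \<in> limit_map I G \<phi> j y"
    using equiv_class_self[OF equiv_limit_rel] assms by (auto simp: limit_map_def)
  have eq: "limit_map I G \<phi> i x \<otimes>\<^bsub>limit_group I G \<phi>\<^esub> limit_map I G \<phi> j y =
      (\<Union>(i', x')\<in>limit_map I G \<phi> i x. \<Union>(j', y')\<in>limit_map I G \<phi> j y.
        \<Union>k'\<in>{k'\<in>I. i' \<le> k' \<and> j' \<le> k'}. limit_map I G \<phi> k' (\<phi> i' k' x' \<otimes>\<^bsub>G k'\<^esub> \<phi> j' k' y'))"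
    (is "_ = ?U")
    by (simp add: limit_group_def)
  have "?U \<subseteq> ?c"
  proof (rule UN_least, clarify)
    fix i' x' j' y' k' s t
    assume "(i', x') \<in> limit_map I G \<phi> i x" "(j', y') \<in> limit_map I G \<phi> j y"
      and k': "k' \<in> I" "i' \<le> k'" "j' \<le> k'"
      and st: "(s, t) \<in> limit_map I G \<phi> k' (\<phi> i' k' x' \<otimes>\<^bsub>G k'\<^esub> \<phi> j' k' y')"
    then have "((i, x), (i', x')) \<in> limit_rel I G \<phi>" "((j, y), (j', y')) \<in> limit_rel I G \<phi>"
      by (simp_all add: limit_map_def)
    from *[OF this k'] st show "(s, t) \<in> ?c"
      by simp
  qed
  moreover have "?c \<subseteq> ?U"
  proof
    fix z assume z: "z \<in> ?c"
    show "z \<in> ?U"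
      by (rule UN_I[OF self(1)], simp only: prod.case, rule UN_I[OF self(2)], simp only: prod.case)
        (use z assms in blast)
  qed
  ultimately show ?thesis
    unfolding eq by (rule subset_antisym)
qed

lemma limit_map_eq_one:
  assumes "i \<in> I" "x \<in> carrier (G i)" "limit_map I G \<phi> i x = \<one>\<^bsub>limit_group I G \<phi>\<^esub>"
  obtains k where "k \<in> I" "i \<le> k" "\<phi> i k x = \<one>\<^bsub>G k\<^esub>"
proof -
  have "\<one>\<^bsub>G i\<^esub> \<in> carrier (G i)"
    using assms(1) by (rule one_carrier)
  then obtain k where "k \<in> I" "i \<le> k" "\<phi> i k x = \<phi> i k \<one>\<^bsub>G i\<^esub>"
    using assms limit_map_eq_iff[of i i x "\<one>\<^bsub>G i\<^esub>"] limit_one_map[of i] by auto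
  then show ?thesis
    using that assms(1) by (simp add: map_one)
qed

lemma limit_mult_same:
  assumes "i \<in> I" "x \<in> carrier (G i)" "y \<in> carrier (G i)"
  shows "limit_map I G \<phi> i x \<otimes>\<^bsub>limit_group I G \<phi>\<^esub> limit_map I G \<phi> i y = limit_map I G \<phi> i (x \<otimes>\<^bsub>G i\<^esub> y)"
  using limit_mult_map[of i i i x y] assms by (simp add: map_id)

lemma limit_map_hom:
  "i \<in> I \<Longrightarrow> limit_map I G \<phi> i \<in> ordered_hom (G i) (pos i) (limit_group I G \<phi>) (limit_pos I G pos \<phi>)"
  by (auto simp: ordered_hom_def hom_def carrier_limit limit_pos_def limit_mult_same)

lemma pos_carrier: "i \<in> I \<Longrightarrow> x \<in> pos i \<Longrightarrow> x \<in> carrier (G i)"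
  using ordered_group.pos_subset[OF ordered_group] by blast

lemma map_pos: "i \<in> I \<Longrightarrow> j \<in> I \<Longrightarrow> i \<le> j \<Longrightarrow> x \<in> pos i \<Longrightarrow> \<phi> i j x \<in> pos j"
  using map_hom[of i j] by (auto simp: ordered_hom_def)

lemma limit_carrierE:
  assumes "A \<in> carrier (limit_group I G \<phi>)"
  obtains i x where "i \<in> I" "x \<in> carrier (G i)" "A = limit_map I G \<phi> i x"
  using assms by (auto simp: carrier_limit)

lemma limit_carrierE2:
  assumes "A \<in> carrier (limit_group I G \<phi>)" "B \<in> carrier (limit_group I G \<phi>)"
  obtains i x y where "i \<in> I" "x \<in> carrier (G i)" "y \<in> carrier (G i)"
    "A = limit_map I G \<phi> i x" "B = limit_map I G \<phi> i y"
proof -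
  obtain i x where 1: "i \<in> I" "x \<in> carrier (G i)" "A = limit_map I G \<phi> i x"
    using assms(1) by (rule limit_carrierE)
  obtain j y where 2: "j \<in> I" "y \<in> carrier (G j)" "B = limit_map I G \<phi> j y"
    using assms(2) by (rule limit_carrierE)
  obtain k where k: "k \<in> I" "i \<le> k" "j \<le> k"
    using index_directed 1 2 by blast
  show ?thesis
    using that[of k "\<phi> i k x" "\<phi> j k y"] 1 2 k by (simp add: limit_map_map map_carrier)
qed

lemma limit_posE2:
  assumes "A \<in> limit_pos I G pos \<phi>" "B \<in> limit_pos I G pos \<phi>"
  obtains i x y where "i \<in> I" "x \<in> pos i" "y \<in> pos i"
    "A = limit_map I G \<phi> i x" "B = limit_map I G \<phi> i y"
proof -
  obtain i x where 1: "i \<in> I" "x \<in> pos i" "A = limit_map I G \<phi> i x"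
    using assms(1) by (auto simp: limit_pos_def)
  obtain j y where 2: "j \<in> I" "y \<in> pos j" "B = limit_map I G \<phi> j y"
    using assms(2) by (auto simp: limit_pos_def)
  obtain k where k: "k \<in> I" "i \<le> k" "j \<le> k"
    using index_directed 1 2 by blast
  show ?thesis
    using that[of k "\<phi> i k x" "\<phi> j k y"] 1 2 k by (simp add: limit_map_map map_pos pos_carrier)
qed

lemma limit_comm_group: "comm_group (limit_group I G \<phi>)"
proof (rule comm_groupI)
  let ?L = "limit_group I G \<phi>" and ?m = "limit_map I G \<phi>"
  have map: "?m i x \<in> carrier ?L" if "i \<in> I" "x \<in> carrier (G i)" for i x
    using that by (auto simp: carrier_limit)
  show "A \<otimes>\<^bsub>?L\<^esub> B \<in> carrier ?L" if "A \<in> carrier ?L" "B \<in> carrier ?L" for A B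
    by (rule limit_carrierE2[OF that]) (simp add: limit_mult_same map mult_carrier)
  show "\<one>\<^bsub>?L\<^esub> \<in> carrier ?L"
    using index_nonempty limit_one_map map one_carrier by fastforce
  show "A \<otimes>\<^bsub>?L\<^esub> B = B \<otimes>\<^bsub>?L\<^esub> A" if "A \<in> carrier ?L" "B \<in> carrier ?L" for A B
    by (rule limit_carrierE2[OF that])
      (simp add: limit_mult_same comm_monoid.m_comm comm_group.axioms(1) comm_group_G)
  show "\<one>\<^bsub>?L\<^esub> \<otimes>\<^bsub>?L\<^esub> A = A" if A: "A \<in> carrier ?L" for A
    by (rule limit_carrierE[OF A])
      (simp add: limit_one_map limit_mult_same one_carrier monoid.l_one group.is_monoid group_G)
  show "\<exists>B\<in>carrier ?L. B \<otimes>\<^bsub>?L\<^esub> A = \<one>\<^bsub>?L\<^esub>" if A: "A \<in> carrier ?L" for A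
  proof (rule limit_carrierE[OF A])
    fix i x assume i: "i \<in> I" "x \<in> carrier (G i)" "A = ?m i x"
    then have "inv\<^bsub>G i\<^esub> x \<in> carrier (G i)" "inv\<^bsub>G i\<^esub> x \<otimes>\<^bsub>G i\<^esub> x = \<one>\<^bsub>G i\<^esub>"
      using group_G by (auto simp: group.inv_closed group.l_inv)
    then show ?thesis
      using i by (intro bexI[of _ "?m i (inv\<^bsub>G i\<^esub> x)"]) (simp_all add: limit_mult_same limit_one_map[of i] map)
  qed
  show "A \<otimes>\<^bsub>?L\<^esub> B \<otimes>\<^bsub>?L\<^esub> C = A \<otimes>\<^bsub>?L\<^esub> (B \<otimes>\<^bsub>?L\<^esub> C)"
    if "A \<in> carrier ?L" "B \<in> carrier ?L" "C \<in> carrier ?L" for A B C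
  proof (rule limit_carrierE2[OF that(1,2)], rule limit_carrierE[OF that(3)])
    fix i x y j z
    assume 1: "i \<in> I" "x \<in> carrier (G i)" "y \<in> carrier (G i)" "A = ?m i x" "B = ?m i y"
      and 2: "j \<in> I" "z \<in> carrier (G j)" "C = ?m j z"
    obtain k where k: "k \<in> I" "i \<le> k" "j \<le> k"
      using index_directed 1 2 by blast
    have "A = ?m k (\<phi> i k x)" "B = ?m k (\<phi> i k y)" "C = ?m k (\<phi> j k z)"
      using 1 2 k by (simp_all add: limit_map_map)
    moreover have "\<phi> i k x \<in> carrier (G k)" "\<phi> i k y \<in> carrier (G k)" "\<phi> j k z \<in> carrier (G k)"
      using 1 2 k by (simp_all add: map_carrier)
    ultimately show ?thesis
      using k(1) by (simp add: limit_mult_same mult_carrier monoid.m_assoc group.is_monoid group_G)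
  qed
qed

lemma limit_ordered_group: "ordered_group (limit_group I G \<phi>) (limit_pos I G pos \<phi>)"
proof -
  let ?L = "limit_group I G \<phi>" and ?P = "limit_pos I G pos \<phi>" and ?m = "limit_map I G \<phi>"
  interpret L: comm_group ?L by (rule limit_comm_group)
  show ?thesis
  proof
    show sub: "?P \<subseteq> carrier ?L"
      by (auto simp: limit_pos_def carrier_limit pos_carrier)
    obtain i where i: "i \<in> I" using index_nonempty by blast
    then have "\<one>\<^bsub>G i\<^esub> \<in> pos i"
      using ordered_group.one_pos[OF ordered_group] by blast
    then show one: "\<one>\<^bsub>?L\<^esub> \<in> ?P"
      using i limit_one_map by (auto simp: limit_pos_def)
    show "A \<otimes>\<^bsub>?L\<^esub> B \<in> ?P" if "A \<in> ?P" "B \<in> ?P" for A B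
    proof (rule limit_posE2[OF that])
      fix i x y assume i: "i \<in> I" "x \<in> pos i" "y \<in> pos i" "A = ?m i x" "B = ?m i y"
      then have "x \<otimes>\<^bsub>G i\<^esub> y \<in> pos i"
        using ordered_group.pos_mult[OF ordered_group] by blast
      then show ?thesis
        unfolding limit_pos_def using i by (auto simp: limit_mult_same pos_carrier)
    qed
    have "A = \<one>\<^bsub>?L\<^esub>" if A: "A \<in> ?P" and B: "B \<in> ?P" and AB: "A = inv\<^bsub>?L\<^esub> B" for A B
    proof (rule limit_posE2[OF A B])
      fix i x y assume i: "i \<in> I" "x \<in> pos i" "y \<in> pos i" "A = ?m i x" "B = ?m i y"
      interpret Gi: ordered_group "G i" "pos i" by (rule ordered_group[OF i(1)])
      have "A \<otimes>\<^bsub>?L\<^esub> B = \<one>\<^bsub>?L\<^esub>"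
        using AB B sub by auto
      then have "?m i (x \<otimes>\<^bsub>G i\<^esub> y) = \<one>\<^bsub>?L\<^esub>"
        using i by (simp add: limit_mult_same pos_carrier)
      then obtain k where k: "k \<in> I" "i \<le> k" "\<phi> i k (x \<otimes>\<^bsub>G i\<^esub> y) = \<one>\<^bsub>G k\<^esub>"
        using i by (auto elim!: limit_map_eq_one[rotated 2] simp: pos_carrier)
      interpret Gk: ordered_group "G k" "pos k" by (rule ordered_group[OF k(1)])
      have xy: "\<phi> i k x \<in> pos k" "\<phi> i k y \<in> pos k"
        using i k by (simp_all add: map_pos)
      have "\<phi> i k x \<otimes>\<^bsub>G k\<^esub> \<phi> i k y = \<one>\<^bsub>G k\<^esub>"
        using i k by (simp add: map_mult pos_carrier)
      then have "\<phi> i k x = inv\<^bsub>G k\<^esub> (\<phi> i k y)"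
        using xy k(1) by (metis Gk.inv_equality pos_carrier)
      then have "\<phi> i k x = \<one>\<^bsub>G k\<^esub>"
        using xy Gk.pos_Int_inv by blast
      then show ?thesis
        using i k limit_map_map[of i k x] limit_one_map[of k] by (simp add: pos_carrier)
    qed
    moreover have "\<one>\<^bsub>?L\<^esub> \<in> m_inv ?L ` ?P"
      using one by (metis L.inv_one imageI)
    ultimately show "?P \<inter> m_inv ?L ` ?P = {\<one>\<^bsub>?L\<^esub>}"
      using one by blast
  qed
qed

end

end

theory Submission
  imports Defs "HOL-Library.Function_Algebras"
begin

text \<open>A system of injective maps of \<open>\<int>\<^sup>n\<close> with limit \<open>V\<close> is the same thing as an increasing sequence
  of simplicial cones, each spanned by a basis of \<open>V\<close>, that exhausts \<open>V\<^sup>+\<close>; the denominators are absorbed by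
  rescaling the bases. So the point is that every finite subset of \<open>V\<^sup>+\<close> lies in the cone spanned by some
  basis of \<open>V\<close> contained in \<open>V\<^sup>+\<close>.

  This is proved for preordered spaces, with bases modulo the lineality space \<open>V\<^sup>+ \<inter> -V\<^sup>+\<close>, by induction on its
  codimension. If some element of the cone outside the lineality space is not an order unit, it generates a
  proper ideal \<open>M\<close>. A basis for \<open>V / M\<close> is lifted to \<open>V\<^sup>+\<close> and, using Riesz decomposition and
  interpolation, lowered by elements of \<open>M\<close> until the given elements differ from nonnegative combinations of it
  by positive elements of \<open>M\<close>; these are covered by a basis for \<open>M\<close>.

  If every such element is an order unit, the cone is determined by its extremal states. By the
  Riesz--Kantorovich formula they are linearly independent over \<open>\<real>\<close>, so they extend to a basis
  \<open>f\<^sub>1, \<dots>, f\<^sub>k\<close> of the real functionals that are positive on the given finite set. As \<open>V\<close> is dense in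
  \<open>\<real>\<^sup>k\<close>, the corresponding real dual basis can be replaced, one vector at a time, by vectors of \<open>V\<close>
  on which all \<open>f\<^sub>i\<close> are positive.\<close>

section \<open>Real functionals on a rational vector space\<close>

locale rat_space = finite_dimensional_vector_space scale Basis
  for scale :: "rat \<Rightarrow> 'v::ab_group_add \<Rightarrow> 'v" (infixr "*s" 75) and Basis :: "'v set"
begin

text \<open>Real values are allowed because extremal states of a cone over the rationals may be
  irrational.\<close>

definition functional :: "('v \<Rightarrow> real) \<Rightarrow> bool"
  where "functional f \<longleftrightarrow> (\<forall>x y. f (x + y) = f x + f y) \<and> (\<forall>q x. f (q *s x) = of_rat q * f x)"

lemma functionalI:
  "(\<And>x y. f (x + y) = f x + f y) \<Longrightarrow> (\<And>q x. f (q *s x) = of_rat q * f x) \<Longrightarrow> functional f"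
  by (simp add: functional_def)

lemma functional_add: "functional f \<Longrightarrow> f (x + y) = f x + f y"
  by (simp add: functional_def)

lemma functional_scale: "functional f \<Longrightarrow> f (q *s x) = of_rat q * f x"
  by (simp add: functional_def)

lemma functional_zero: "functional f \<Longrightarrow> f 0 = 0"
  using functional_scale[of f 0 0] by simp

lemma functional_minus: "functional f \<Longrightarrow> f (- x) = - f x"
  using functional_scale[of f "-1" x] by simp

lemma functional_diff: "functional f \<Longrightarrow> f (x - y) = f x - f y"
  using functional_add[of f x "- y"] by (simp add: functional_minus)

lemma functional_sum: "functional f \<Longrightarrow> f (\<Sum>i\<in>I. g i) = (\<Sum>i\<in>I. f (g i))"
  by (induction I rule: infinite_finite_induct) (simp_all add: functional_zero functional_add)

lemma functional_linear_comb:
  "functional f \<Longrightarrow> f (\<Sum>i\<in>I. c i *s b i) = (\<Sum>i\<in>I. of_rat (c i) * f (b i))"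
  by (simp add: functional_sum functional_scale)

lemma functional_combine:
  "functional f \<Longrightarrow> functional g \<Longrightarrow> functional (\<lambda>v. a * f v + c * g v)"
  by (simp add: functional_def algebra_simps)

section \<open>Separation by functionals and density of their values\<close>

lemma separating_functional:
  assumes U: "subspace U" and x: "x \<notin> U"
  obtains h where "functional h" "\<And>u. u \<in> U \<Longrightarrow> h u = 0" "h x \<noteq> 0"
proof -
  obtain B where B: "B \<subseteq> U" "independent B" "U \<subseteq> span B"
    by (rule basis_exists[of U])
  have span: "span B = U"
    using span_subspace[OF B(1,3) U] .
  then have ind: "independent (insert x B)"
    using independent_insertI[of x B] B(2) x unfolding span by blast
  define C where "C = extend_basis (insert x B)"
  have C: "independent C" "span C = UNIV" "insert x B \<subseteq> C"
    unfolding C_def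
    using independent_extend_basis[OF ind] span_extend_basis[OF ind] extend_basis_superset[OF ind] by - assumption+
  \<comment> \<open>The coordinate along \<open>x\<close> kills \<open>U\<close>, since the basis
    \<open>C\<close> contains a basis of \<open>U\<close> besides \<open>x\<close>.\<close>
  define h where "h v = (of_rat (representation C v x) :: real)" for v
  have h: "functional h"
    unfolding h_def using C
    by (intro functionalI) (simp_all add: representation_add representation_scale of_rat_add of_rat_mult)
  have hx: "h x = 1"
    using C by (simp add: h_def representation_basis)
  have hB: "h b = 0" if "b \<in> B" for b
  proof -
    have "b \<noteq> x"
      using that B x by auto
    then show ?thesis
      using that C by (auto simp: h_def representation_basis)
  qed
  have "h u = 0" if "u \<in> U" for u
  proof -
    have "u \<in> span B"
      using that B by blast
    then show ?thesis
      by (induction rule: span_induct_alt) (simp_all add: hB h functional_zero functional_add functional_scale)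
  qed
  then show ?thesis
    using that h hx by simp
qed

text \<open>The closure of the image of \<open>V\<close> in the real coordinate space is stable
  under real multiples, because the rationals are dense. Real independence of the \<open>f i\<close>
  then provides a dual family inside this closure, so it is the whole space.\<close>

lemma functionals_dense:
  fixes f :: "'i \<Rightarrow> 'v \<Rightarrow> real"
  assumes I: "finite I" and f: "\<And>i. i \<in> I \<Longrightarrow> functional (f i)"
    and indep: "\<And>c. (\<And>v. (\<Sum>i\<in>I. c i * f i v) = 0) \<Longrightarrow> \<forall>i\<in>I. c i = 0"
    and e: "0 < e"
  shows "\<exists>v. \<forall>i\<in>I. \<bar>f i v - t i\<bar> < e"
proof -
  \<comment> \<open>\<open>A\<close> is the closure of the value tuples of vectors of
    \<open>V\<close>, in the maximum norm over \<open>I\<close>.\<close>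
  define A where "A = {t. \<forall>e>0. \<exists>v. \<forall>i\<in>I. \<bar>f i v - t i\<bar> < e}"
  have A_D: "\<exists>v. \<forall>i\<in>I. \<bar>f i v - t i\<bar> < e" if "t \<in> A" "0 < e" for t e
    using that by (simp add: A_def)
  have A_mem: "(\<lambda>i. f i v) \<in> A" for v
    by (auto simp: A_def intro!: exI[of _ v])
  have A_zero: "(\<lambda>i. 0) \<in> A"
    by (auto simp: A_def functional_zero f intro!: exI[of _ 0])
  have A_add: "(\<lambda>i. t i + s i) \<in> A" if ts: "t \<in> A" "s \<in> A" for t s
    unfolding A_def
  proof (clarify)
    fix e :: real assume "e > 0"
    then have "e / 2 > 0" by simp
    then obtain v w where "\<forall>i\<in>I. \<bar>f i v - t i\<bar> < e / 2" "\<forall>i\<in>I. \<bar>f i w - s i\<bar> < e / 2"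
      using A_D[OF ts(1), of "e / 2"] A_D[OF ts(2), of "e / 2"] by blast
    then have "\<bar>f i v - t i\<bar> < e / 2" "\<bar>f i w - s i\<bar> < e / 2" if "i \<in> I" for i
      using that by blast+
    then have "\<bar>f i (v + w) - (t i + s i)\<bar> < e" if "i \<in> I" for i
      unfolding functional_add[OF f[OF that]] using that by (smt (verit) field_sum_of_halves)
    then show "\<exists>v. \<forall>i\<in>I. \<bar>f i v - (t i + s i)\<bar> < e" by blast
  qed
  have A_scale: "(\<lambda>i. r * t i) \<in> A" if t: "t \<in> A" for r t
    unfolding A_def
  proof (clarify)
    fix e :: real assume e: "e > 0"
    \<comment> \<open>\<open>T\<close> bounds all entries of \<open>t\<close>. Replacing
      \<open>r\<close> by the rational \<open>q\<close> costs less than \<open>e / 2\<close>, and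
      approximating \<open>t\<close> within \<open>d\<close> before multiplying by \<open>q\<close>
      at most another \<open>e / 2\<close>.\<close>
    define T where "T = 1 + (\<Sum>i\<in>I. \<bar>t i\<bar>)"
    have T: "\<bar>t i\<bar> \<le> T" if "i \<in> I" for i
      using member_le_sum[of i I "\<lambda>i. \<bar>t i\<bar>"] that I by (simp add: T_def)
    have "T > 0"
      by (simp add: T_def add_pos_nonneg sum_nonneg)
    obtain q where q: "r < of_rat q" "of_rat q < r + e / (2 * T)"
      using of_rat_dense[of r "r + e / (2 * T)"] \<open>T > 0\<close> e by auto
    define a :: real where "a = \<bar>of_rat q\<bar> + 1"
    have a: "a > 0" "\<bar>of_rat q\<bar> \<le> a"
      by (simp_all add: a_def add_nonneg_pos)
    define d where "d = e / (2 * a)"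
    have "d > 0"
      using e a by (simp add: d_def)
    then obtain v where v: "\<forall>i\<in>I. \<bar>f i v - t i\<bar> < d"
      using t unfolding A_def by blast
    have "\<bar>f i (q *s v) - r * t i\<bar> < e" if i: "i \<in> I" for i
    proof -
      have "f i (q *s v) - r * t i = of_rat q * (f i v - t i) + (of_rat q - r) * t i"
        using f i by (simp add: functional_scale algebra_simps)
      then have "\<bar>f i (q *s v) - r * t i\<bar> \<le> \<bar>of_rat q\<bar> * \<bar>f i v - t i\<bar> + (of_rat q - r) * \<bar>t i\<bar>"
        using q(1) by (metis abs_mult abs_of_pos abs_triangle_ineq diff_gt_0_iff_gt)
      also have "(of_rat q - r) * \<bar>t i\<bar> \<le> (of_rat q - r) * T"
        using q(1) T i by (intro mult_left_mono) auto
      also have "(of_rat q - r) * T < e / (2 * T) * T"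
        using q(2) \<open>T > 0\<close> by (intro mult_strict_right_mono) auto
      also have "e / (2 * T) * T = e / 2"
        using \<open>T > 0\<close> by simp
      also have "\<bar>of_rat q\<bar> * \<bar>f i v - t i\<bar> \<le> a * d"
        using v i a by (intro mult_mono) (auto intro: less_imp_le)
      also have "a * d = e / 2"
        using a by (simp add: d_def)
      finally show ?thesis by simp
    qed
    then show "\<exists>v. \<forall>i\<in>I. \<bar>f i v - r * t i\<bar> < e" by blast
  qed
  have A_sum: "(\<lambda>i. \<Sum>j\<in>J. c j * D j i) \<in> A" if "finite J" "\<And>j. j \<in> J \<Longrightarrow> D j \<in> A" for J :: "'i set" and c D
    using that by (induction J rule: finite_induct) (simp_all add: A_zero A_add A_scale)
  have A_diff: "(\<lambda>i. t i - r * s i) \<in> A" if "t \<in> A" "s \<in> A" for t s r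
    using A_add[OF that(1) A_scale[OF that(2), of "- r"]] by simp
  \<comment> \<open>Gaussian elimination inside \<open>A\<close>: a dual family for \<open>J\<close>
    is enlarged by one index at a time.\<close>
  have dual: "\<exists>D. \<forall>j\<in>J. D j \<in> A \<and> (\<forall>i\<in>J. D j i = (if i = j then 1 else 0))" if "J \<subseteq> I" for J
    using finite_subset[OF that I] that
  proof (induction J rule: finite_induct)
    case empty
    then show ?case by simp
  next
    case (insert m J)
    then obtain D where D: "\<And>j. j \<in> J \<Longrightarrow> D j \<in> A"
      "\<And>i j. i \<in> J \<Longrightarrow> j \<in> J \<Longrightarrow> D j i = (if i = j then 1 else 0)"
      by auto
    \<comment> \<open>Otherwise \<open>f m\<close> would be the combination of the
      \<open>f j\<close> with coefficients \<open>D j m\<close>, against independence.\<close>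
    have "\<exists>v. f m v - (\<Sum>j\<in>J. D j m * f j v) \<noteq> 0"
    proof (rule ccontr)
      assume neg: "\<nexists>v. f m v - (\<Sum>j\<in>J. D j m * f j v) \<noteq> 0"
      define c where "c i = (if i = m then 1 else if i \<in> J then - D i m else 0)" for i
      have "(\<Sum>i\<in>I. c i * f i v) = 0" for v
      proof -
        have "(\<Sum>i\<in>I. c i * f i v) = (\<Sum>i\<in>insert m J. c i * f i v)"
          using insert.prems I by (intro sum.mono_neutral_right) (auto simp: c_def)
        also have "\<dots> = f m v + (\<Sum>i\<in>J. c i * f i v)"
          using insert.hyps by (simp add: c_def)
        also have "(\<Sum>i\<in>J. c i * f i v) = (\<Sum>i\<in>J. - (D i m * f i v))"
          using insert.hyps by (intro sum.cong) (auto simp: c_def)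
        finally show ?thesis
          using neg by (simp add: sum_negf)
      qed
      then have "c m = 0"
        using indep insert.prems by blast
      then show False by (simp add: c_def)
    qed
    then obtain v where v: "f m v - (\<Sum>j\<in>J. D j m * f j v) \<noteq> 0" by blast
    define s where "s = f m v - (\<Sum>j\<in>J. D j m * f j v)"
    \<comment> \<open>The value tuple of \<open>v\<close> is cleared at the indices in
      \<open>J\<close> and normalised at \<open>m\<close>; the factor \<open>1\<close> matches the
      shape of \<open>A_diff\<close>.\<close>
    define E where "E = (\<lambda>i. (1 / s) * (f i v - 1 * (\<Sum>j\<in>J. f j v * D j i)))"
    have EA: "E \<in> A"
      unfolding E_def using insert.hyps D by (intro A_scale A_diff A_mem A_sum) auto
    have EJ: "E i = 0" if "i \<in> J" for i
    proof -
      have "(\<Sum>j\<in>J. f j v * D j i) = (\<Sum>j\<in>J. if j = i then f j v else 0)"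
        using that D by (intro sum.cong) auto
      then show ?thesis
        using that insert.hyps by (simp add: E_def)
    qed
    have "(\<Sum>j\<in>J. f j v * D j m) = (\<Sum>j\<in>J. D j m * f j v)"
      by (simp add: mult.commute)
    then have Em: "E m = 1"
      using v by (simp add: E_def s_def)
    \<comment> \<open>Subtracting a multiple of \<open>E\<close> clears the entry of
      \<open>D j\<close> at \<open>m\<close>.\<close>
    define D' where "D' j = (if j = m then E else (\<lambda>i. D j i - D j m * E i))" for j
    have "\<forall>j\<in>insert m J. D' j \<in> A \<and> (\<forall>i\<in>insert m J. D' j i = (if i = j then 1 else 0))"
      using EA EJ Em D insert.hyps by (auto simp: D'_def intro!: A_diff)
    then show ?case by blast
  qed
  obtain D where D: "\<And>j. j \<in> I \<Longrightarrow> D j \<in> A"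
    "\<And>i j. i \<in> I \<Longrightarrow> j \<in> I \<Longrightarrow> D j i = (if i = j then 1 else 0)"
    using dual[of I] by auto
  have "(\<lambda>i. \<Sum>j\<in>I. t j * D j i) \<in> A"
    using I D by (intro A_sum)
  moreover have "(\<Sum>j\<in>I. t j * D j i) = t i" if "i \<in> I" for i
  proof -
    have "(\<Sum>j\<in>I. t j * D j i) = (\<Sum>j\<in>I. if j = i then t j else 0)"
      using that D by (intro sum.cong) auto
    then show ?thesis using that I by simp
  qed
  ultimately show ?thesis
    using e unfolding A_def by (fastforce)
qed

section \<open>Bases of the real dual of V/N and the exchange of basis vectors\<close>

definition functional_basis :: "'v set \<Rightarrow> 'i set \<Rightarrow> ('i \<Rightarrow> 'v \<Rightarrow> real) \<Rightarrow> bool"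
  where "functional_basis N I f \<longleftrightarrow> finite I \<and>
    (\<forall>i\<in>I. functional (f i) \<and> (\<forall>x\<in>N. f i x = 0)) \<and>
    (\<forall>c. (\<forall>v. (\<Sum>i\<in>I. c i * f i v) = 0) \<longrightarrow> (\<forall>i\<in>I. c i = 0)) \<and>
    (\<forall>h. functional h \<and> (\<forall>x\<in>N. h x = 0) \<longrightarrow> (\<exists>c. \<forall>v. h v = (\<Sum>i\<in>I. c i * f i v)))"

text \<open>If the \<open>f j\<close> are read as coordinates with respect to a real dual basis,
  these are the coordinates after the \<open>i\<close>-th basis vector has been replaced by
  \<open>b\<close>.\<close>

definition exchange :: "('i \<Rightarrow> 'v \<Rightarrow> real) \<Rightarrow> 'i \<Rightarrow> 'v \<Rightarrow> 'i \<Rightarrow> 'v \<Rightarrow> real"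
  where "exchange f i b j v = (if j = i then f i v / f i b else f j v - f i v / f i b * f j b)"

lemma exchange_inverse:
  assumes "f i b \<noteq> 0"
  shows "f j v = (if j = i then 0 else exchange f i b j v) + f j b * exchange f i b i v"
  using assms by (simp add: exchange_def)

text \<open>The change of coordinates is invertible because \<open>f i b\<close> is nonzero, so
  independence and spanning carry over by rewriting coefficients.\<close>

lemma functional_basis_exchange:
  assumes f: "functional_basis N I f" and i: "i \<in> I" and b: "f i b \<noteq> 0"
  shows "functional_basis N I (exchange f i b)"
proof -
  have I: "finite I" and lin: "\<And>j. j \<in> I \<Longrightarrow> functional (f j)"
    and N: "\<And>j x. j \<in> I \<Longrightarrow> x \<in> N \<Longrightarrow> f j x = 0"
    and indep: "\<And>c. (\<And>v. (\<Sum>i\<in>I. c i * f i v) = 0) \<Longrightarrow> \<forall>i\<in>I. c i = 0"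
    and spn: "\<And>h. functional h \<Longrightarrow> (\<And>x. x \<in> N \<Longrightarrow> h x = 0) \<Longrightarrow> \<exists>c. \<forall>v. h v = (\<Sum>i\<in>I. c i * f i v)"
    using f unfolding functional_basis_def by blast+
  show ?thesis
    unfolding functional_basis_def
  proof (intro conjI ballI allI impI)
    show "finite I" by fact
  next
    fix j assume j: "j \<in> I"
    show "functional (exchange f i b j)"
      using functional_combine[OF lin[OF i] lin[OF i], of "1 / f i b" 0]
        functional_combine[OF lin[OF j] lin[OF i], of 1 "- (f j b / f i b)"]
      by (cases "j = i") (simp_all add: exchange_def[abs_def] mult.commute)
    show "exchange f i b j x = 0" if "x \<in> N" for x
      using that j i N by (simp add: exchange_def)
  next
    fix c j assume c: "\<forall>v. (\<Sum>j\<in>I. c j * exchange f i b j v) = 0" and j: "j \<in> I"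
    \<comment> \<open>These are the coefficients of the given combination after regrouping it along
      \<open>f\<close>.\<close>
    define d where "d = (\<lambda>k. if k = i then (c i - (\<Sum>j\<in>I - {i}. c j * f j b)) / f i b else c k)"
    have "(\<Sum>k\<in>I. d k * f k v) = (\<Sum>j\<in>I. c j * exchange f i b j v)" for v
    proof -
      have "(\<Sum>k\<in>I. d k * f k v) = d i * f i v + (\<Sum>k\<in>I - {i}. c k * f k v)"
        using I i by (simp add: sum.remove[of I i] d_def)
      also have "d i * f i v = c i * exchange f i b i v - (\<Sum>k\<in>I - {i}. c k * (f i v / f i b * f k b))"
        using b by (simp add: d_def exchange_def diff_divide_distrib algebra_simps sum_distrib_left sum_distrib_right
            sum_divide_distrib)
      finally have "(\<Sum>k\<in>I. d k * f k v) = c i * exchange f i b i v + (\<Sum>k\<in>I - {i}. c k * (f k v - f i v / f i b * f k b))"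
        by (simp add: right_diff_distrib sum_subtractf)
      also have "(\<Sum>k\<in>I - {i}. c k * (f k v - f i v / f i b * f k b)) = (\<Sum>k\<in>I - {i}. c k * exchange f i b k v)"
        by (intro sum.cong) (auto simp: exchange_def)
      finally show ?thesis
        using I i by (simp add: sum.remove[of I i])
    qed
    then have d: "\<forall>k\<in>I. d k = 0"
      using indep c by simp
    then have 1: "c k = 0" if "k \<in> I - {i}" for k
      using that by (auto simp: d_def split: if_splits)
    then have "(\<Sum>j\<in>I - {i}. c j * f j b) = 0"
      by (intro sum.neutral) simp
    then have "c i = 0"
      using d i b by (auto simp: d_def)
    then show "c j = 0"
      using 1 j by (cases "j = i") auto
  next
    fix h assume "functional h \<and> (\<forall>x\<in>N. h x = 0)"
    then obtain c where c: "\<And>v. h v = (\<Sum>j\<in>I. c j * f j v)"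
      using spn by blast
    \<comment> \<open>Only the coefficient at \<open>i\<close> changes: by
      \<open>exchange_inverse\<close> it collects the values \<open>f j b\<close> and becomes
      \<open>h b\<close>.\<close>
    define d where "d = (\<lambda>k. if k = i then (\<Sum>j\<in>I. c j * f j b) else c k)"
    have "h v = (\<Sum>j\<in>I. d j * exchange f i b j v)" for v
    proof -
      have "h v = (\<Sum>j\<in>I. c j * ((if j = i then 0 else exchange f i b j v) + f j b * exchange f i b i v))"
        unfolding c by (intro sum.cong refl arg_cong2[where f = "(*)"] exchange_inverse b)
      also have "\<dots> = (\<Sum>j\<in>I. c j * (if j = i then 0 else exchange f i b j v)) + (\<Sum>j\<in>I. c j * f j b) * exchange f i b i v"
        by (simp add: distrib_left sum.distrib sum_distrib_right mult.assoc)
      also have "(\<Sum>j\<in>I. c j * (if j = i then 0 else exchange f i b j v)) = (\<Sum>j\<in>I - {i}. d j * exchange f i b j v)"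
        using I by (intro sum.mono_neutral_cong_right) (auto simp: d_def)
      finally show ?thesis
        using I i by (simp add: sum.remove[of I i] d_def)
    qed
    then show "\<exists>c. \<forall>v. h v = (\<Sum>j\<in>I. c j * exchange f i b j v)" by blast
  qed
qed

text \<open>A real dual basis of \<open>f\<close> need not lie in \<open>V\<close>. Vectors of
  \<open>V\<close> are exchanged in for the indices of \<open>T\<close> one after the other, each
  close enough to a coordinate direction to keep \<open>F\<close> positive. The region where all
  \<open>g i\<close> are positive stays inside the one for \<open>f\<close>, which makes the new
  vectors positive under \<open>f\<close>.\<close>

lemma exchange_all:
  fixes f :: "'i \<Rightarrow> 'v \<Rightarrow> real"
  assumes f: "functional_basis N I f" and F: "finite F" "\<And>x i. x \<in> F \<Longrightarrow> i \<in> I \<Longrightarrow> 0 < f i x"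
    and T: "T \<subseteq> I"
  shows "\<exists>g b. functional_basis N I g \<and> (\<forall>x\<in>F. \<forall>i\<in>I. 0 < g i x) \<and>
    (\<forall>v. (\<forall>i\<in>I. 0 < g i v) \<longrightarrow> (\<forall>i\<in>I. 0 < f i v)) \<and>
    (\<forall>j\<in>T. \<forall>i\<in>I. g i (b j) = (if i = j then 1 else 0) \<and> 0 < f i (b j))"
proof -
  have "finite I"
    using f by (simp add: functional_basis_def)
  then have "finite T"
    using T by (metis finite_subset)
  then show ?thesis
    using T
  proof (induction T rule: finite_induct)
    case empty
    then show ?case using f F by blast
  next
    case (insert m T)
    then obtain g b where g: "functional_basis N I g" "\<And>x i. x \<in> F \<Longrightarrow> i \<in> I \<Longrightarrow> 0 < g i x"
      "\<And>v. (\<And>i. i \<in> I \<Longrightarrow> 0 < g i v) \<Longrightarrow> (\<forall>i\<in>I. 0 < f i v)"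
      "\<And>i j. j \<in> T \<Longrightarrow> i \<in> I \<Longrightarrow> g i (b j) = (if i = j then 1 else 0)"
      "\<And>i j. j \<in> T \<Longrightarrow> i \<in> I \<Longrightarrow> 0 < f i (b j)"
      by (simp add: insert.IH) blast
    have m: "m \<in> I" "m \<notin> T"
      using insert by auto
    \<comment> \<open>\<open>e\<close> will be a quarter of the least ratio, so that off-diagonal
      entries below \<open>2 * e\<close> cannot outweigh the coordinates of a point of
      \<open>F\<close>. The inserted 1 keeps the set nonempty and gives
      \<open>e \<le> 1 / 4\<close>.\<close>
    define R where "R = insert 1 ((\<lambda>(x, i). g i x / g m x) ` (F \<times> I))"
    define e where "e = Min R / 4"
    have R: "finite R" "R \<noteq> {}"
      using F \<open>finite I\<close> by (auto simp: R_def)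
    have "0 < Min R"
      using R g(2) m by (subst Min_gr_iff) (auto simp: R_def)
    then have "0 < e" by (simp add: e_def)
    have "Min R \<le> 1"
      using R by (intro Min_le) (auto simp: R_def)
    then have e: "0 < e" "e \<le> 1 / 4"
      using \<open>0 < e\<close> by (simp_all add: e_def)
    have eR: "4 * e \<le> g i x / g m x" if "x \<in> F" "i \<in> I" for x i
      unfolding e_def using R that by (auto simp: R_def intro!: Min_le)
    \<comment> \<open>Density yields \<open>v\<close> whose \<open>m\<close>-th coordinate exceeds 1
      while all others lie strictly between 0 and \<open>2 * e\<close>.\<close>
    have "\<exists>v. \<forall>i\<in>I. \<bar>g i v - (if i = m then 2 else e)\<bar> < e"
      using g(1) e by (intro functionals_dense) (auto simp: functional_basis_def)
    then obtain v where v: "\<And>i. i \<in> I \<Longrightarrow> \<bar>g i v - (if i = m then 2 else e)\<bar> < e"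
      by blast
    have vm: "1 < g m v"
      using v[OF m(1)] e by auto
    have vp: "0 < g i v" "i \<noteq> m \<Longrightarrow> g i v < 2 * e" if "i \<in> I" for i
      using v[OF that] e vm by (auto split: if_splits)
    let ?g = "exchange g m v" and ?b = "b(m := v)"
    have "0 < ?g i x" if x: "x \<in> F" and i: "i \<in> I" for x i
    proof (cases "i = m")
      case True
      then show ?thesis
        using vm g(2)[OF x m(1)] by (simp add: exchange_def)
    next
      case False
      have gm: "0 < g m x" using g(2) x m by blast
      have "g m x / g m v * g i v < g m x * (2 * e)"
      proof -
        have "g m x / g m v \<le> g m x"
          using gm vm by (simp add: divide_le_eq)
        then have "g m x / g m v * g i v \<le> g m x * g i v"
          using vp(1)[OF i] by (intro mult_right_mono) auto
        also have "\<dots> < g m x * (2 * e)"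
          using gm vp(2)[OF i False] by simp
        finally show ?thesis .
      qed
      also have "\<dots> \<le> g m x * (4 * e)"
        using gm e by simp
      also have "\<dots> \<le> g m x * (g i x / g m x)"
        using gm eR[OF x i] by (intro mult_left_mono) auto
      also have "\<dots> = g i x"
        using gm by simp
      finally show ?thesis
        using False by (simp add: exchange_def)
    qed
    \<comment> \<open>By \<open>exchange_inverse\<close>, \<open>g i w\<close> is a nonnegative
      number plus \<open>g i v\<close> times the new \<open>m\<close>-th coordinate, and
      \<open>g i v\<close> is positive.\<close>
    moreover have "\<forall>i\<in>I. 0 < f i w" if w: "\<forall>i\<in>I. 0 < ?g i w" for w
    proof (rule g(3))
      fix i assume i: "i \<in> I"
      have "g i w = (if i = m then 0 else ?g i w) + g i v * ?g m w"
        using vm by (intro exchange_inverse) simp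
      moreover have "0 < g i v * ?g m w"
        using vp(1)[OF i] w m by simp
      ultimately show "0 < g i w"
        using w i by (auto split: if_splits intro: add_pos_pos)
    qed
    moreover have "?g i (?b j) = (if i = j then 1 else 0) \<and> 0 < f i (?b j)"
      if j: "j \<in> insert m T" and i: "i \<in> I" for i j
    proof (cases "j = m")
      case True
      then show ?thesis
        using g(3)[of v] vp(1) vm i by (auto simp: exchange_def)
    next
      case False
      \<comment> \<open>Here \<open>g m (b j) = 0\<close>, so the exchange leaves the coordinates of
        the earlier vectors unchanged.\<close>
      then have "j \<in> T" using j by simp
      then show ?thesis
        using False g(4)[of j] g(5)[of j] i m by (auto simp: exchange_def)
    qed
    ultimately show ?case
      using functional_basis_exchange[OF g(1) m(1), of v] vm
      by (intro exI[of _ ?g] exI[of _ ?b]) auto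
  qed
qed

text \<open>Exchanging at all indices yields vectors \<open>b\<close> of \<open>V\<close> and a
  functional basis \<open>g\<close> dual to them. So \<open>g j\<close> reads off the rational
  coefficients along \<open>b\<close>, and these are positive on \<open>F\<close> because
  \<open>g\<close> is.\<close>

lemma functional_basis_simplex:
  fixes f :: "'i \<Rightarrow> 'v \<Rightarrow> real"
  assumes f: "functional_basis N I f" and F: "finite F" "\<And>x i. x \<in> F \<Longrightarrow> i \<in> I \<Longrightarrow> 0 < f i x"
    and N: "subspace N"
  obtains b where "\<And>i j. i \<in> I \<Longrightarrow> j \<in> I \<Longrightarrow> 0 < f i (b j)"
    "\<And>c. (\<Sum>i\<in>I. c i *s b i) \<in> N \<Longrightarrow> \<forall>i\<in>I. c i = 0"
    "\<And>x. x \<in> F \<Longrightarrow> \<exists>c. (\<forall>i\<in>I. 0 \<le> c i) \<and> x - (\<Sum>i\<in>I. c i *s b i) \<in> N"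
proof -
  obtain g b where g: "functional_basis N I g" "\<And>x i. x \<in> F \<Longrightarrow> i \<in> I \<Longrightarrow> 0 < g i x"
    and gb: "\<And>i j. j \<in> I \<Longrightarrow> i \<in> I \<Longrightarrow> g i (b j) = (if i = j then 1 else 0)"
    and fb: "\<And>i j. j \<in> I \<Longrightarrow> i \<in> I \<Longrightarrow> 0 < f i (b j)"
    using exchange_all[OF f F subset_refl] by blast
  have I: "finite I" and lin: "\<And>j. j \<in> I \<Longrightarrow> functional (g j)"
    and gN: "\<And>j x. j \<in> I \<Longrightarrow> x \<in> N \<Longrightarrow> g j x = 0"
    and spn: "\<And>h. functional h \<Longrightarrow> (\<And>x. x \<in> N \<Longrightarrow> h x = 0) \<Longrightarrow> \<exists>c. \<forall>v. h v = (\<Sum>i\<in>I. c i * g i v)"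
    using g(1) unfolding functional_basis_def by blast+
  have coord: "g j (\<Sum>i\<in>I. c i *s b i) = of_rat (c j)" if "j \<in> I" for c j
  proof -
    have "g j (\<Sum>i\<in>I. c i *s b i) = (\<Sum>i\<in>I. if i = j then of_rat (c i) else 0)"
      unfolding functional_linear_comb[OF lin[OF that]]
      using that by (intro sum.cong) (auto simp: gb)
    then show ?thesis using that I by simp
  qed
  \<comment> \<open>\<open>U\<close> is \<open>N\<close> plus the rational span of \<open>b\<close>;
    separation will show that it is all of \<open>V\<close>.\<close>
  define U where "U = {x. \<exists>c. x - (\<Sum>i\<in>I. c i *s b i) \<in> N}"
  have subU: "subspace U"
  proof (rule subspaceI)
    show "0 \<in> U"
      using subspace_0[OF N] by (auto simp: U_def intro!: exI[of _ "\<lambda>_. 0"])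
    fix x y assume "x \<in> U" "y \<in> U"
    then obtain c d where "x - (\<Sum>i\<in>I. c i *s b i) \<in> N" "y - (\<Sum>i\<in>I. d i *s b i) \<in> N"
      by (auto simp: U_def)
    then have "(x - (\<Sum>i\<in>I. c i *s b i)) + (y - (\<Sum>i\<in>I. d i *s b i)) \<in> N"
      using subspace_add[OF N] by blast
    then have "x + y - (\<Sum>i\<in>I. (c i + d i) *s b i) \<in> N"
      by (simp add: scale_left_distrib sum.distrib algebra_simps)
    then show "x + y \<in> U" by (auto simp: U_def)
  next
    fix q x assume "x \<in> U"
    then obtain c where "x - (\<Sum>i\<in>I. c i *s b i) \<in> N"
      by (auto simp: U_def)
    then have "q *s (x - (\<Sum>i\<in>I. c i *s b i)) \<in> N"
      using subspace_scale[OF N] by blast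
    then have "q *s x - (\<Sum>i\<in>I. (q * c i) *s b i) \<in> N"
      by (simp add: scale_right_diff_distrib scale_sum_right)
    then show "q *s x \<in> U" by (auto simp: U_def)
  qed
  have NU: "N \<subseteq> U"
    by (auto simp: U_def intro!: exI[of _ "\<lambda>_. 0"])
  have bU: "b j \<in> U" if "j \<in> I" for j
  proof -
    have "(\<Sum>i\<in>I. (if i = j then 1 else 0) *s b i) = (\<Sum>i\<in>I. if i = j then b i else 0)"
      by (intro sum.cong) auto
    then have "b j - (\<Sum>i\<in>I. (if i = j then 1 else 0) *s b i) \<in> N"
      using that I subspace_0[OF N] by simp
    then show ?thesis
      unfolding U_def by (intro CollectI exI)
  qed
  have UU: "x \<in> U" for x
  proof (rule ccontr)
    assume "x \<notin> U"
    then obtain h where h: "functional h" "\<And>u. u \<in> U \<Longrightarrow> h u = 0" "h x \<noteq> 0"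
      using separating_functional subU by blast
    then obtain c where c: "\<And>v. h v = (\<Sum>i\<in>I. c i * g i v)"
      using spn[of h] NU by blast
    \<comment> \<open>\<open>h\<close> vanishes at \<open>b j\<close>, and its value there is
      exactly the coefficient of \<open>g j\<close>.\<close>
    have "c j = 0" if "j \<in> I" for j
    proof -
      have "(\<Sum>i\<in>I. c i * g i (b j)) = (\<Sum>i\<in>I. if i = j then c i else 0)"
        using that by (intro sum.cong) (auto simp: gb)
      then show ?thesis
        using c[of "b j"] h(2)[OF bU[OF that]] that I by simp
    qed
    then show False
      using h(3) c[of x] by simp
  qed
  show ?thesis
  proof
    show "0 < f i (b j)" if "i \<in> I" "j \<in> I" for i j
      using fb that by blast
    show "\<forall>i\<in>I. c i = 0" if "(\<Sum>i\<in>I. c i *s b i) \<in> N" for c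
      using coord[of _ c] gN[OF _ that] by auto
    fix x assume x: "x \<in> F"
    obtain c where c: "x - (\<Sum>i\<in>I. c i *s b i) \<in> N"
      using UU[of x] by (auto simp: U_def)
    have "0 \<le> c i" if i: "i \<in> I" for i
    proof -
      have "g i x - of_rat (c i) = 0"
        using gN[OF i c] functional_diff[OF lin[OF i]] coord[OF i] by simp
      then have "0 < (of_rat (c i) :: real)"
        using g(2)[OF x i] by simp
      then show ?thesis by simp
    qed
    then show "\<exists>c. (\<forall>i\<in>I. 0 \<le> c i) \<and> x - (\<Sum>i\<in>I. c i *s b i) \<in> N"
      using c by blast
  qed
qed

end

section \<open>Extension to a basis of functionals positive on a finite set\<close>

lemma sum_fun_apply: "(\<Sum>i\<in>I. f i) x = (\<Sum>i\<in>I. f i x)"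
  by (induction I rule: infinite_finite_induct) simp_all

context rat_space
begin

text \<open>Among the independent sets containing \<open>X\<close> whose members vanish on
  \<open>N\<close> and are positive on \<open>F\<close>, a largest one spans: a functional outside
  its span becomes positive on \<open>F\<close> after adding a large multiple of a member of
  \<open>X\<close>.\<close>

lemma functional_basis_extend:
  assumes X: "X \<noteq> {}" "\<And>f. f \<in> X \<Longrightarrow> functional f" "\<And>f x. f \<in> X \<Longrightarrow> x \<in> N \<Longrightarrow> f x = 0"
    and indep: "\<And>J c. finite J \<Longrightarrow> J \<subseteq> X \<Longrightarrow> (\<And>v. (\<Sum>f\<in>J. c f * f v) = 0) \<Longrightarrow> \<forall>f\<in>J. c f = 0"
    and F: "finite F" "\<And>x f. x \<in> F \<Longrightarrow> f \<in> X \<Longrightarrow> 0 < f x"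
  obtains S where "X \<subseteq> S" "functional_basis N S (\<lambda>f. f)" "\<And>x f. x \<in> F \<Longrightarrow> f \<in> S \<Longrightarrow> 0 < f x"
proof -
  interpret R: vector_space "\<lambda>(r::real) (f :: 'v \<Rightarrow> real) v. r * f v"
    by unfold_locales (auto simp: fun_eq_iff algebra_simps)
  \<comment> \<open>The coordinate functionals of \<open>Basis\<close> span all functionals, which
    bounds the size of independent sets.\<close>
  define E where "E = (\<lambda>b v. of_rat (representation Basis v b) :: real) ` Basis"
  have fE: "f \<in> R.span E" if f: "functional f" for f
  proof -
    have eq: "f v = (\<Sum>b\<in>Basis. f b * of_rat (representation Basis v b))" for v
    proof -
      have "v = (\<Sum>b\<in>Basis. representation Basis v b *s b)"
        using sum_representation_eq[OF independent_Basis _ finite_Basis subset_refl, of v] span_Basis by simp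
      then have "f v = f (\<Sum>b\<in>Basis. representation Basis v b *s b)"
        by (rule arg_cong)
      then show ?thesis
        unfolding functional_linear_comb[OF f] by (simp only: mult.commute)
    qed
    have "f = (\<Sum>b\<in>Basis. (\<lambda>v. f b * of_rat (representation Basis v b)))"
      by (intro ext) (simp only: sum_fun_apply, rule eq)
    also have "\<dots> \<in> R.span E"
      by (intro R.span_sum R.span_scale R.span_base) (auto simp: E_def)
    finally show ?thesis .
  qed
  define P where "P S \<longleftrightarrow> X \<subseteq> S \<and> (\<forall>f\<in>S. functional f \<and> (\<forall>x\<in>N. f x = 0) \<and> (\<forall>x\<in>F. 0 < f x)) \<and> R.independent S" for S
  have bound: "finite S \<and> card S \<le> card E" if "P S" for S
    using that fE by (intro R.independent_span_bound) (auto simp: P_def E_def finite_Basis)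
  have "R.independent X"
  proof (subst R.independent_explicit_finite_subsets, intro allI impI ballI)
    fix J c f assume J: "J \<subseteq> X" "finite J" "(\<Sum>f\<in>J. (\<lambda>v. c f * f v)) = 0" "f \<in> J"
    have "(\<Sum>f\<in>J. c f * f v) = 0" for v
      using fun_cong[OF J(3), of v] by (simp add: sum_fun_apply)
    then show "c f = 0"
      using indep J by blast
  qed
  then have "P X"
    using X F by (simp add: P_def)
  then have "\<exists>S. P S \<and> (\<forall>T. P T \<longrightarrow> card T \<le> card S)"
    using bound by (intro ex_has_greatest_nat[of P X card "Suc (card E)"]) (auto simp: le_imp_less_Suc)
  then obtain S where S: "P S" "\<And>T. P T \<Longrightarrow> card T \<le> card S" by blast
  have finS: "finite S" using bound S by blast
  have spn: "h \<in> R.span S" if h: "functional h" "\<And>x. x \<in> N \<Longrightarrow> h x = 0" for h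
  proof (rule ccontr)
    assume hS: "h \<notin> R.span S"
    obtain s where s: "s \<in> X" using X by blast
    \<comment> \<open>\<open>K * s\<close> exceeds the absolute value of \<open>h\<close> on
      \<open>F\<close>, as each quotient is one of the summands; the 1 makes the bound
      strict.\<close>
    define K where "K = 1 + (\<Sum>x\<in>F. \<bar>h x\<bar> / s x)"
    define g where "g = (\<lambda>v. 1 * h v + K * s v)"
    have "s \<in> S" using s S(1) by (auto simp: P_def)
    have gS: "g \<notin> R.span S"
    proof
      assume "g \<in> R.span S"
      then have "g - (\<lambda>v. K * s v) \<in> R.span S"
        by (rule R.span_diff[OF _ R.span_scale[OF R.span_base[OF \<open>s \<in> S\<close>]]])
      moreover have "g - (\<lambda>v. K * s v) = h"
        by (simp add: g_def fun_eq_iff)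
      ultimately show False using hS by simp
    qed
    then have "g \<notin> S"
      using R.span_base by blast
    have ind: "R.independent (insert g S)"
      using R.independent_insertI[OF gS] S(1) by (simp add: P_def)
    have "0 < g x" if x: "x \<in> F" for x
    proof -
      have sx: "0 < s x" using x s F by blast
      have "\<bar>h x\<bar> / s x \<le> (\<Sum>x\<in>F. \<bar>h x\<bar> / s x)"
        using x F s by (intro member_le_sum) (auto intro: divide_nonneg_pos)
      then have "\<bar>h x\<bar> / s x < K" by (simp add: K_def)
      then have "\<bar>h x\<bar> < K * s x"
        using sx by (simp add: divide_less_eq)
      then show ?thesis by (simp add: g_def)
    qed
    moreover have "functional g"
      unfolding g_def using h s X by (intro functional_combine) auto
    moreover have "g x = 0" if "x \<in> N" for x
      using that h s X by (simp add: g_def)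
    ultimately have "P (insert g S)"
      using S(1) ind by (auto simp: P_def)
    then show False
      using S(2)[of "insert g S"] finS \<open>g \<notin> S\<close> by simp
  qed
  have "functional_basis N S (\<lambda>f. f)"
    unfolding functional_basis_def
  proof (intro conjI allI impI)
    show "finite S" by fact
    show "\<forall>f\<in>S. functional f \<and> (\<forall>x\<in>N. f x = 0)"
      using S(1) by (auto simp: P_def)
  next
    fix c assume "\<forall>v. (\<Sum>f\<in>S. c f * f v) = 0"
    then have "(\<Sum>f\<in>S. (\<lambda>v. c f * f v)) = 0"
      by (simp add: fun_eq_iff sum_fun_apply)
    moreover have "R.independent S"
      using S(1) by (simp add: P_def)
    ultimately show "\<forall>f\<in>S. c f = 0"
      using finS by (auto simp: R.independent_explicit_finite_subsets)
  next
    fix h assume "functional h \<and> (\<forall>x\<in>N. h x = 0)"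
    then have "h \<in> R.span S" using spn by blast
    then obtain c where "h = (\<Sum>f\<in>S. (\<lambda>v. c f * f v))"
      using finS by (auto simp: R.span_finite)
    then show "\<exists>c. \<forall>v. h v = (\<Sum>f\<in>S. c f * f v)"
      by (auto simp: sum_fun_apply)
  qed
  then show ?thesis
    using that[of S] S(1) by (auto simp: P_def)
qed

section \<open>Sublinear functions and directional slopes\<close>

definition sublinear :: "('v \<Rightarrow> real) \<Rightarrow> bool"
  where "sublinear p \<longleftrightarrow> (\<forall>x y. p (x + y) \<le> p x + p y) \<and> (\<forall>q x. 0 \<le> q \<longrightarrow> p (q *s x) = of_rat q * p x)"

text \<open>The inequality for \<open>1 / q\<close> gives the converse inequality for
  \<open>q\<close>.\<close>

lemma sublinearI:
  assumes "\<And>x y. p (x + y) \<le> p x + p y" "p 0 = 0" "\<And>q x. 0 < q \<Longrightarrow> p (q *s x) \<le> of_rat q * p x"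
  shows "sublinear p"
  unfolding sublinear_def
proof (intro conjI allI impI)
  fix q :: rat and x assume "0 \<le> q"
  show "p (q *s x) = of_rat q * p x"
  proof (cases "q = 0")
    case True
    then show ?thesis using assms by simp
  next
    case False
    then have q: "0 < q" using \<open>0 \<le> q\<close> by simp
    have "p x \<le> of_rat (1 / q) * p (q *s x)"
      using assms(3)[of "1 / q" "q *s x"] q by simp
    then have "of_rat q * p x \<le> p (q *s x)"
      using q by (simp add: of_rat_divide field_simps)
    then show ?thesis using assms(3)[OF q, of x] by simp
  qed
qed (use assms in auto)

lemma sublinear_add: "sublinear p \<Longrightarrow> p (x + y) \<le> p x + p y"
  by (simp add: sublinear_def)

lemma sublinear_scale: "sublinear p \<Longrightarrow> 0 \<le> q \<Longrightarrow> p (q *s x) = of_rat q * p x"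
  by (simp add: sublinear_def)

lemma sublinear_zero: "sublinear p \<Longrightarrow> p 0 = 0"
  using sublinear_scale[of p 0 0] by simp

text \<open>The vectors on which \<open>p\<close> is odd form a subspace, so a basis suffices; an
  odd sublinear function is linear.\<close>

lemma sublinear_functional:
  assumes p: "sublinear p" and B: "\<And>b. b \<in> Basis \<Longrightarrow> p b + p (- b) \<le> 0"
  shows "functional p"
proof -
  have "subspace {v. p v + p (- v) \<le> 0}"
  proof (rule subspaceI)
    show "0 \<in> {v. p v + p (- v) \<le> 0}"
      by (simp add: p sublinear_zero)
    show "x + y \<in> {v. p v + p (- v) \<le> 0}" if "x \<in> {v. p v + p (- v) \<le> 0}" "y \<in> {v. p v + p (- v) \<le> 0}" for x y
      using that sublinear_add[OF p, of x y] sublinear_add[OF p, of "- x" "- y"] by simp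
    show "q *s x \<in> {v. p v + p (- v) \<le> 0}" if x: "x \<in> {v. p v + p (- v) \<le> 0}" for q x
    proof (cases "0 \<le> q")
      case True
      have "of_rat q * (p x + p (- x)) \<le> 0"
        using x True by (simp add: mult_nonneg_nonpos)
      then show ?thesis
        using sublinear_scale[OF p True, of x] sublinear_scale[OF p True, of "- x"] by (simp add: distrib_left)
    next
      case False
      then have q: "0 \<le> - q" by simp
      have "of_rat (- q) * (p x + p (- x)) \<le> 0"
        using x False by (simp add: mult_nonpos_nonpos mult_nonneg_nonpos del: of_rat_minus)
      then show ?thesis
        using sublinear_scale[OF p q, of x] sublinear_scale[OF p q, of "- x"] by (simp add: distrib_left)
    qed
  qed
  then have "span Basis \<subseteq> {v. p v + p (- v) \<le> 0}"
    using B by (intro span_minimal) auto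
  then have le: "p v + p (- v) \<le> 0" for v
    using span_Basis by blast
  have minus: "p (- v) = - p v" for v
    using le[of v] sublinear_add[OF p, of v "- v"] by (simp add: p sublinear_zero)
  show ?thesis
  proof (rule functionalI)
    show "p (x + y) = p x + p y" for x y
      using sublinear_add[OF p, of x y] sublinear_add[OF p, of "- x" "- y"] minus[of "x + y"] minus[of x] minus[of y]
      by simp
    show "p (q *s x) = of_rat q * p x" for q x
    proof (cases "0 \<le> q")
      case True
      then show ?thesis by (rule sublinear_scale[OF p])
    next
      case False
      then show ?thesis
        using sublinear_scale[OF p, of "- q" x] minus[of "q *s x"] by (simp add: of_rat_minus)
    qed
  qed
qed

text \<open>For sublinear \<open>p\<close> this is the one-sided derivative of \<open>p\<close> at
  \<open>v\<close> in direction \<open>x\<close>, with \<open>t\<close> the inverse of the step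
  length. A functional below it agrees with \<open>p\<close> at \<open>v\<close>.\<close>

definition slope :: "('v \<Rightarrow> real) \<Rightarrow> 'v \<Rightarrow> 'v \<Rightarrow> real"
  where "slope p v x = (INF t\<in>{0..}. p (x + t *s v) - of_rat t * p v)"

context
  fixes p :: "'v \<Rightarrow> real" and v :: 'v assumes p: "sublinear p"
begin

lemma slope_le: "0 \<le> t \<Longrightarrow> slope p v x \<le> p (x + t *s v) - of_rat t * p v"
proof -
  \<comment> \<open>A lower bound independent of \<open>t\<close>, so that the infimum is a genuine
    one.\<close>
  have "- p (- x) \<le> p (x + t *s v) - of_rat t * p v" if "0 \<le> t" for t
    using sublinear_add[OF p, of "x + t *s v" "- x"] sublinear_scale[OF p that, of v] by simp
  then show "0 \<le> t \<Longrightarrow> slope p v x \<le> p (x + t *s v) - of_rat t * p v"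
    unfolding slope_def by (intro cINF_lower bdd_belowI2[of _ "- p (- x)"]) auto
qed

lemma slope_greatest: "(\<And>t. 0 \<le> t \<Longrightarrow> a \<le> p (x + t *s v) - of_rat t * p v) \<Longrightarrow> a \<le> slope p v x"
  unfolding slope_def by (rule cINF_greatest) auto

lemma slope_le_self: "slope p v x \<le> p x"
  using slope_le[of 0 x] by simp

lemma slope_minus: "slope p v (- v) \<le> - p v"
  using slope_le[of 1 "- v"] by (simp add: p sublinear_zero)

lemma sublinear_slope: "sublinear (slope p v)"
proof (rule sublinearI)
  fix x y
  \<comment> \<open>The parameter \<open>s + t\<close> serves for the sum; the infima over
    \<open>t\<close> and \<open>s\<close> are then taken one after the other.\<close>
  have 1: "slope p v (x + y) \<le> (p (x + s *s v) - of_rat s * p v) + (p (y + t *s v) - of_rat t * p v)"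
    if "0 \<le> s" "0 \<le> t" for s t
    using slope_le[of "s + t" "x + y"] sublinear_add[OF p, of "x + s *s v" "y + t *s v"] that
    by (simp add: scale_left_distrib of_rat_add algebra_simps)
  have "slope p v (x + y) - (p (x + s *s v) - of_rat s * p v) \<le> slope p v y" if "0 \<le> s" for s
    using 1[OF that] by (intro slope_greatest) (simp add: algebra_simps)
  then have "slope p v (x + y) - slope p v y \<le> slope p v x"
    by (intro slope_greatest) (simp add: algebra_simps)
  then show "slope p v (x + y) \<le> slope p v x + slope p v y"
    by simp
next
  have "0 \<le> slope p v 0"
    by (intro slope_greatest) (simp add: sublinear_scale[OF p])
  then show "slope p v 0 = 0"
    using slope_le_self[of 0] by (simp add: p sublinear_zero)
next
  fix q :: rat and x assume q: "0 < q"
  have "slope p v (q *s x) / of_rat q \<le> slope p v x"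
  proof (rule slope_greatest)
    fix t :: rat assume t: "0 \<le> t"
    have "slope p v (q *s x) \<le> p (q *s x + (q * t) *s v) - of_rat (q * t) * p v"
      using q t by (intro slope_le) simp
    also have "q *s x + (q * t) *s v = q *s (x + t *s v)"
      by (simp add: scale_right_distrib)
    also have "p \<dots> = of_rat q * p (x + t *s v)"
      using q by (intro sublinear_scale[OF p]) simp
    finally show "slope p v (q *s x) / of_rat q \<le> p (x + t *s v) - of_rat t * p v"
      using q by (simp add: of_rat_mult field_simps)
  qed
  then show "slope p v (q *s x) \<le> of_rat q * slope p v x"
    using q by (simp add: divide_le_eq algebra_simps)
qed

end

text \<open>Following the slopes in a list of directions maximises these directions lexicographically,
  which is what makes the resulting functional extremal.\<close>

lemma slope_list:
  assumes "sublinear p"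
  shows "\<exists>r. sublinear r \<and> (\<forall>x. r x \<le> p x) \<and> (\<forall>v\<in>set vs. r v + r (- v) \<le> 0) \<and>
    (\<forall>v ws. vs = v # ws \<longrightarrow> r (- v) \<le> - p v) \<and>
    (\<forall>f h h' c c'. functional f \<longrightarrow> functional h \<longrightarrow> functional h' \<longrightarrow> 0 \<le> c \<longrightarrow> 0 \<le> c' \<longrightarrow>
      (\<forall>x. f x \<le> r x) \<longrightarrow> (\<forall>x. h x \<le> c * p x) \<longrightarrow> (\<forall>x. h' x \<le> c' * p x) \<longrightarrow>
      (\<forall>x. h x + h' x = (c + c') * f x) \<longrightarrow> (\<forall>x. h x \<le> c * r x))"
  using assms
proof (induction vs arbitrary: p)
  case Nil
  then show ?case by (intro exI[of _ p]) auto
next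
  \<comment> \<open>The last conjunct passes through one slope: bounds by multiples of
    \<open>p\<close> are sharpened to bounds by multiples of \<open>slope p v\<close>, and then the
    induction hypothesis applies.\<close>
  case (Cons v vs)
  note p = Cons.prems
  obtain r where r: "sublinear r" "\<And>x. r x \<le> slope p v x" "\<And>w. w \<in> set vs \<Longrightarrow> r w + r (- w) \<le> 0"
    and ext: "\<And>f h h' c c'. functional f \<Longrightarrow> functional h \<Longrightarrow> functional h' \<Longrightarrow> 0 \<le> c \<Longrightarrow> 0 \<le> c' \<Longrightarrow>
      (\<And>x. f x \<le> r x) \<Longrightarrow> (\<And>x. h x \<le> c * slope p v x) \<Longrightarrow> (\<And>x. h' x \<le> c' * slope p v x) \<Longrightarrow>
      (\<And>x. h x + h' x = (c + c') * f x) \<Longrightarrow> (\<forall>x. h x \<le> c * r x)"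
    using Cons.IH[OF sublinear_slope[OF p, of v]] by blast
  have le: "r x \<le> p x" for x
    using r(2)[of x] slope_le_self[OF p, of v x] by simp
  have minus: "r (- v) \<le> - p v"
    using r(2)[of "- v"] slope_minus[OF p, of v] by simp
  have "h x \<le> c * r x"
    if f: "functional f" and h: "functional h" and h': "functional h'" and c: "0 \<le> c" "0 \<le> c'"
      and fr: "\<And>x. f x \<le> r x" and hp: "\<And>x. h x \<le> c * p x" and hp': "\<And>x. h' x \<le> c' * p x"
      and sum: "\<And>x. h x + h' x = (c + c') * f x" for f h h' c c' x
  proof -
    \<comment> \<open>Since \<open>r (- v) \<le> - p v\<close>, a functional below \<open>r\<close>
      attains \<open>p\<close> at \<open>v\<close>. The bounds on \<open>h v\<close> and
      \<open>h' v\<close> then add up to an equality, so each is an equality.\<close>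
    have "f v = p v"
      using fr[of v] fr[of "- v"] le[of v] minus functional_minus[OF f, of v] by simp
    then have hv: "h v = c * p v" "h' v = c' * p v"
      using hp[of v] hp'[of v] sum[of v] by (simp_all add: distrib_right)
    \<comment> \<open>A functional below \<open>d * p\<close> that touches it at \<open>v\<close>
      also lies below its derivative there.\<close>
    have key: "k x \<le> d * slope p v x"
      if k: "functional k" and d: "0 \<le> d" "k v = d * p v" "\<And>x. k x \<le> d * p x" for k d x
    proof (cases "d = 0")
      case True
      then show ?thesis using d(3)[of x] by simp
    next
      case False
      then have d0: "0 < d" using d by simp
      have "k x / d \<le> slope p v x"
      proof (rule slope_greatest[OF p])
        fix t :: rat assume "0 \<le> t"
        have "k x = k (x + t *s v) - of_rat t * (d * p v)"
          using k d by (simp add: functional_add functional_scale)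
        also have "\<dots> \<le> d * p (x + t *s v) - of_rat t * (d * p v)"
          using d(3) by simp
        finally show "k x / d \<le> p (x + t *s v) - of_rat t * p v"
          using d0 by (simp add: field_simps)
      qed
      then show ?thesis
        using d0 by (simp add: divide_le_eq algebra_simps)
    qed
    show ?thesis
      using ext[OF f h h' c fr key[OF h c(1) hv(1) hp] key[OF h' c(2) hv(2) hp'] sum] by blast
  qed
  then show ?case
    using r le minus by (intro exI[of _ r]) (auto intro: order_trans[OF add_mono[OF le minus]])
qed

end

section \<open>Extremal states\<close>

text \<open>The cone may contain lines. Quotients and ideals can therefore be represented by larger
  cones in the same \<open>V\<close>, and the induction stays inside one vector space.\<close>

locale riesz_cone = rat_space scale Basis
  for scale :: "rat \<Rightarrow> 'v::ab_group_add \<Rightarrow> 'v" (infixr "*s" 75) and Basis :: "'v set" +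
  fixes Q :: "'v set"
  assumes zero_mem: "0 \<in> Q"
    and add_mem: "x \<in> Q \<Longrightarrow> y \<in> Q \<Longrightarrow> x + y \<in> Q"
    and scale_mem: "0 \<le> q \<Longrightarrow> x \<in> Q \<Longrightarrow> q *s x \<in> Q"
    and generating: "\<exists>x\<in>Q. \<exists>y\<in>Q. v = x - y"
    and interpolation: "riesz_interpolation Q"
begin

lemma interpolate:
  assumes "c1 - a1 \<in> Q" "c2 - a1 \<in> Q" "c1 - a2 \<in> Q" "c2 - a2 \<in> Q"
  obtains b where "b - a1 \<in> Q" "b - a2 \<in> Q" "c1 - b \<in> Q" "c2 - b \<in> Q"
  using interpolation assms unfolding riesz_interpolation_def cone_le_def by blast

text \<open>Interpolating between the lower bounds \<open>0\<close>, \<open>x - y2\<close> and the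
  upper bounds \<open>x\<close>, \<open>y1\<close> gives the first summand.\<close>

lemma decompose:
  assumes "x \<in> Q" "y1 \<in> Q" "y2 \<in> Q" "y1 + y2 - x \<in> Q"
  obtains x1 x2 where "x1 \<in> Q" "x2 \<in> Q" "x = x1 + x2" "y1 - x1 \<in> Q" "y2 - x2 \<in> Q"
proof -
  obtain b where "b - 0 \<in> Q" "b - (x - y2) \<in> Q" "x - b \<in> Q" "y1 - b \<in> Q"
    using interpolate[of x 0 y1 "x - y2"] assms by (auto simp: algebra_simps)
  then show ?thesis
    using that[of b "x - b"] by (simp add: algebra_simps)
qed

lemma trans_mem: "y - x \<in> Q \<Longrightarrow> z - y \<in> Q \<Longrightarrow> z - x \<in> Q"
  using add_mem[of "y - x" "z - y"] by simp

section \<open>Positive functionals and their infima\<close>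

definition positive :: "('v \<Rightarrow> real) \<Rightarrow> bool"
  where "positive f \<longleftrightarrow> functional f \<and> (\<forall>x\<in>Q. 0 \<le> f x)"

lemma positive_functional: "positive f \<Longrightarrow> functional f"
  by (simp add: positive_def)

lemma positive_nonneg: "positive f \<Longrightarrow> x \<in> Q \<Longrightarrow> 0 \<le> f x"
  by (simp add: positive_def)

lemma positive_mono: "positive f \<Longrightarrow> y - x \<in> Q \<Longrightarrow> f x \<le> f y"
  using positive_nonneg[of f "y - x"] by (simp add: positive_functional functional_diff)

text \<open>Every vector is a difference of elements of \<open>Q\<close>, and additivity makes the
  value independent of the chosen difference.\<close>

lemma extend_to_functional:
  assumes add: "\<And>x y. x \<in> Q \<Longrightarrow> y \<in> Q \<Longrightarrow> m (x + y) = m x + m y"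
    and scl: "\<And>q x. 0 \<le> q \<Longrightarrow> x \<in> Q \<Longrightarrow> m (q *s x) = of_rat q * m x"
  obtains h where "functional h" "\<And>x. x \<in> Q \<Longrightarrow> h x = m x"
proof -
  obtain a b where ab: "\<And>v. a v \<in> Q" "\<And>v. b v \<in> Q" "\<And>v. v = a v - b v"
    using generating by metis
  define h where "h v = m (a v) - m (b v)" for v
  have h: "h v = m x - m y" if "x \<in> Q" "y \<in> Q" "v = x - y" for v x y
  proof -
    have "a v + y = x + b v"
      using that(3) ab(3)[of v] by (metis add.commute diff_add_cancel add_diff_eq diff_diff_eq2)
    then have "m (a v) + m y = m x + m (b v)"
      using add[of "a v" y] add[of x "b v"] ab that by simp
    then show ?thesis by (simp add: h_def)
  qed
  have "functional h"
  proof (rule functionalI)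
    fix x y
    have "h (x + y) = m (a x + a y) - m (b x + b y)"
      using ab(3)[of x] ab(3)[of y] by (intro h add_mem ab) (simp add: algebra_simps)
    then show "h (x + y) = h x + h y"
      by (simp add: add ab h_def)
  next
    fix q x
    show "h (q *s x) = of_rat q * h x"
    proof (cases "0 \<le> q")
      case True
      then have "h (q *s x) = m (q *s a x) - m (q *s b x)"
        using ab(3)[of x] by (intro h scale_mem ab) (simp_all add: scale_right_diff_distrib[symmetric])
      then show ?thesis
        using True by (simp add: scl ab h_def right_diff_distrib)
    next
      case False
      then have "h (q *s x) = m ((- q) *s b x) - m ((- q) *s a x)"
        using ab(3)[of x] by (intro h scale_mem ab)
          (simp_all add: scale_right_diff_distrib[symmetric] scale_minus_left)
      also have "m ((- q) *s b x) = of_rat (- q) * m (b x)"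
        using False by (intro scl ab) simp
      also have "m ((- q) *s a x) = of_rat (- q) * m (a x)"
        using False by (intro scl ab) simp
      finally show ?thesis
        by (simp add: h_def algebra_simps of_rat_minus)
    qed
  qed
  moreover have "h x = m x" if "x \<in> Q" for x
    using h[of x 0 x] that zero_mem scl[of 0 0] by simp
  ultimately show ?thesis using that by blast
qed

text \<open>The last clause expresses that \<open>f - m\<close> is the positive part of
  \<open>f - g\<close>: it lies below every positive \<open>k\<close> that lies above
  \<open>f - g\<close>.\<close>

lemma positive_inf:
  assumes f: "positive f" and g: "positive g"
  obtains m where "positive m" "\<And>x. x \<in> Q \<Longrightarrow> m x \<le> f x" "\<And>x. x \<in> Q \<Longrightarrow> m x \<le> g x"
    "\<And>k x. positive k \<Longrightarrow> (\<And>x. x \<in> Q \<Longrightarrow> f x \<le> g x + k x) \<Longrightarrow> x \<in> Q \<Longrightarrow> f x \<le> m x + k x"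
proof -
  define W where "W x = {y \<in> Q. x - y \<in> Q}" for x
  \<comment> \<open>Riesz--Kantorovich formula\<close>
  define m where "m x = (INF y\<in>W x. f y + g (x - y))" for x
  have le: "m x \<le> f y + g (x - y)" if "y \<in> W x" for x y
    unfolding m_def using that f g
    by (intro cINF_lower bdd_belowI2[of _ 0]) (auto simp: W_def positive_nonneg)
  have W0: "0 \<in> W x" "x \<in> W x" if "x \<in> Q" for x
    using that zero_mem by (simp_all add: W_def)
  have greatest: "d \<le> m x" if "x \<in> Q" "\<And>y. y \<in> W x \<Longrightarrow> d \<le> f y + g (x - y)" for x d
    unfolding m_def using that W0 by (intro cINF_greatest) auto
  have lin: "functional f" "functional g"
    using f g by (simp_all add: positive_functional)
  have add: "m (x + y) = m x + m y" if xy: "x \<in> Q" "y \<in> Q" for x y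
  proof (rule antisym)
    have 1: "m (x + y) \<le> (f a + g (x - a)) + (f b + g (y - b))" if "a \<in> W x" "b \<in> W y" for a b
    proof -
      have "a + b \<in> W (x + y)"
        using that add_mem[of a b] add_mem[of "x - a" "y - b"] by (simp add: W_def algebra_simps)
      from le[OF this] show ?thesis
        using lin by (simp add: functional_add functional_diff)
    qed
    have "m (x + y) - (f a + g (x - a)) \<le> m y" if "a \<in> W x" for a
      using 1[OF that] xy by (intro greatest) (auto simp: algebra_simps)
    then have "m (x + y) - m y \<le> m x"
      using xy by (intro greatest) (auto simp: algebra_simps)
    then show "m (x + y) \<le> m x + m y" by simp
  next
    show "m x + m y \<le> m (x + y)"
    proof (rule greatest)
      fix z assume "z \<in> W (x + y)"
      \<comment> \<open>Riesz decomposition splits \<open>z\<close> into parts below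
        \<open>x\<close> and \<open>y\<close>; this is the half of additivity that depends on
        it.\<close>
      then obtain a b where "a \<in> Q" "b \<in> Q" "z = a + b" "x - a \<in> Q" "y - b \<in> Q"
        using decompose[of z x y] xy by (auto simp: W_def)
      then show "m x + m y \<le> f z + g (x + y - z)"
        using le[of a x] le[of b y] lin by (simp add: W_def functional_add functional_diff)
    qed (use xy add_mem in simp)
  qed
  have m0: "0 \<le> m x" if "x \<in> Q" for x
    using that f g by (intro greatest) (auto simp: W_def positive_nonneg)
  have scl_le: "m (q *s x) \<le> of_rat q * m x" if q: "0 < q" and x: "x \<in> Q" for q x
  proof -
    have "m (q *s x) / of_rat q \<le> m x"
    proof (rule greatest[OF x])
      fix y assume y: "y \<in> W x"
      then have "q *s y \<in> W (q *s x)"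
        using q scale_mem[of q y] scale_mem[of q "x - y"] by (simp add: W_def scale_right_diff_distrib)
      from le[OF this] show "m (q *s x) / of_rat q \<le> f y + g (x - y)"
        using q lin by (simp add: functional_scale functional_diff field_simps)
    qed
    then show ?thesis using q by (simp add: divide_le_eq algebra_simps)
  qed
  have scl: "m (q *s x) = of_rat q * m x" if q: "0 \<le> q" and x: "x \<in> Q" for q x
  proof (cases "q = 0")
    case True
    then show ?thesis using add[of 0 0] zero_mem by simp
  next
    case False
    then have q': "0 < q" using q by simp
    have "m x \<le> of_rat (1 / q) * m (q *s x)"
      using scl_le[of "1 / q" "q *s x"] q' scale_mem[OF q x] by simp
    then have "of_rat q * m x \<le> m (q *s x)"
      using q' by (simp add: of_rat_divide field_simps)
    then show ?thesis using scl_le[OF q' x] by simp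
  qed
  obtain h where h: "functional h" "\<And>x. x \<in> Q \<Longrightarrow> h x = m x"
    using extend_to_functional[of m, OF add scl] by blast
  show ?thesis
  proof
    show "positive h"
      using h m0 by (simp add: positive_def)
    show "h x \<le> f x" "h x \<le> g x" if "x \<in> Q" for x
      using le[of x x] le[of 0 x] W0[OF that] h(2)[OF that] lin by (simp_all add: functional_zero)
    show "f x \<le> h x + k x" if k: "positive k" "\<And>x. x \<in> Q \<Longrightarrow> f x \<le> g x + k x" and x: "x \<in> Q" for k x
    proof -
      have "f x - k x \<le> m x"
      proof (rule greatest[OF x])
        fix y assume "y \<in> W x"
        then have y: "y \<in> Q" "x - y \<in> Q" by (simp_all add: W_def)
        \<comment> \<open>The hypothesis on \<open>k\<close> is applied to the complement
          \<open>x - y\<close>, where it bounds the part of \<open>f\<close> left out by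
          \<open>y\<close>.\<close>
        have "f x - f y \<le> g (x - y) + k (x - y)"
          using k(2)[OF y(2)] lin by (simp add: functional_diff)
        moreover have "k (x - y) \<le> k x"
          using y k(1) by (intro positive_mono) simp_all
        ultimately show "f x - k x \<le> f y + g (x - y)" by simp
      qed
      then show ?thesis using h(2)[OF x] by simp
    qed
  qed
qed

section \<open>States on extreme rays of the cone of positive functionals\<close>

definition extremal_state :: "'v \<Rightarrow> ('v \<Rightarrow> real) \<Rightarrow> bool"
  where "extremal_state u f \<longleftrightarrow> positive f \<and> f u = 1 \<and>
    (\<forall>h. positive h \<and> (\<forall>x\<in>Q. h x \<le> f x) \<longrightarrow> (\<exists>c. \<forall>v. h v = c * f v))"

text \<open>The infimum of \<open>f\<close> and \<open>c * g\<close> is a multiple of both. Distinct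
  states normalised at \<open>u\<close> are not proportional, so the infimum vanishes, and the
  characterisation in \<open>positive_inf\<close> removes the term \<open>c * g\<close> from the
  bound.\<close>

lemma extremal_disjoint:
  assumes f: "extremal_state u f" and g: "extremal_state u g" and ne: "f \<noteq> g"
    and c: "0 \<le> c" and k: "positive k" and le: "\<And>x. x \<in> Q \<Longrightarrow> f x \<le> c * g x + k x" and x: "x \<in> Q"
  shows "f x \<le> k x"
proof (cases "c = 0")
  case True
  then show ?thesis using le[OF x] by simp
next
  case False
  then have c0: "0 < c" using c by simp
  have pos: "positive f" "positive g" using f g by (simp_all add: extremal_state_def)
  have cg: "positive (\<lambda>v. c * g v)"
    using pos c by (simp add: positive_def functional_def algebra_simps)
  obtain m where m: "positive m" "\<And>x. x \<in> Q \<Longrightarrow> m x \<le> f x" "\<And>x. x \<in> Q \<Longrightarrow> m x \<le> c * g x"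
    "\<And>k x. positive k \<Longrightarrow> (\<And>x. x \<in> Q \<Longrightarrow> f x \<le> c * g x + k x) \<Longrightarrow> x \<in> Q \<Longrightarrow> f x \<le> m x + k x"
    using positive_inf[OF pos(1) cg] by blast
  obtain a where a: "\<And>v. m v = a * f v"
    using f m(1,2) unfolding extremal_state_def by blast
  have "positive (\<lambda>v. m v / c)"
    using m(1) c0 by (simp add: positive_def functional_def add_divide_distrib)
  moreover have "\<forall>x\<in>Q. m x / c \<le> g x"
    using m(3) c0 by (simp add: divide_le_eq mult.commute)
  ultimately have "\<exists>b. \<forall>v. m v / c = b * g v"
    using g unfolding extremal_state_def by (elim conjE) (erule allE[of _ "\<lambda>v. m v / c"], simp)
  then obtain b where b: "\<And>v. m v / c = b * g v" by blast
  have "a = 0"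
  proof (rule ccontr)
    assume "a \<noteq> 0"
    have eq: "a * f v = c * b * g v" for v
      using a[of v] b[of v] c0 by (simp add: field_simps)
    have "a = c * b"
      using eq[of u] f g by (simp add: extremal_state_def)
    then have "f = g"
      using eq \<open>a \<noteq> 0\<close> by (simp add: fun_eq_iff)
    then show False using ne by simp
  qed
  then show ?thesis
    using m(4)[OF k le x] a[of x] by simp
qed

text \<open>\<open>extremal_disjoint\<close> removes the terms one by one, ending with
  \<open>f \<le> 0\<close> on \<open>Q\<close> although \<open>f u = 1\<close>.\<close>

lemma extremal_not_dominated:
  assumes "finite J" "\<And>g. g \<in> J \<Longrightarrow> extremal_state u g" "\<And>g. g \<in> J \<Longrightarrow> 0 \<le> c g"
    and f: "extremal_state u f" and "f \<notin> J" and u: "u \<in> Q"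
    and le: "\<And>x. x \<in> Q \<Longrightarrow> f x \<le> (\<Sum>g\<in>J. c g * g x)"
  shows False
  using assms(1-3,5) le
proof (induction J rule: finite_induct)
  case empty
  then show ?case using u f by (force simp: extremal_state_def)
next
  case (insert g J)
  have pos: "positive g" if "g \<in> J" for g
    using insert.prems(1) that by (simp add: extremal_state_def)
  have k: "positive (\<lambda>x. \<Sum>g\<in>J. c g * g x)"
    unfolding positive_def
  proof (intro conjI ballI functionalI)
    show "(\<Sum>g\<in>J. c g * g (x + y)) = (\<Sum>g\<in>J. c g * g x) + (\<Sum>g\<in>J. c g * g y)" for x y
      using pos by (simp add: positive_functional functional_add distrib_left sum.distrib)
    show "(\<Sum>g\<in>J. c g * g (q *s x)) = of_rat q * (\<Sum>g\<in>J. c g * g x)" for q x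
      using pos by (simp add: positive_functional functional_scale sum_distrib_left mult.left_commute)
    show "0 \<le> (\<Sum>g\<in>J. c g * g x)" if "x \<in> Q" for x
      using that insert.prems(2) pos by (intro sum_nonneg mult_nonneg_nonneg) (auto simp: positive_nonneg)
  qed
  show ?case
  proof (rule insert.IH)
    show "f x \<le> (\<Sum>g\<in>J. c g * g x)" if "x \<in> Q" for x
    proof (rule extremal_disjoint[OF f _ _ _ k _ that])
      show "extremal_state u g" "f \<noteq> g" "0 \<le> c g"
        using insert.prems by auto
      show "f x \<le> c g * g x + (\<Sum>g\<in>J. c g * g x)" if "x \<in> Q" for x
        using insert.prems(4)[OF that] insert.hyps by simp
    qed
  qed (use insert.prems in auto)
qed

text \<open>Solving a relation for a state with positive coefficient would bound that state by a
  nonnegative combination of the others. A negative coefficient becomes positive when the relation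
  changes sign.\<close>

lemma extremal_independent:
  assumes J: "finite J" "\<And>g. g \<in> J \<Longrightarrow> extremal_state u g" and u: "u \<in> Q"
    and sum: "\<And>v. (\<Sum>f\<in>J. c f * f v) = 0"
  shows "\<forall>f\<in>J. c f = 0"
proof -
  have no_pos: False if sum: "\<And>v. (\<Sum>f\<in>J. c f * f v) = 0" and f: "f \<in> J" "0 < c f" for f and c :: "('v \<Rightarrow> real) \<Rightarrow> real"
  proof (rule extremal_not_dominated[of "J - {f}" u "\<lambda>g. max 0 (- c g / c f)" f])
    fix x assume x: "x \<in> Q"
    have "c f * f x = (\<Sum>g\<in>J - {f}. - c g * g x)"
      using sum[of x] f J by (simp add: sum.remove[of J f] sum_negf)
    then have "f x = (\<Sum>g\<in>J - {f}. - c g * g x) / c f"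
      using f(2) by (simp add: nonzero_eq_divide_eq mult.commute)
    also have "\<dots> = (\<Sum>g\<in>J - {f}. - c g / c f * g x)"
      by (simp add: sum_divide_distrib)
    \<comment> \<open>Replacing negative factors by 0 only enlarges the sum, since states are
      nonnegative on \<open>Q\<close>.\<close>
    also have "(\<Sum>g\<in>J - {f}. - c g / c f * g x) \<le> (\<Sum>g\<in>J - {f}. max 0 (- c g / c f) * g x)"
      using J x by (intro sum_mono mult_right_mono) (auto simp: extremal_state_def positive_nonneg)
    finally show "f x \<le> (\<Sum>g\<in>J - {f}. max 0 (- c g / c f) * g x)" .
  qed (use J u f in auto)
  show ?thesis
  proof
    fix f assume f: "f \<in> J"
    have "\<not> 0 < c f"
      using no_pos[of c f] sum f by blast
    moreover have "\<not> 0 < - c f"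
      using no_pos[of "\<lambda>g. - c g" f] sum f by (auto simp: sum_negf)
    ultimately show "c f = 0" by simp
  qed
qed

text \<open>Starting from the gauge of the order unit \<open>u\<close>, slopes are taken first in
  direction \<open>- v\<close> and then along a basis. The first makes \<open>f v\<close>
  nonpositive; the whole list makes the result linear and extremal.\<close>

lemma extremal_state_exists:
  assumes u: "u \<in> Q" "- u \<notin> Q" "\<And>x. \<exists>q. q *s u - x \<in> Q" and v: "v \<notin> Q"
  obtains f where "extremal_state u f" "f v \<le> 0"
proof -
  define W where "W x = {q. q *s u - x \<in> Q}" for x
  \<comment> \<open>\<open>p\<close> is the gauge of the order unit: the infimum of the factors
    \<open>q\<close> for which \<open>q *s u\<close> lies above \<open>x\<close>.\<close>
  define p where "p x = (INF q\<in>W x. of_rat q :: real)" for x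
  have W: "W x \<noteq> {}" for x
    using u(3) by (auto simp: W_def)
  have uQ: "0 \<le> q" if "q *s u \<in> Q" for q
  proof (rule ccontr)
    assume "\<not> 0 \<le> q"
    then have "(- 1 / q) *s (q *s u) \<in> Q"
      using scale_mem[OF _ that, of "- 1 / q"] by (simp add: divide_nonpos_nonpos)
    then show False using u(2) \<open>\<not> 0 \<le> q\<close> by simp
  qed
  have Wadd: "q + q' \<in> W (x + y)" if "q \<in> W x" "q' \<in> W y" for q q' x y
  proof -
    have eq: "(q + q') *s u - (x + y) = (q *s u - x) + (q' *s u - y)"
      by (simp add: scale_left_distrib)
    show ?thesis
      using that unfolding W_def mem_Collect_eq eq by (rule add_mem)
  qed
  have bdd: "bdd_below ((\<lambda>q. of_rat q :: real) ` W x)" for x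
  proof -
    \<comment> \<open>Adding an element of \<open>W (- x)\<close> to one of \<open>W x\<close> gives
      a nonnegative number by \<open>uQ\<close>, which bounds \<open>W x\<close> from below.\<close>
    obtain q' where "q' \<in> W (- x)" using W by blast
    then have "- q' \<le> q" if "q \<in> W x" for q
      using Wadd[OF that, of q' "- x"] uQ[of "q + q'"] by (simp add: W_def)
    then have "(of_rat (- q') :: real) \<le> of_rat q" if "q \<in> W x" for q
      using that by (simp only: of_rat_less_eq)
    then show ?thesis by (intro bdd_belowI2[of _ "of_rat (- q')"]) auto
  qed
  have p_le: "p x \<le> of_rat q" if "q \<in> W x" for x q
    unfolding p_def using that bdd by (intro cINF_lower) auto
  have p_greatest: "a \<le> p x" if "\<And>q. q \<in> W x \<Longrightarrow> a \<le> of_rat q" for x a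
    unfolding p_def using that W by (intro cINF_greatest) auto
  have p: "sublinear p"
  proof (rule sublinearI)
    fix x y
    have "p (x + y) - of_rat q \<le> p y" if "q \<in> W x" for q
      using p_le[OF Wadd[OF that]] by (intro p_greatest) (simp add: of_rat_add diff_le_eq add.commute[of _ "of_rat q"])
    then have "p (x + y) - p y \<le> p x"
      by (intro p_greatest) (simp add: algebra_simps)
    then show "p (x + y) \<le> p x + p y" by simp
  next
    have "0 \<le> p 0"
      by (intro p_greatest) (auto simp: W_def intro: uQ)
    then show "p 0 = 0"
      using p_le[of 0 0] zero_mem by (simp add: W_def)
  next
    fix q :: rat and x assume q: "0 < q"
    have "p (q *s x) / of_rat q \<le> p x"
    proof (rule p_greatest)
      fix t assume "t \<in> W x"
      then have "q *s (t *s u - x) \<in> Q"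
        using q by (intro scale_mem) (auto simp: W_def)
      then have "q * t \<in> W (q *s x)"
        by (simp add: W_def scale_right_diff_distrib)
      from p_le[OF this] show "p (q *s x) / of_rat q \<le> of_rat t"
        using q by (simp add: divide_le_eq of_rat_mult mult.commute)
    qed
    then show "p (q *s x) \<le> of_rat q * p x"
      using q by (simp add: divide_le_eq mult.commute)
  qed
  \<comment> \<open>Positivity becomes domination by a multiple of the gauge, the form in which
    \<open>ext\<close> tests extremality.\<close>
  have h_le: "h x \<le> h u * p x" if h: "positive h" for h x
  proof -
    have q: "h x \<le> of_rat q * h u" if "q \<in> W x" for q
      using positive_mono[OF h, of "q *s u" x] that h
      by (simp add: W_def functional_scale positive_functional)
    have "0 \<le> h u" using h u by (simp add: positive_nonneg)
    show ?thesis
    proof (cases "h u = 0")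
      case True
      then show ?thesis using q W[of x] by auto
    next
      case False
      then have hu: "0 < h u" using \<open>0 \<le> h u\<close> by simp
      then have "h x / h u \<le> p x"
        using q by (intro p_greatest) (simp add: divide_le_eq)
      then show ?thesis using hu by (simp add: divide_le_eq mult.commute)
    qed
  qed
  obtain bs where bs: "set bs = Basis"
    using finite_list[OF finite_Basis] by blast
  obtain f where f: "sublinear f" "\<And>x. f x \<le> p x" "\<And>b. b \<in> Basis \<Longrightarrow> f b + f (- b) \<le> 0"
    and fv: "f v \<le> - p (- v)"
    and ext: "\<And>f' h h' c c'. functional f' \<Longrightarrow> functional h \<Longrightarrow> functional h' \<Longrightarrow> 0 \<le> c \<Longrightarrow> 0 \<le> c' \<Longrightarrow>
      (\<And>x. f' x \<le> f x) \<Longrightarrow> (\<And>x. h x \<le> c * p x) \<Longrightarrow> (\<And>x. h' x \<le> c' * p x) \<Longrightarrow>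
      (\<And>x. h x + h' x = (c + c') * f' x) \<Longrightarrow> (\<forall>x. h x \<le> c * f x)"
    using slope_list[OF p, of "- v # bs"] bs by auto
  have lin: "functional f"
    using sublinear_functional f by blast
  \<comment> \<open>A negative \<open>q\<close> with \<open>q *s u + v\<close> in \<open>Q\<close>
    would put \<open>v\<close> itself into \<open>Q\<close>.\<close>
  have "0 \<le> p (- v)"
  proof (rule p_greatest)
    fix q assume "q \<in> W (- v)"
    then have q: "q *s u + v \<in> Q" by (simp add: W_def)
    have "0 \<le> q"
    proof (rule ccontr)
      assume "\<not> 0 \<le> q"
      then have "(q *s u + v) + (- q) *s u \<in> Q"
        using add_mem[OF q scale_mem[OF _ u(1), of "- q"]] by simp
      then show False using v by (simp add: scale_minus_left)
    qed
    then show "0 \<le> (of_rat q :: real)" by simp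
  qed
  then have "f v \<le> 0" using fv by simp
  have "1 \<in> W u" "- 1 \<in> W (- u)"
    using zero_mem by (simp_all add: W_def)
  then have fu: "f u = 1"
    using p_le[of 1 u] p_le[of "- 1" "- u"] f(2)[of u] f(2)[of "- u"] lin by (simp add: functional_minus)
  have pos: "positive f"
    unfolding positive_def
  proof (intro conjI ballI)
    fix x assume "x \<in> Q"
    then have "0 \<in> W (- x)" by (simp add: W_def)
    from p_le[OF this] show "0 \<le> f x"
      using f(2)[of "- x"] lin by (simp add: functional_minus)
  qed fact
  have "extremal_state u f"
    unfolding extremal_state_def
  proof (intro conjI allI impI pos fu)
    fix h assume "positive h \<and> (\<forall>x\<in>Q. h x \<le> f x)"
    then have h: "positive h" "\<And>x. x \<in> Q \<Longrightarrow> h x \<le> f x" by auto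
    \<comment> \<open>The complement of \<open>h\<close> in \<open>f\<close> supplies the second
      summand for \<open>ext\<close>; the weights \<open>h u\<close> and \<open>h' u\<close> add up
      to 1.\<close>
    define h' where "h' = (\<lambda>v. 1 * f v + (- 1) * h v)"
    have "functional h'"
      unfolding h'_def using lin h by (intro functional_combine) (auto simp: positive_functional)
    then have h': "positive h'"
      using h by (simp add: positive_def h'_def)
    have le: "h x \<le> h u * f x" for x
    proof -
      have "\<forall>x. h x \<le> h u * f x"
      proof (rule ext)
        show "0 \<le> h u" "0 \<le> h' u"
          using h h' u by (simp_all add: positive_nonneg)
        show "h x + h' x = (h u + h' u) * f x" for x
          by (simp add: h'_def fu)
      qed (use lin h h' in \<open>auto simp: positive_functional h_le\<close>)
      then show ?thesis by blast
    qed
    \<comment> \<open>A linear inequality that holds at \<open>x\<close> and at \<open>- x\<close>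
      is an equality.\<close>
    have "h x = h u * f x" for x
      using le[of x] le[of "- x"] lin h by (simp add: functional_minus positive_functional)
    then show "\<exists>c. \<forall>v. h v = c * f v" by blast
  qed
  then show ?thesis using that \<open>f v \<le> 0\<close> by blast
qed

end

section \<open>Simplicial subcones\<close>

definition lineality :: "'v::ab_group_add set \<Rightarrow> 'v set"
  where "lineality Q = {x \<in> Q. - x \<in> Q}"

context rat_space
begin

text \<open>Independence and coefficients are taken modulo \<open>N\<close>. Generation of
  \<open>V\<close> is not part of the notion; in \<open>pos_basis_exists\<close> it follows from the
  choice of \<open>F\<close>.\<close>

definition cone_basis :: "'v set \<Rightarrow> 'v set \<Rightarrow> 'v set \<Rightarrow> nat \<Rightarrow> (nat \<Rightarrow> 'v) \<Rightarrow> bool"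
  where "cone_basis Q N F k b \<longleftrightarrow> (\<forall>i<k. b i \<in> Q) \<and>
    (\<forall>c. (\<Sum>i<k. c i *s b i) \<in> N \<longrightarrow> (\<forall>i<k. c i = 0)) \<and>
    (\<forall>x\<in>F. \<exists>c. (\<forall>i<k. 0 \<le> c i) \<and> x - (\<Sum>i<k. c i *s b i) \<in> N)"

lemma subspace_complement:
  assumes M: "subspace M"
  obtains D where "subspace D" "M \<inter> D = {0}" "\<And>v. \<exists>m\<in>M. \<exists>d\<in>D. v = m + d"
proof -
  obtain B where B: "B \<subseteq> M" "independent B" "M \<subseteq> span B"
    by (rule basis_exists[of M])
  have M_eq: "span B = M"
    using span_subspace[OF B(1,3) M] .
  define C where "C = extend_basis B"
  have C: "independent C" "span C = UNIV" "B \<subseteq> C"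
    unfolding C_def
    using independent_extend_basis[OF B(2)] span_extend_basis[OF B(2)] extend_basis_superset[OF B(2)] by - assumption+
  have "finite C" using C finiteI_independent by blast
  let ?D = "span (C - B)"
  have BC: "B \<union> (C - B) = C" using C by blast
  have sum: "\<exists>m\<in>M. \<exists>d\<in>?D. v = m + d" for v
  proof -
    have "v \<in> span (B \<union> (C - B))" using C BC by simp
    then show ?thesis unfolding span_Un M_eq by auto
  qed
  have "M \<inter> ?D = {0}"
  proof -
    have "x = 0" if x: "x \<in> M" "x \<in> ?D" for x
    proof -
      \<comment> \<open>The representation in \<open>C\<close> coincides with those in
        \<open>B\<close> and in \<open>C - B\<close>, whose supports are disjoint.\<close>
      have "representation C x c = 0" for c
      proof -
        have "representation C x c = representation B x c"
          using representation_extend[OF C(1) _ C(3), of x] x M_eq by simp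
        moreover have "representation C x c = representation (C - B) x c"
          using representation_extend[OF C(1) x(2)] by simp
        ultimately show ?thesis
          using representation_ne_zero[of B x c] representation_ne_zero[of "C - B" x c] by fastforce
      qed
      then show "x = 0"
        using sum_nonzero_representation_eq[OF C(1), of x] C(2) by simp
    qed
    then show ?thesis
      using subspace_0[OF M] span_zero by blast
  qed
  then show ?thesis
    using that[of ?D] sum subspace_span by blast
qed

end

context riesz_cone
begin

section \<open>Cones without proper order ideals\<close>

lemma sum_mem: "(\<And>i. i \<in> I \<Longrightarrow> f i \<in> Q) \<Longrightarrow> (\<Sum>i\<in>I. f i) \<in> Q"
  by (induction I rule: infinite_finite_induct) (simp_all add: zero_mem add_mem)

lemma subspace_lineality: "subspace (lineality Q)"
proof (rule subspaceI)
  show "0 \<in> lineality Q"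
    by (simp add: lineality_def zero_mem)
  show "x + y \<in> lineality Q" if "x \<in> lineality Q" "y \<in> lineality Q" for x y
    using that add_mem[of x y] add_mem[of "- x" "- y"] by (simp add: lineality_def)
  show "q *s x \<in> lineality Q" if "x \<in> lineality Q" for q x
    using that scale_mem[of q x] scale_mem[of q "- x"] scale_mem[of "- q" x] scale_mem[of "- q" "- x"]
    by (cases "0 \<le> q") (simp_all add: lineality_def scale_minus_left)
qed

lemma positive_lineality: "positive f \<Longrightarrow> x \<in> lineality Q \<Longrightarrow> f x = 0"
  using positive_nonneg[of f x] positive_nonneg[of f "- x"]
  by (simp add: lineality_def positive_functional functional_minus)

text \<open>Extremal states decide membership in \<open>Q\<close>. They extend to a functional basis
  positive on \<open>F\<close> off the lineality space, and the vectors given by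
  \<open>functional_basis_simplex\<close> are positive under all of them, hence lie in
  \<open>Q\<close>.\<close>

lemma cone_basis_simple:
  assumes unit: "\<And>u x. u \<in> Q \<Longrightarrow> - u \<notin> Q \<Longrightarrow> \<exists>q. q *s u - x \<in> Q"
    and F: "finite F" "F \<subseteq> Q"
  shows "\<exists>k b. cone_basis Q (lineality Q) F k b"
proof (cases "\<exists>u\<in>Q. - u \<notin> Q")
  \<comment> \<open>If \<open>Q\<close> is a subspace, then \<open>F\<close> lies in the lineality
    space and the empty family serves.\<close>
  case False
  then have "cone_basis Q (lineality Q) F 0 (\<lambda>_. 0)"
    using F by (auto simp: cone_basis_def lineality_def)
  then show ?thesis by blast
next
  case True
  then obtain u where u: "u \<in> Q" "- u \<notin> Q" by blast
  let ?N = "lineality Q"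
  define X where "X = {f. extremal_state u f}"
  have X: "positive f" "f u = 1" if "f \<in> X" for f
    using that by (simp_all add: X_def extremal_state_def)
  \<comment> \<open>Such an \<open>x\<close> is itself an order unit, so some multiple of it exceeds
    \<open>u\<close>, where \<open>f\<close> is 1.\<close>
  have pos: "0 < f x" if x: "x \<in> F - ?N" and f: "f \<in> X" for x f
  proof -
    have xQ: "x \<in> Q" "- x \<notin> Q" using x F by (auto simp: lineality_def)
    then obtain q where "q *s x - u \<in> Q" using unit by blast
    then have "1 \<le> of_rat q * f x"
      using positive_mono[of f "q *s x" u] X[OF f] by (simp add: positive_functional functional_scale)
    then have "f x \<noteq> 0" by auto
    then show ?thesis
      using positive_nonneg[of f x] X[OF f] xQ by simp
  qed
  \<comment> \<open>\<open>- u\<close> lies outside \<open>Q\<close>, so it yields at least one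
    extremal state.\<close>
  have "X \<noteq> {}"
    using extremal_state_exists[OF u unit[OF u], of "- u"] u by (auto simp: X_def)
  then obtain S where S: "X \<subseteq> S" "functional_basis ?N S (\<lambda>f. f)" "\<And>x f. x \<in> F - ?N \<Longrightarrow> f \<in> S \<Longrightarrow> 0 < f x"
  proof (rule functional_basis_extend[of X ?N "F - ?N"])
    show "\<forall>f\<in>J. c f = 0" if "finite J" "J \<subseteq> X" "\<And>v. (\<Sum>f\<in>J. c f * f v) = 0" for J c
      using that u by (intro extremal_independent[of J u]) (auto simp: X_def)
  qed (use F X pos positive_lineality positive_functional in auto)
  obtain b where b: "\<And>f g. f \<in> S \<Longrightarrow> g \<in> S \<Longrightarrow> 0 < f (b g)"
    "\<And>c. (\<Sum>f\<in>S. c f *s b f) \<in> ?N \<Longrightarrow> \<forall>f\<in>S. c f = 0"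
    "\<And>x. x \<in> F - ?N \<Longrightarrow> \<exists>c. (\<forall>f\<in>S. 0 \<le> c f) \<and> x - (\<Sum>f\<in>S. c f *s b f) \<in> ?N"
    using functional_basis_simplex[OF S(2) _ _ subspace_lineality, of "F - ?N"] S(3) F(1) by blast
  have "finite S" using S by (simp add: functional_basis_def)
  then obtain e where e: "bij_betw e {..<card S} S"
    using ex_bij_betw_nat_finite[of S] by (auto simp: atLeast0LessThan)
  have eS: "e i \<in> S" if "i < card S" for i
    using e that by (auto simp: bij_betw_def)
  have inv: "inv_into {..<card S} e (e i) = i" if "i < card S" for i
    using e that by (auto simp: bij_betw_def)
  have reindex: "(\<Sum>i<card S. c (e i) *s b (e i)) = (\<Sum>f\<in>S. c f *s b f)" for c
    by (rule sum.reindex_bij_betw[OF e])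
  have "cone_basis Q ?N F (card S) (\<lambda>i. b (e i))"
    unfolding cone_basis_def
  proof (intro conjI allI impI ballI)
    fix i assume i: "i < card S"
    \<comment> \<open>A vector outside \<open>Q\<close> would be nonpositive under some extremal
      state, and all of these belong to \<open>S\<close>.\<close>
    show "b (e i) \<in> Q"
    proof (rule ccontr)
      assume "b (e i) \<notin> Q"
      then obtain f where "extremal_state u f" "f (b (e i)) \<le> 0"
        using extremal_state_exists[OF u unit[OF u]] by blast
      then show False
        using b(1)[of f "e i"] S(1) eS[OF i] by (auto simp: X_def)
    qed
  next
    fix c i assume c: "(\<Sum>i<card S. c i *s b (e i)) \<in> ?N" and i: "i < card S"
    let ?c = "\<lambda>f. c (inv_into {..<card S} e f)"
    have "(\<Sum>i<card S. c i *s b (e i)) = (\<Sum>f\<in>S. ?c f *s b f)"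
      unfolding reindex[symmetric] by (intro sum.cong) (auto simp: inv)
    then have "\<forall>f\<in>S. ?c f = 0"
      using b(2)[of ?c] c by simp
    then show "c i = 0"
      using eS[OF i] inv[OF i] by fastforce
  next
    fix x assume x: "x \<in> F"
    show "\<exists>c. (\<forall>i<card S. 0 \<le> c i) \<and> x - (\<Sum>i<card S. c i *s b (e i)) \<in> ?N"
    proof (cases "x \<in> ?N")
      case True
      then show ?thesis by (intro exI[of _ "\<lambda>_. 0"]) simp
    next
      case False
      then obtain c where "\<forall>f\<in>S. 0 \<le> c f" "x - (\<Sum>f\<in>S. c f *s b f) \<in> ?N"
        using b(3) x by blast
      then show ?thesis
        using eS reindex by (intro exI[of _ "\<lambda>i. c (e i)"]) auto
    qed
  qed
  then show ?thesis by blast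
qed

section \<open>Finite forms of decomposition and interpolation\<close>

lemma decompose_sum:
  fixes k :: nat
  assumes "x \<in> Q" "\<And>i. i < k \<Longrightarrow> y i \<in> Q" "(\<Sum>i<k. y i) - x \<in> Q"
  shows "\<exists>z. (\<forall>i<k. z i \<in> Q \<and> y i - z i \<in> Q \<and> x - z i \<in> Q) \<and> (\<Sum>i<k. z i) - x \<in> Q"
  using assms
proof (induction k arbitrary: x)
  \<comment> \<open>The cone may contain lines, so \<open>x\<close> need not vanish here; hence the
    conclusion bounds \<open>x\<close> by the sum instead of equating them.\<close>
  case 0
  then show ?case by simp
next
  case (Suc k)
  have "(\<Sum>i<k. y i) \<in> Q" using Suc.prems by (intro sum_mem) auto
  then obtain x1 x2 where x: "x1 \<in> Q" "x2 \<in> Q" "x = x1 + x2" "(\<Sum>i<k. y i) - x1 \<in> Q" "y k - x2 \<in> Q"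
    using decompose[of x "\<Sum>i<k. y i" "y k"] Suc.prems by auto
  obtain z where z: "\<And>i. i < k \<Longrightarrow> z i \<in> Q" "\<And>i. i < k \<Longrightarrow> y i - z i \<in> Q"
    "\<And>i. i < k \<Longrightarrow> x1 - z i \<in> Q" "(\<Sum>i<k. z i) - x1 \<in> Q"
    using Suc.IH[OF x(1) _ x(4)] Suc.prems(2) by auto
  have "x - z i \<in> Q" if "i < k" for i
    using trans_mem[OF z(3)[OF that], of x] x by simp
  then have "\<forall>i<Suc k. (z(k := x2)) i \<in> Q \<and> y i - (z(k := x2)) i \<in> Q \<and> x - (z(k := x2)) i \<in> Q"
    using z x by (auto simp: less_Suc_eq)
  moreover have "(\<Sum>i<Suc k. (z(k := x2)) i) - x = (\<Sum>i<k. z i) - x1"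
    using x(3) by (simp add: algebra_simps)
  ultimately show ?case
    using z(4) by (intro exI[of _ "z(k := x2)"]) (simp only: simp_thms)
qed

text \<open>When the next element of \<open>A\<close> is added, the interpolant found so far acts as
  the second lower bound.\<close>

lemma interpolate_finite:
  assumes "finite A" "A \<noteq> {}" "\<And>a. a \<in> A \<Longrightarrow> c1 - a \<in> Q" "\<And>a. a \<in> A \<Longrightarrow> c2 - a \<in> Q"
  shows "\<exists>b. (\<forall>a\<in>A. b - a \<in> Q) \<and> c1 - b \<in> Q \<and> c2 - b \<in> Q"
  using assms
proof (induction A rule: finite_ne_induct)
  case (singleton a)
  then show ?case using zero_mem by (intro exI[of _ a]) simp
next
  case (insert a A)
  then obtain b where b: "\<And>x. x \<in> A \<Longrightarrow> b - x \<in> Q" "c1 - b \<in> Q" "c2 - b \<in> Q" by blast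
  obtain d where d: "d - a \<in> Q" "d - b \<in> Q" "c1 - d \<in> Q" "c2 - d \<in> Q"
    using interpolate[of c1 a c2 b] insert.prems b by blast
  have "d - x \<in> Q" if "x \<in> A" for x
    using trans_mem[OF b(1)[OF that] d(2)] .
  then show ?case using d by blast
qed

section \<open>The order ideal of an element and the quotient by it\<close>

context
  fixes u assumes u: "u \<in> Q"
begin

definition face :: "'v set"
  where "face = {x \<in> Q. \<exists>q. q *s u - x \<in> Q}"

definition order_ideal :: "'v set"
  where "order_ideal = {x - y | x y. x \<in> face \<and> y \<in> face}"

text \<open>The preimage in \<open>V\<close> of the image of \<open>Q\<close> in the quotient of
  \<open>V\<close> by the order ideal.\<close>

definition quotient_cone :: "'v set"
  where "quotient_cone = {x. \<exists>m\<in>order_ideal. x + m \<in> Q}"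

lemma face_subset: "x \<in> face \<Longrightarrow> x \<in> Q"
  by (simp add: face_def)

lemma face_down: "x \<in> Q \<Longrightarrow> y \<in> face \<Longrightarrow> y - x \<in> Q \<Longrightarrow> x \<in> face"
  using trans_mem[of y x] by (auto simp: face_def)

lemma face_add: "x \<in> face \<Longrightarrow> y \<in> face \<Longrightarrow> x + y \<in> face"
proof -
  assume "x \<in> face" "y \<in> face"
  then obtain q r where "x \<in> Q" "y \<in> Q" "q *s u - x \<in> Q" "r *s u - y \<in> Q"
    by (auto simp: face_def)
  moreover have "(q + r) *s u - (x + y) = (q *s u - x) + (r *s u - y)"
    by (simp add: scale_left_distrib)
  ultimately have "x + y \<in> Q" "(q + r) *s u - (x + y) \<in> Q"
    by (simp_all only: add_mem)
  then show ?thesis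
    by (auto simp: face_def)
qed

lemma face_scale: "0 \<le> r \<Longrightarrow> x \<in> face \<Longrightarrow> r *s x \<in> face"
proof -
  assume r: "0 \<le> r" and "x \<in> face"
  then obtain q where "x \<in> Q" "q *s u - x \<in> Q"
    by (auto simp: face_def)
  then have "r *s x \<in> Q" "(r * q) *s u - r *s x \<in> Q"
    using r scale_mem[of r x] scale_mem[of r "q *s u - x"] by (simp_all add: scale_right_diff_distrib)
  then show ?thesis by (auto simp: face_def)
qed

lemma face_zero: "0 \<in> face"
  using u by (auto simp: face_def zero_mem intro!: exI[of _ 1])

lemma face_self: "u \<in> face"
  using u zero_mem by (auto simp: face_def intro!: exI[of _ 1])

lemma lineality_face: "x \<in> lineality Q \<Longrightarrow> x \<in> face"
  by (auto simp: face_def lineality_def intro!: exI[of _ 0])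

lemma face_ideal: "x \<in> face \<Longrightarrow> x \<in> order_ideal"
  unfolding order_ideal_def using face_zero by force

lemma ideal_pos: "x \<in> order_ideal \<Longrightarrow> x \<in> Q \<Longrightarrow> x \<in> face"
  unfolding order_ideal_def using face_down[of x] face_subset by force

lemma ideal_bound:
  assumes "x \<in> order_ideal" obtains g where "g \<in> face" "g - x \<in> Q"
  using assms face_subset unfolding order_ideal_def by force

lemma subspace_ideal: "subspace order_ideal"
proof (rule subspaceI)
  show "0 \<in> order_ideal" by (intro face_ideal face_zero)
  show "x + y \<in> order_ideal" if xy: "x \<in> order_ideal" "y \<in> order_ideal" for x y
  proof -
    obtain a b c d where *: "a \<in> face" "b \<in> face" "c \<in> face" "d \<in> face" "x = a - b" "y = c - d"
      using xy by (auto simp: order_ideal_def)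
    then have "x + y = (a + c) - (b + d)" by simp
    then show ?thesis
      unfolding order_ideal_def using face_add * by blast
  qed
  show "q *s x \<in> order_ideal" if x: "x \<in> order_ideal" for q x
  proof -
    obtain a b where *: "a \<in> face" "b \<in> face" "x = a - b"
      using x by (auto simp: order_ideal_def)
    show ?thesis
    proof (cases "0 \<le> q")
      case True
      have "q *s x = q *s a - q *s b" using * by (simp add: scale_right_diff_distrib)
      then show ?thesis
        unfolding order_ideal_def using face_scale[OF True] * by blast
    next
      case False
      then have q: "0 \<le> - q" by simp
      have "q *s x = (- q) *s b - (- q) *s a" using * by (simp add: scale_right_diff_distrib scale_minus_left)
      then show ?thesis
        unfolding order_ideal_def using face_scale[OF q] * by blast
    qed
  qed
qed

text \<open>If \<open>x\<close> and \<open>- x\<close> are both positive modulo the ideal, then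
  \<open>x + m\<close> lies between 0 and an element of the ideal, hence in the face.\<close>

lemma lineality_quotient_cone: "lineality quotient_cone = order_ideal"
proof (intro equalityI subsetI)
  fix x assume "x \<in> order_ideal"
  then have "- x \<in> order_ideal" using subspace_neg[OF subspace_ideal] by blast
  then show "x \<in> lineality quotient_cone"
    using \<open>x \<in> order_ideal\<close> zero_mem unfolding lineality_def quotient_cone_def by force
next
  fix x assume "x \<in> lineality quotient_cone"
  then obtain m m' where m: "m \<in> order_ideal" "m' \<in> order_ideal" "x + m \<in> Q" "- x + m' \<in> Q"
    by (auto simp: lineality_def quotient_cone_def)
  then have "m + m' \<in> Q" "m + m' - (x + m) \<in> Q"
    using add_mem[of "x + m" "- x + m'"] by (simp_all add: algebra_simps)
  then have "x + m \<in> face"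
    using m face_down ideal_pos subspace_add[OF subspace_ideal] by blast
  then have "(x + m) - m \<in> order_ideal"
    using m face_ideal subspace_diff[OF subspace_ideal] by blast
  then show "x \<in> order_ideal" by simp
qed

text \<open>For interpolation, both upper bounds are raised by one element of the face so that all
  four inequalities hold in \<open>Q\<close>; modulo the ideal nothing changes.\<close>

lemma riesz_cone_quotient_cone: "riesz_cone scale Basis quotient_cone"
proof
  note sub = subspace_ideal
  have Q: "x \<in> quotient_cone" if "x \<in> Q" for x
    using that subspace_0[OF sub] by (auto simp: quotient_cone_def intro!: bexI[of _ 0])
  show "0 \<in> quotient_cone" by (intro Q zero_mem)
  show "x + y \<in> quotient_cone" if xy: "x \<in> quotient_cone" "y \<in> quotient_cone" for x y
  proof -
    obtain m m' where "m \<in> order_ideal" "m' \<in> order_ideal" "x + m \<in> Q" "y + m' \<in> Q"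
      using xy by (auto simp: quotient_cone_def)
    then show ?thesis
      using add_mem[of "x + m" "y + m'"] subspace_add[OF sub, of m m']
      by (auto simp: quotient_cone_def algebra_simps intro!: bexI[of _ "m + m'"])
  qed
  show "q *s x \<in> quotient_cone" if q: "0 \<le> q" and x: "x \<in> quotient_cone" for q x
  proof -
    obtain m where "m \<in> order_ideal" "x + m \<in> Q"
      using x by (auto simp: quotient_cone_def)
    then show ?thesis
      using scale_mem[OF q, of "x + m"] subspace_scale[OF sub, of m q]
      by (auto simp: quotient_cone_def scale_right_distrib)
  qed
  show "\<exists>x\<in>quotient_cone. \<exists>y\<in>quotient_cone. v = x - y" for v
    using generating Q by blast
  show "riesz_interpolation quotient_cone"
    unfolding riesz_interpolation_def cone_le_def
  proof (intro allI impI, elim conjE)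
    fix a1 a2 c1 c2
    assume *: "c1 - a1 \<in> quotient_cone" "c2 - a1 \<in> quotient_cone" "c1 - a2 \<in> quotient_cone" "c2 - a2 \<in> quotient_cone"
    \<comment> \<open>Every element of the ideal lies below one of the face, so the correction can
      be taken in the face.\<close>
    have ex: "\<exists>g\<in>face. x + g \<in> Q" if x: "x \<in> quotient_cone" for x
    proof -
      obtain m where m: "m \<in> order_ideal" "x + m \<in> Q"
        using x by (auto simp: quotient_cone_def)
      obtain g where "g \<in> face" "g - m \<in> Q"
        using ideal_bound[OF m(1)] by blast
      then show ?thesis
        using add_mem[OF m(2), of "g - m"] by (intro bexI[of _ g]) simp_all
    qed
    obtain g1 g2 g3 g4 where g: "g1 \<in> face" "g2 \<in> face" "g3 \<in> face" "g4 \<in> face"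
      "c1 - a1 + g1 \<in> Q" "c2 - a1 + g2 \<in> Q" "c1 - a2 + g3 \<in> Q" "c2 - a2 + g4 \<in> Q"
      using ex *[THEN ex] by blast
    define g where "g = g1 + g2 + g3 + g4"
    have gf: "g \<in> face" using g by (simp add: g_def face_add)
    have "(c1 - a1 + g1) + (g2 + g3 + g4) \<in> Q" "(c2 - a1 + g2) + (g1 + g3 + g4) \<in> Q"
      "(c1 - a2 + g3) + (g1 + g2 + g4) \<in> Q" "(c2 - a2 + g4) + (g1 + g2 + g3) \<in> Q"
      using g(5-8) g(1-4)[THEN face_subset] by (simp_all only: add_mem)
    then have "c1 + g - a1 \<in> Q" "c2 + g - a1 \<in> Q" "c1 + g - a2 \<in> Q" "c2 + g - a2 \<in> Q"
      by (simp_all add: g_def algebra_simps)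
    then obtain b where b: "b - a1 \<in> Q" "b - a2 \<in> Q" "c1 + g - b \<in> Q" "c2 + g - b \<in> Q"
      using interpolate by blast
    have "c1 - b \<in> quotient_cone" "c2 - b \<in> quotient_cone"
      using b(3,4) face_ideal[OF gf] by (auto simp: quotient_cone_def algebra_simps intro!: bexI[of _ g])
    then show "\<exists>b. b - a1 \<in> quotient_cone \<and> b - a2 \<in> quotient_cone \<and> c1 - b \<in> quotient_cone \<and> c2 - b \<in> quotient_cone"
      using b(1,2) Q by blast
  qed
qed

section \<open>The cone of the ideal, extended along a complement\<close>

context
  fixes D assumes D: "subspace D" "order_ideal \<inter> D = {0}" "\<And>v. \<exists>m\<in>order_ideal. \<exists>d\<in>D. v = m + d"
begin

text \<open>The preimage of the face under the projection of \<open>V\<close> onto the ideal along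
  \<open>D\<close>. It represents the ordered ideal by a cone that generates all of
  \<open>V\<close>.\<close>

definition extended_face :: "'v set"
  where "extended_face = {x. \<exists>d\<in>D. x - d \<in> face}"

text \<open>Extending along \<open>D\<close> makes the lineality space larger but adds nothing to it
  inside the ideal; both facts are used in the induction.\<close>

lemma lineality_extended_face:
  "D \<subseteq> lineality extended_face" "lineality Q \<subseteq> lineality extended_face"
  "order_ideal \<inter> lineality extended_face \<subseteq> lineality Q"
proof -
  show "D \<subseteq> lineality extended_face"
    using subspace_neg[OF D(1)] face_zero unfolding lineality_def extended_face_def by force
  have "x \<in> lineality extended_face" if "x \<in> lineality Q" for x
  proof -
    have "- x \<in> lineality Q" using that by (simp add: lineality_def)
    then have "x \<in> face" "- x \<in> face"
      using that lineality_face by blast+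
    then show ?thesis
      using subspace_0[OF D(1)] by (auto simp: lineality_def extended_face_def intro!: bexI[of _ 0])
  qed
  then show "lineality Q \<subseteq> lineality extended_face" by blast
  show "order_ideal \<inter> lineality extended_face \<subseteq> lineality Q"
  proof
    fix x assume x: "x \<in> order_ideal \<inter> lineality extended_face"
    then obtain d d' where d: "d \<in> D" "d' \<in> D" "x - d \<in> face" "- x - d' \<in> face"
      by (auto simp: lineality_def extended_face_def)
    have "x - (x - d) \<in> order_ideal" "- x - (- x - d') \<in> order_ideal"
      using x d face_ideal subspace_diff[OF subspace_ideal] subspace_neg[OF subspace_ideal] by blast+
    then have "d = 0" "d' = 0" using D(2) d by auto
    then show "x \<in> lineality Q"
      using d face_subset by (auto simp: lineality_def)
  qed
qed

text \<open>Inequalities for this cone are inequalities between components in the ideal, so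
  interpolation is carried out there.\<close>

lemma riesz_cone_extended_face: "riesz_cone scale Basis extended_face"
proof
  have G: "x \<in> extended_face" if "x \<in> face" for x
    using that subspace_0[OF D(1)] by (auto simp: extended_face_def intro!: bexI[of _ 0])
  show "0 \<in> extended_face" by (intro G face_zero)
  show "x + y \<in> extended_face" if xy: "x \<in> extended_face" "y \<in> extended_face" for x y
  proof -
    obtain m m' where "m \<in> D" "m' \<in> D" "x - m \<in> face" "y - m' \<in> face"
      using xy by (auto simp: extended_face_def)
    then show ?thesis
      using face_add[of "x - m" "y - m'"] subspace_add[OF D(1), of m m']
      by (auto simp: extended_face_def algebra_simps)
  qed
  show "q *s x \<in> extended_face" if q: "0 \<le> q" and x: "x \<in> extended_face" for q x
  proof -
    obtain m where "m \<in> D" "x - m \<in> face"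
      using x by (auto simp: extended_face_def)
    then show ?thesis
      using face_scale[OF q, of "x - m"] subspace_scale[OF D(1), of m q]
      by (auto simp: extended_face_def scale_right_diff_distrib)
  qed
  show "\<exists>x\<in>extended_face. \<exists>y\<in>extended_face. v = x - y" for v
  proof -
    obtain x y d where *: "x \<in> face" "y \<in> face" "d \<in> D" "v = x - y + d"
      using D(3)[of v] unfolding order_ideal_def by blast
    then have "x + d \<in> extended_face"
      by (auto simp: extended_face_def intro!: bexI[of _ d])
    then show ?thesis
      using * G by (intro bexI[of _ "x + d"] bexI[of _ y]) simp_all
  qed
  show "riesz_interpolation extended_face"
    unfolding riesz_interpolation_def cone_le_def
  proof (intro allI impI, elim conjE)
    fix a1 a2 c1 c2
    assume *: "c1 - a1 \<in> extended_face" "c2 - a1 \<in> extended_face" "c1 - a2 \<in> extended_face" "c2 - a2 \<in> extended_face"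
    have "\<exists>m. m \<in> order_ideal \<and> v - m \<in> D" for v
      using D(3)[of v] by force
    then obtain \<pi> where \<pi>: "\<And>v. \<pi> v \<in> order_ideal" "\<And>v. v - \<pi> v \<in> D" by metis
    have proj: "\<pi> c - \<pi> a \<in> face" if ca: "c - a \<in> extended_face" for a c
    proof -
      obtain d where d: "d \<in> D" "c - a - d \<in> face"
        using ca by (auto simp: extended_face_def)
      \<comment> \<open>This difference lies both in \<open>D\<close> and in the ideal, hence is
        0.\<close>
      let ?z = "(c - a - d) - (\<pi> c - \<pi> a)"
      have "?z = (c - \<pi> c) - (a - \<pi> a) - d" by simp
      then have "?z \<in> D"
        using subspace_diff[OF D(1)] \<pi> d by metis
      moreover have "?z \<in> order_ideal"
        using subspace_diff[OF subspace_ideal] \<pi> d face_ideal by metis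
      ultimately have "?z = 0" using D(2) by blast
      then show ?thesis using d by simp
    qed
    note p = *[THEN proj]
    obtain b where b: "b - \<pi> a1 \<in> Q" "b - \<pi> a2 \<in> Q" "\<pi> c1 - b \<in> Q" "\<pi> c2 - b \<in> Q"
      using interpolate[of "\<pi> c1" "\<pi> a1" "\<pi> c2" "\<pi> a2"] p[THEN face_subset] by blast
    \<comment> \<open>These differences are positive and below elements of the face, so they stay in
      the face.\<close>
    have bf: "b - \<pi> a1 \<in> face" "\<pi> c1 - b \<in> face" "\<pi> c2 - b \<in> face"
      using face_down[OF b(1) p(1)] face_down[OF b(3) p(1)] face_down[OF b(4) p(2)] b by simp_all
    have "b - \<pi> a2 \<in> face"
      using face_down[OF b(2) p(3)] b by simp
    moreover have up: "x - a \<in> extended_face" if "x - \<pi> a \<in> face" for x a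
      using that subspace_neg[OF D(1) \<pi>(2)[of a]] by (auto simp: extended_face_def intro!: bexI[of _ "- (a - \<pi> a)"])
    moreover have down: "c - x \<in> extended_face" if "\<pi> c - x \<in> face" for x c
      using that \<pi>(2)[of c] by (auto simp: extended_face_def intro!: bexI[of _ "c - \<pi> c"])
    ultimately show "\<exists>b. b - a1 \<in> extended_face \<and> b - a2 \<in> extended_face \<and> c1 - b \<in> extended_face \<and> c2 - b \<in> extended_face"
      using bf by (intro exI[of _ b]) blast
  qed
qed

end

text \<open>Lifts \<open>s i\<close> of the basis to \<open>Q\<close> leave remainders
  \<open>p - q\<close> with \<open>p\<close> and \<open>q\<close> in the face. The part
  \<open>q\<close> is absorbed by lowering the \<open>s i\<close> within the ideal: Riesz
  decomposition finds sufficient amounts for one \<open>x\<close>, interpolation common amounts for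
  all of \<open>F\<close>.\<close>

lemma lift_quotient_basis:
  assumes b: "cone_basis quotient_cone order_ideal F k b" and F: "finite F" "F \<subseteq> Q"
  obtains r where "\<And>i. i < k \<Longrightarrow> r i \<in> Q" "\<And>i. i < k \<Longrightarrow> r i - b i \<in> order_ideal"
    "\<And>x. x \<in> F \<Longrightarrow> \<exists>c. (\<forall>i<k. 0 \<le> c i) \<and> x - (\<Sum>i<k. c i *s r i) \<in> face"
proof -
  note sub = subspace_ideal
  have "\<exists>s. i < k \<longrightarrow> s \<in> Q \<and> s - b i \<in> order_ideal" for i
  proof (cases "i < k")
    case True
    then obtain m where "m \<in> order_ideal" "b i + m \<in> Q"
      using b by (auto simp: cone_basis_def quotient_cone_def)
    then show ?thesis by (intro exI[of _ "b i + m"]) simp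
  qed simp
  then obtain s where s: "\<And>i. i < k \<Longrightarrow> s i \<in> Q" "\<And>i. i < k \<Longrightarrow> s i - b i \<in> order_ideal" by metis
  \<comment> \<open>The amounts \<open>w\<close> work for \<open>x\<close>, and so do all larger
    amounts \<open>c\<close> in the face; this is what permits a common choice.\<close>
  define R where "R x l w \<longleftrightarrow> (\<forall>i<k. 0 \<le> l i \<and> w i \<in> face \<and> s i - w i \<in> Q) \<and>
      (\<forall>c. (\<forall>i<k. c i \<in> face \<and> c i - w i \<in> Q) \<longrightarrow> x - (\<Sum>i<k. l i *s (s i - c i)) \<in> face)" for x l w
  have "\<forall>x\<in>F. \<exists>l. \<exists>w. R x l w"
  proof
    fix x assume xF: "x \<in> F"
    then obtain l where l: "\<And>i. i < k \<Longrightarrow> 0 \<le> l i" "x - (\<Sum>i<k. l i *s b i) \<in> order_ideal"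
      using b xF unfolding cone_basis_def by blast
    have "(\<Sum>i<k. l i *s (s i - b i)) \<in> order_ideal"
      using s by (intro subspace_sum[OF sub] subspace_scale[OF sub]) auto
    from subspace_diff[OF sub l(2) this] have xm: "x - (\<Sum>i<k. l i *s s i) \<in> order_ideal"
      by (simp add: scale_right_diff_distrib sum_subtractf)
    then obtain p q where pq: "p \<in> face" "q \<in> face" "x - (\<Sum>i<k. l i *s s i) = p - q"
      by (auto simp: order_ideal_def)
    have xQ: "x \<in> Q" using xF F by blast
    have ls: "l i *s s i \<in> Q" if "i < k" for i
      using that l s by (intro scale_mem) auto
    \<comment> \<open>As \<open>x\<close> is in \<open>Q\<close>, \<open>q\<close> lies below
      \<open>p\<close> plus the sum, so it can be split along these terms.\<close>
    have "p + (\<Sum>i<k. l i *s s i) - q = x"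
      using pq(3) by (simp add: algebra_simps)
    then obtain p' z0 where z0: "p' \<in> Q" "z0 \<in> Q" "q = p' + z0" "p - p' \<in> Q" "(\<Sum>i<k. l i *s s i) - z0 \<in> Q"
      using decompose[of q p "\<Sum>i<k. l i *s s i"] pq(1,2)[THEN face_subset] sum_mem[of "{..<k}" "\<lambda>i. l i *s s i"] ls xQ
      by auto
    obtain z where z: "\<And>i. i < k \<Longrightarrow> z i \<in> Q" "\<And>i. i < k \<Longrightarrow> l i *s s i - z i \<in> Q"
      "\<And>i. i < k \<Longrightarrow> z0 - z i \<in> Q" "(\<Sum>i<k. z i) - z0 \<in> Q"
      using decompose_sum[OF z0(2) _ z0(5)] ls by auto
    have "z0 \<in> face"
      using face_down[OF z0(2) pq(2)] z0 by simp
    then have zf: "z i \<in> face" if "i < k" for i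
      using face_down[OF z(1) _ z(3)] that by blast
    \<comment> \<open>For \<open>l i = 0\<close> the division gives \<open>w i = 0\<close>, so
      nothing is subtracted from \<open>s i\<close> there.\<close>
    define w where "w i = (1 / l i) *s z i" for i
    have w: "w i \<in> face \<and> s i - w i \<in> Q" if i: "i < k" for i
    proof
      show "w i \<in> face"
        unfolding w_def using zf i l by (intro face_scale) auto
      show "s i - w i \<in> Q"
      proof (cases "l i = 0")
        case True
        then show ?thesis using s i by (simp add: w_def)
      next
        case False
        have "(1 / l i) *s (l i *s s i - z i) \<in> Q"
          using z(2)[OF i] l(1)[OF i] by (intro scale_mem) auto
        then show ?thesis
          using False by (simp add: w_def scale_right_diff_distrib)
      qed
    qed
    have "x - (\<Sum>i<k. l i *s (s i - c i)) \<in> face" if c: "\<forall>i<k. c i \<in> face \<and> c i - w i \<in> Q" for c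
    proof (rule ideal_pos)
      have eq: "x - (\<Sum>i<k. l i *s (s i - c i)) = (x - (\<Sum>i<k. l i *s s i)) + (\<Sum>i<k. l i *s c i)"
        by (simp add: scale_right_diff_distrib sum_subtractf)
      show "x - (\<Sum>i<k. l i *s (s i - c i)) \<in> order_ideal"
        unfolding eq using c xm face_ideal
        by (intro subspace_add[OF sub] subspace_sum[OF sub] subspace_scale[OF sub]) auto
      have lc: "l i *s c i - z i \<in> Q" if i: "i < k" for i
      proof (cases "l i = 0")
        case True
        then show ?thesis using z(2)[OF i] by simp
      next
        case False
        then have "l i *s (c i - w i) = l i *s c i - z i"
          by (simp add: w_def scale_right_diff_distrib)
        then show ?thesis
          using scale_mem[OF l(1)[OF i], of "c i - w i"] c i by simp
      qed
      \<comment> \<open>The new remainder is the sum of three positive gaps: \<open>p'\<close> below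
        \<open>p\<close>, \<open>z0\<close> below the sum of the \<open>z i\<close>, and each
        \<open>z i\<close> below \<open>l i *s c i\<close>.\<close>
      have "(p - p') + ((\<Sum>i<k. z i) - z0) + (\<Sum>i<k. l i *s c i - z i) \<in> Q"
        using z0(4) z(4) lc by (intro add_mem sum_mem) auto
      moreover have "(p - p') + ((\<Sum>i<k. z i) - z0) + (\<Sum>i<k. l i *s c i - z i) = x - (\<Sum>i<k. l i *s (s i - c i))"
        unfolding eq pq(3) using z0(3) by (simp add: sum_subtractf)
      ultimately show "x - (\<Sum>i<k. l i *s (s i - c i)) \<in> Q" by (simp only:)
    qed
    then show "\<exists>l w. R x l w"
      using l w unfolding R_def by blast
  qed
  then obtain l w where lwR: "\<And>x. x \<in> F \<Longrightarrow> R x (l x) (w x)"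
    unfolding bchoice_iff by blast
  have l: "\<And>x i. x \<in> F \<Longrightarrow> i < k \<Longrightarrow> 0 \<le> l x i"
    and w: "\<And>x i. x \<in> F \<Longrightarrow> i < k \<Longrightarrow> w x i \<in> face" "\<And>x i. x \<in> F \<Longrightarrow> i < k \<Longrightarrow> s i - w x i \<in> Q"
    and lw: "\<And>x c. x \<in> F \<Longrightarrow> (\<forall>i<k. c i \<in> face \<and> c i - w x i \<in> Q) \<Longrightarrow> x - (\<Sum>i<k. l x i *s (s i - c i)) \<in> face"
    using lwR unfolding R_def by blast+
  have "\<exists>c. i < k \<longrightarrow> c \<in> face \<and> s i - c \<in> Q \<and> (\<forall>x\<in>F. c - w x i \<in> Q)" for i
  proof (cases "i < k")
    case True
    let ?g = "\<Sum>x\<in>F. w x i"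
    have sum_face: "(\<Sum>x\<in>A. w x i) \<in> face" if "A \<subseteq> F" for A
      using that by (induction A rule: infinite_finite_induct) (auto simp: face_zero face_add w True)
    have "?g - w x i \<in> Q" if "x \<in> F" for x
      using face_subset[OF sum_face[of "F - {x}"]] F that by (simp add: sum.remove)
    \<comment> \<open>The upper bound \<open>s i\<close> keeps the lowered lift in \<open>Q\<close>.
      The lower bound 0 and the upper bound \<open>?g\<close>, an element of the face, force
      \<open>c\<close> into the face.\<close>
    then have "\<exists>c. (\<forall>a\<in>insert 0 ((\<lambda>x. w x i) ` F). c - a \<in> Q) \<and> s i - c \<in> Q \<and> ?g - c \<in> Q"
      using F s(1) w(2) True face_subset[OF sum_face[of F]] by (intro interpolate_finite) auto
    then obtain c where c: "c \<in> Q" "\<And>x. x \<in> F \<Longrightarrow> c - w x i \<in> Q" "s i - c \<in> Q" "?g - c \<in> Q"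
      by auto
    then show ?thesis
      using face_down[OF c(1) sum_face[of F] c(4)] by blast
  qed simp
  then obtain c where c: "\<And>i. i < k \<Longrightarrow> c i \<in> face" "\<And>i. i < k \<Longrightarrow> s i - c i \<in> Q"
    "\<And>i x. i < k \<Longrightarrow> x \<in> F \<Longrightarrow> c i - w x i \<in> Q" by metis
  show ?thesis
  proof
    fix i assume i: "i < k"
    show "s i - c i \<in> Q" using c i by blast
    have "(s i - b i) - c i \<in> order_ideal"
      using s c i face_ideal subspace_diff[OF sub] by blast
    then show "(s i - c i) - b i \<in> order_ideal" by (simp add: algebra_simps)
  next
    fix x assume x: "x \<in> F"
    then show "\<exists>d. (\<forall>i<k. 0 \<le> d i) \<and> x - (\<Sum>i<k. d i *s (s i - c i)) \<in> face"
      using lw[OF x, of c] l[OF x] c by (intro exI[of _ "l x"]) auto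
  qed
qed

end

end

section \<open>Induction on the codimension of the lineality space\<close>

context rat_space
begin

text \<open>A lifted basis for the quotient and a basis for the ideal are concatenated. Both cones
  used in the induction have strictly larger lineality spaces: the first gains \<open>u\<close>, the
  second an element outside the ideal.\<close>

theorem cone_basis_exists:
  assumes "riesz_cone scale Basis Q" "finite F" "F \<subseteq> Q"
  shows "\<exists>k b. cone_basis Q (lineality Q) F k b"
  using assms
proof (induction "dimension - dim (lineality Q)" arbitrary: Q F rule: less_induct)
  case less
  interpret riesz_cone scale Basis Q by fact
  let ?N = "lineality Q"
  have smaller: "dimension - dim (lineality R) < dimension - dim ?N"
    if R: "riesz_cone scale Basis R" and sub: "?N \<subset> lineality R" for R
  proof -
    have "dim ?N < dim (lineality R)"
      using sub subspace_lineality riesz_cone.subspace_lineality[OF R]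
      by (intro dim_psubset) (simp add: span_eq_iff[THEN iffD2])
    then show ?thesis
      using dim_subset_UNIV[of "lineality R"] by linarith
  qed
  show ?case
  proof (cases "\<forall>u x. u \<in> Q \<longrightarrow> - u \<notin> Q \<longrightarrow> (\<exists>q. q *s u - x \<in> Q)")
    case True
    then show ?thesis using cone_basis_simple less.prems by blast
  next
    case False
    then obtain u x where u: "u \<in> Q" "- u \<notin> Q" and x: "\<And>q. q *s u - x \<notin> Q" by blast
    let ?G = "face u" and ?M = "order_ideal u"
    note sub = subspace_ideal[OF u(1)]
    have lin_M: "?N \<subseteq> ?M"
      using lineality_face[OF u(1)] face_ideal[OF u(1)] by blast
    have "u \<in> ?M - ?N"
      using u face_ideal[OF u(1) face_self[OF u(1)]] by (simp add: lineality_def)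
    then have "?N \<subset> lineality (quotient_cone u)"
      using lin_M unfolding lineality_quotient_cone[OF u(1)] by blast
    note 1 = smaller[OF riesz_cone_quotient_cone[OF u(1)] this]
    have "F \<subseteq> quotient_cone u"
      using less.prems subspace_0[OF sub] unfolding quotient_cone_def[OF u(1)] by force
    then obtain k b where b: "cone_basis (quotient_cone u) ?M F k b"
      using less.hyps[OF 1 riesz_cone_quotient_cone[OF u(1)] less.prems(2)]
      unfolding lineality_quotient_cone[OF u(1)] by blast
    obtain r where r: "\<And>i. i < k \<Longrightarrow> r i \<in> Q" "\<And>i. i < k \<Longrightarrow> r i - b i \<in> ?M"
      "\<And>x. x \<in> F \<Longrightarrow> \<exists>c. (\<forall>i<k. 0 \<le> c i) \<and> x - (\<Sum>i<k. c i *s r i) \<in> ?G"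
      using lift_quotient_basis[OF u(1) b less.prems(2,3)] by blast
    obtain c where c: "\<And>x i. x \<in> F \<Longrightarrow> i < k \<Longrightarrow> 0 \<le> c x i"
      "\<And>x. x \<in> F \<Longrightarrow> x - (\<Sum>i<k. c x i *s r i) \<in> ?G"
      using r(3) by metis
    obtain D where D: "subspace D" "?M \<inter> D = {0}" "\<And>v. \<exists>m\<in>?M. \<exists>d\<in>D. v = m + d"
      using subspace_complement[OF sub] by blast
    let ?E = "extended_face u D"
    note lin_E = lineality_extended_face[OF u(1) D]
    note E = riesz_cone_extended_face[OF u(1) D]
    \<comment> \<open>Elements of the ideal lie below multiples of \<open>u\<close>, which
      \<open>x\<close> does not; so the complement \<open>D\<close> has a component of
      \<open>x\<close> outside the ideal.\<close>
    have "x \<notin> ?M"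
    proof
      assume "x \<in> ?M"
      then obtain g where "g \<in> ?G" "g - x \<in> Q" by (rule ideal_bound[OF u(1)])
      then obtain q where "q *s u - g \<in> Q" by (auto simp: face_def[OF u(1)])
      then show False using x[of q] trans_mem \<open>g - x \<in> Q\<close> by blast
    qed
    then obtain d where d: "d \<in> D" "d \<notin> ?M"
      using D(3)[of x] subspace_add[OF sub] by blast
    then have "?N \<subset> lineality ?E"
      using lin_E lin_M by blast
    note 2 = smaller[OF E this]
    \<comment> \<open>What the lifted basis leaves over lies in the face and is left to the basis of
      the ideal.\<close>
    define F' where "F' = (\<lambda>x. x - (\<Sum>i<k. c x i *s r i)) ` F"
    have F': "finite F'" "F' \<subseteq> ?G"
      using less.prems c by (auto simp: F'_def)
    have "F' \<subseteq> ?E"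
      using F' subspace_0[OF D(1)] unfolding extended_face_def[OF u(1) D] by force
    then obtain l e where e: "cone_basis ?E (lineality ?E) F' l e"
      using less.hyps[OF 2 E F'(1)] by blast
    \<comment> \<open>The vectors \<open>e i\<close> are moved along \<open>D\<close> into the face;
      this changes combinations only by the lineality space of \<open>?E\<close>.\<close>
    have "\<exists>g. i < l \<longrightarrow> g \<in> ?G \<and> e i - g \<in> D" for i
    proof (cases "i < l")
      case True
      then obtain d where "d \<in> D" "e i - d \<in> ?G"
        using e by (auto simp: cone_basis_def extended_face_def[OF u(1) D])
      then show ?thesis by (intro exI[of _ "e i - d"]) simp
    qed simp
    then obtain g where g: "\<And>i. i < l \<Longrightarrow> g i \<in> ?G" "\<And>i. i < l \<Longrightarrow> e i - g i \<in> D" by metis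
    have subE: "subspace (lineality ?E)"
      by (rule riesz_cone.subspace_lineality[OF E])
    have eg: "(\<Sum>i<l. a i *s e i) - (\<Sum>i<l. a i *s g i) \<in> lineality ?E" for a
    proof -
      have "(\<Sum>i<l. a i *s (e i - g i)) \<in> lineality ?E"
        using g lin_E(1) by (intro subspace_sum[OF subE] subspace_scale[OF subE]) auto
      then show ?thesis by (simp add: scale_right_diff_distrib sum_subtractf)
    qed
    have gM: "(\<Sum>i<l. a i *s g i) \<in> ?M" for a
      using g face_ideal[OF u(1)] by (intro subspace_sum[OF sub] subspace_scale[OF sub]) auto
    define h where "h i = (if i < k then r i else g (i - k))" for i
    have split: "(\<Sum>i<k + l. a i *s h i) = (\<Sum>i<k. a i *s r i) + (\<Sum>i<l. a (k + i) *s g i)" for a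
    proof -
      have "(\<Sum>i<k + m. a i *s h i) = (\<Sum>i<k. a i *s r i) + (\<Sum>i<m. a (k + i) *s g i)" for m
        by (induction m) (simp_all add: h_def add.assoc)
      then show ?thesis .
    qed
    have "cone_basis Q ?N F (k + l) h"
      unfolding cone_basis_def
    proof (intro conjI allI impI ballI)
      fix i assume "i < k + l"
      then show "h i \<in> Q"
        using r(1) g(1) face_subset[OF u(1)] by (auto simp: h_def)
    next
      fix a i assume a: "(\<Sum>i<k + l. a i *s h i) \<in> ?N" and i: "i < k + l"
      \<comment> \<open>Modulo the ideal only the lifted part survives, which kills the first
        \<open>k\<close> coefficients; the others then vanish by independence for
        \<open>?E\<close>.\<close>
      have "(\<Sum>i<k + l. a i *s h i) - (\<Sum>i<l. a (k + i) *s g i) \<in> ?M"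
        using a lin_M gM by (intro subspace_diff[OF sub]) auto
      then have "(\<Sum>i<k. a i *s r i) \<in> ?M"
        unfolding split by simp
      moreover have "(\<Sum>i<k. a i *s (r i - b i)) \<in> ?M"
        using r(2) by (intro subspace_sum[OF sub] subspace_scale[OF sub]) auto
      ultimately have "(\<Sum>i<k. a i *s r i) - (\<Sum>i<k. a i *s (r i - b i)) \<in> ?M"
        by (rule subspace_diff[OF sub])
      then have "(\<Sum>i<k. a i *s b i) \<in> ?M"
        by (simp add: scale_right_diff_distrib sum_subtractf)
      then have ak: "\<forall>i<k. a i = 0"
        using b by (auto simp: cone_basis_def)
      then have "(\<Sum>i<l. a (k + i) *s g i) \<in> lineality ?E"
        using a lin_E(2) unfolding split by auto
      then have "((\<Sum>i<l. a (k + i) *s e i) - (\<Sum>i<l. a (k + i) *s g i)) + (\<Sum>i<l. a (k + i) *s g i) \<in> lineality ?E"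
        by (intro subspace_add[OF subE] eg)
      then have al: "\<forall>i<l. a (k + i) = 0"
        using e unfolding cone_basis_def
        by (elim conjE allE[of _ "\<lambda>i. a (k + i)"]) simp
      show "a i = 0"
        using ak al[rule_format, of "i - k"] i by (cases "i < k") auto
    next
      fix x assume x: "x \<in> F"
      let ?y = "x - (\<Sum>i<k. c x i *s r i)"
      have "?y \<in> F'" using x by (simp add: F'_def)
      then obtain a where a: "\<And>i. i < l \<Longrightarrow> 0 \<le> a i" "?y - (\<Sum>i<l. a i *s e i) \<in> lineality ?E"
        using e unfolding cone_basis_def by blast
      have "(?y - (\<Sum>i<l. a i *s e i)) + ((\<Sum>i<l. a i *s e i) - (\<Sum>i<l. a i *s g i)) \<in> lineality ?E"
        by (intro subspace_add[OF subE] eg a)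
      \<comment> \<open>Inside the ideal the lineality space of \<open>?E\<close> is no larger than
        \<open>?N\<close>.\<close>
      then have "?y - (\<Sum>i<l. a i *s g i) \<in> lineality ?E" by simp
      moreover have "?y - (\<Sum>i<l. a i *s g i) \<in> ?M"
        by (rule subspace_diff[OF sub face_ideal[OF u(1) c(2)[OF x]] gM])
      ultimately have "?y - (\<Sum>i<l. a i *s g i) \<in> ?N"
        using lin_E(3) by blast
      then have "x - (\<Sum>i<k + l. (if i < k then c x i else a (i - k)) *s h i) \<in> ?N"
        unfolding split by (simp add: diff_diff_eq)
      then show "\<exists>d. (\<forall>i<k + l. 0 \<le> d i) \<and> x - (\<Sum>i<k + l. d i *s h i) \<in> ?N"
        using a c(1)[OF x] by (intro exI[of _ "\<lambda>i. if i < k then c x i else a (i - k)"]) auto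
    qed
    then show ?thesis by blast
  qed
qed

end

section \<open>Limits of simplicial groups\<close>

lemma additive_group_simps [simp]:
  "carrier additive_group = UNIV" "x \<otimes>\<^bsub>additive_group\<^esub> y = x + y" "\<one>\<^bsub>additive_group\<^esub> = 0"
  by (simp_all add: additive_group_def)

lemma ordered_group_int_power: "ordered_group (int_power_group n) (int_power_pos n)"
proof -
  interpret comm_group "int_power_group n"
    unfolding int_power_group_def
    by (rule group.group_comm_groupI) (auto simp: add.commute intro!: restrict_ext)
  show ?thesis
  proof
    show "int_power_pos n \<subseteq> carrier (int_power_group n)"
      by (auto simp: int_power_pos_def)
    show one: "\<one>\<^bsub>int_power_group n\<^esub> \<in> int_power_pos n"
      by (auto simp: int_power_pos_def int_power_group_def)
    show "x \<otimes>\<^bsub>int_power_group n\<^esub> y \<in> int_power_pos n" if "x \<in> int_power_pos n" "y \<in> int_power_pos n" for x y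
      using that by (auto simp: int_power_pos_def int_power_group_def)
    have "x = \<one>\<^bsub>int_power_group n\<^esub>"
      if x: "x \<in> int_power_pos n" and y: "y \<in> int_power_pos n" and xy: "x = inv\<^bsub>int_power_group n\<^esub> y" for x y
    proof -
      have mult: "x \<otimes>\<^bsub>int_power_group n\<^esub> y = \<one>\<^bsub>int_power_group n\<^esub>"
        using xy y by (auto simp: int_power_pos_def)
      have "x i + y i = 0" if "i < n" for i
        using fun_cong[OF mult, of i] that by (simp add: int_power_group_def)
      moreover have "0 \<le> x i" "0 \<le> y i" if "i < n" for i
        using that x y by (simp_all add: int_power_pos_def)
      ultimately have x0: "x i = 0" if "i < n" for i
        using that by (smt (verit))
      show ?thesis
      proof (rule PiE_ext)
        show "x \<in> (\<Pi>\<^sub>E i\<in>{..<n}. UNIV)"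
          using x by (simp add: int_power_pos_def int_power_group_def)
        show "\<one>\<^bsub>int_power_group n\<^esub> \<in> (\<Pi>\<^sub>E i\<in>{..<n}. UNIV)"
          by (simp add: int_power_group_def)
        show "x i = \<one>\<^bsub>int_power_group n\<^esub> i" if "i \<in> {..<n}" for i
          using that by (simp add: x0 int_power_group_def)
      qed
    qed
    moreover have "\<one>\<^bsub>int_power_group n\<^esub> \<in> m_inv (int_power_group n) ` int_power_pos n"
      using one inv_one by (metis imageI)
    ultimately show "int_power_pos n \<inter> m_inv (int_power_group n) ` int_power_pos n = {\<one>\<^bsub>int_power_group n\<^esub>}"
      using one by blast
  qed
qed

text \<open>The transition maps are the inclusions of the images, pulled back along the injections
  \<open>r i\<close>. A class of the limit is then determined by its value in the union.\<close>

lemma directed_union_limit: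
  fixes r :: "nat \<Rightarrow> 'a \<Rightarrow> 'v::ab_group_add" and G :: "'a monoid"
  assumes G: "ordered_group G pos"
    and hom: "\<And>i x y. x \<in> carrier G \<Longrightarrow> y \<in> carrier G \<Longrightarrow> r i (x \<otimes>\<^bsub>G\<^esub> y) = r i x + r i y"
    and inj: "\<And>i. inj_on (r i) (carrier G)"
    and mono_carrier: "\<And>i. r i ` carrier G \<subseteq> r (Suc i) ` carrier G"
    and mono_pos: "\<And>i. r i ` pos \<subseteq> r (Suc i) ` pos"
    and union_carrier: "(\<Union>i. r i ` carrier G) = UNIV"
    and union_pos: "(\<Union>i. r i ` pos) = P"
  shows "\<exists>\<phi> :: nat \<Rightarrow> nat \<Rightarrow> 'a \<Rightarrow> 'a. inductive_system {1..} (\<lambda>_. G) (\<lambda>_. pos) \<phi> \<and>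
    ordered_iso (limit_group {1..} (\<lambda>_. G) \<phi>) (limit_pos {1..} (\<lambda>_. G) (\<lambda>_. pos) \<phi>) additive_group P \<noteq> {}"
proof -
  interpret G: ordered_group G pos by (rule G)
  have carr: "r i ` carrier G \<subseteq> r j ` carrier G" if "i \<le> j" for i j
    by (rule lift_Suc_mono_le[of "\<lambda>i. r i ` carrier G", OF mono_carrier that])
  have ps: "r i ` pos \<subseteq> r j ` pos" if "i \<le> j" for i j
    by (rule lift_Suc_mono_le[of "\<lambda>i. r i ` pos", OF mono_pos that])
  define \<phi> where "\<phi> i j x = inv_into (carrier G) (r j) (r i x)" for i j x
  have \<phi>: "\<phi> i j x \<in> carrier G" "r j (\<phi> i j x) = r i x" if "i \<le> j" "x \<in> carrier G" for i j x
  proof -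
    have "r i x \<in> r j ` carrier G"
      using carr[OF that(1)] that(2) by blast
    then show "\<phi> i j x \<in> carrier G" "r j (\<phi> i j x) = r i x"
      by (simp_all only: \<phi>_def inv_into_into f_inv_into_f)
  qed
  have \<phi>_eq: "\<phi> i j x = y" if "y \<in> carrier G" "r j y = r i x" for i j x y
    using that inv_into_f_f[OF inj[of j]] unfolding \<phi>_def by metis
  have sys: "inductive_system {1..} (\<lambda>_. G) (\<lambda>_. pos) \<phi>"
  proof
    show "{1::nat..} \<noteq> {}" by auto
    show "\<exists>k\<in>{1..}. i \<le> k \<and> j \<le> k" if "i \<in> {1..}" for i j :: nat
      using that by (intro bexI[of _ "max i j"]) auto
    show "\<phi> i j \<in> ordered_hom G pos G pos" if "i \<le> j" for i j
    proof -
      have "\<phi> i j (x \<otimes>\<^bsub>G\<^esub> y) = \<phi> i j x \<otimes>\<^bsub>G\<^esub> \<phi> i j y" if "x \<in> carrier G" "y \<in> carrier G" for x y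
        using that \<phi>[OF \<open>i \<le> j\<close>] by (intro \<phi>_eq) (simp_all add: hom)
      moreover have "\<phi> i j x \<in> pos" if x: "x \<in> pos" for x
      proof -
        obtain y where "y \<in> pos" "r j y = r i x"
          using ps[OF \<open>i \<le> j\<close>] x by (metis imageE imageI subsetD)
        then show ?thesis
          using \<phi>_eq[of y j i x] G.pos_subset by auto
      qed
      ultimately show ?thesis
        using \<phi>[OF that] by (auto simp: ordered_hom_def hom_def)
    qed
    show "\<phi> i i x = x" if "x \<in> carrier G" for i x
      using that by (intro \<phi>_eq) simp_all
    show "\<phi> j k (\<phi> i j x) = \<phi> i k x" if "i \<le> j" "j \<le> k" "x \<in> carrier G" for i j k x
      using that \<phi>[of i j x] \<phi>[of i k x] by (intro \<phi>_eq) simp_all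
  qed
  interpret inductive_system "{1..}" "\<lambda>_. G" "\<lambda>_. pos" \<phi> by (rule sys)
  let ?L = "limit_group {1..} (\<lambda>_. G) \<phi>" and ?m = "limit_map {1..} (\<lambda>_. G) \<phi>"
  have eq_iff: "?m i x = ?m j y \<longleftrightarrow> r i x = r j y"
    if "1 \<le> i" "1 \<le> j" "x \<in> carrier G" "y \<in> carrier G" for i j x y
  proof -
    have "?m i x = ?m j y \<longleftrightarrow> (\<exists>k\<in>{1..}. i \<le> k \<and> j \<le> k \<and> \<phi> i k x = \<phi> j k y)"
      using that by (intro limit_map_eq_iff) auto
    also have "\<dots> \<longleftrightarrow> r i x = r j y"
    proof
      assume "\<exists>k\<in>{1..}. i \<le> k \<and> j \<le> k \<and> \<phi> i k x = \<phi> j k y"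
      then obtain k where "i \<le> k" "j \<le> k" "\<phi> i k x = \<phi> j k y" by blast
      then show "r i x = r j y"
        using \<phi>(2)[of i k x] \<phi>(2)[of j k y] that by simp
    next
      assume "r i x = r j y"
      \<comment> \<open>\<open>\<phi> i k x\<close> depends on \<open>i\<close> and \<open>x\<close>
        only through \<open>r i x\<close>.\<close>
      then have "\<phi> i (max i j) x = \<phi> j (max i j) y"
        by (simp add: \<phi>_def)
      then show "\<exists>k\<in>{1..}. i \<le> k \<and> j \<le> k \<and> \<phi> i k x = \<phi> j k y"
        using that by (intro bexI[of _ "max i j"]) auto
    qed
    finally show ?thesis .
  qed
  define \<psi> where "\<psi> A = (THE v. \<exists>i\<ge>1. \<exists>x\<in>carrier G. A = ?m i x \<and> v = r i x)" for A
  have \<psi>: "\<psi> (?m i x) = r i x" if "1 \<le> i" "x \<in> carrier G" for i x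
    unfolding \<psi>_def
  proof (rule the_equality)
    show "\<exists>j\<ge>1. \<exists>y\<in>carrier G. ?m i x = ?m j y \<and> r i x = r j y"
      using that by blast
    show "v = r i x" if "\<exists>j\<ge>1. \<exists>y\<in>carrier G. ?m i x = ?m j y \<and> v = r j y" for v
      using that eq_iff \<open>1 \<le> i\<close> \<open>x \<in> carrier G\<close> by metis
  qed
  have "\<psi> \<in> hom ?L additive_group"
  proof (rule homI)
    show "\<psi> (A \<otimes>\<^bsub>?L\<^esub> B) = \<psi> A \<otimes>\<^bsub>additive_group\<^esub> \<psi> B" if AB: "A \<in> carrier ?L" "B \<in> carrier ?L" for A B
      by (rule limit_carrierE2[OF AB]) (simp add: limit_mult_same \<psi> hom del: One_nat_def)
  qed simp
  moreover have "inj_on \<psi> (carrier ?L)"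
  proof (rule inj_onI)
    fix A B assume AB: "A \<in> carrier ?L" "B \<in> carrier ?L" and eq: "\<psi> A = \<psi> B"
    show "A = B"
      by (rule limit_carrierE2[OF AB]) (use eq in \<open>simp add: \<psi> eq_iff del: One_nat_def\<close>)
  qed
  moreover have "\<psi> ` carrier ?L = UNIV"
  proof -
    have "v \<in> \<psi> ` carrier ?L" for v
    proof -
      have "v \<in> (\<Union>i. r i ` carrier G)"
        unfolding union_carrier by simp
      then obtain i x where x: "x \<in> carrier G" "v = r i x"
        by blast
      \<comment> \<open>The index moves up by one because the system starts at 1 while the sequence
        starts at 0.\<close>
      then obtain y where y: "y \<in> carrier G" "v = r (Suc i) y"
        using mono_carrier[of i] by blast
      have "v = \<psi> (?m (Suc i) y)"
        unfolding y(2) by (rule \<psi>[symmetric]) (simp, rule y(1))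
      moreover have "?m (Suc i) y \<in> carrier ?L"
        unfolding carrier_limit using y(1) by (intro UN_I[of "Suc i"] imageI) simp_all
      ultimately show ?thesis by blast
    qed
    then show ?thesis by blast
  qed
  moreover have "\<psi> ` limit_pos {1..} (\<lambda>_. G) (\<lambda>_. pos) \<phi> = P"
  proof -
    have "\<psi> ` limit_pos {1..} (\<lambda>_. G) (\<lambda>_. pos) \<phi> = (\<Union>i\<in>{1..}. r i ` pos)"
      unfolding limit_pos_def image_UN image_image
      using G.pos_subset by (intro SUP_cong image_cong refl) (auto intro!: \<psi> simp del: One_nat_def)
    also have "\<dots> = P"
      unfolding union_pos[symmetric] using mono_pos by fastforce
    finally show ?thesis .
  qed
  ultimately have "\<psi> \<in> ordered_iso ?L (limit_pos {1..} (\<lambda>_. G) (\<lambda>_. pos) \<phi>) additive_group P"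
    by (simp add: ordered_iso_def iso_def bij_betw_def)
  then show ?thesis using sys by blast
qed

section \<open>Clearing denominators and exhausting the cone by bases\<close>

lemma common_denominator:
  assumes "finite (R :: rat set)"
  shows "\<exists>d::int. 0 < d \<and> (\<forall>q\<in>R. \<exists>z. q * of_int d = of_int z)"
  using assms
proof (induction R rule: finite_induct)
  case empty
  then show ?case by (intro exI[of _ 1]) simp
next
  case (insert q R)
  then obtain d where d: "0 < d" "\<And>q. q \<in> R \<Longrightarrow> \<exists>z. q * of_int d = of_int z" by blast
  obtain a b where ab: "quotient_of q = (a, b)" by fastforce
  then have b: "0 < b" "q = of_int a / of_int b"
    using quotient_of_denom_pos quotient_of_div by blast+
  have "\<exists>z. p * of_int (d * b) = of_int z" if p: "p \<in> R" for p
  proof -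
    obtain z where "p * of_int d = of_int z" using d p by blast
    then have "p * of_int (d * b) = of_int (z * b)" by (simp add: mult.assoc[symmetric])
    then show ?thesis by blast
  qed
  moreover have "q * of_int (d * b) = of_int (a * d)"
    using b by simp
  ultimately show ?case
    using d(1) b(1) by (intro exI[of _ "d * b"]) (auto simp del: of_int_mult)
qed

context rat_space
begin

text \<open>With \<open>C = UNIV\<close> this is the lattice generated by the family, with
  \<open>C = {0..}\<close> its simplicial positive part.\<close>

definition int_combs :: "nat \<Rightarrow> int set \<Rightarrow> (nat \<Rightarrow> 'v) \<Rightarrow> 'v set"
  where "int_combs n C b = {\<Sum>m<n. of_int (c m) *s b m | c. \<forall>m<n. c m \<in> C}"

text \<open>Coefficients compose by matrix multiplication, which stays inside \<open>C\<close> by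
  closure under sums and products.\<close>

lemma int_combs_mono:
  assumes b: "\<And>m. m < n \<Longrightarrow> b m \<in> int_combs n C b'"
    and C: "0 \<in> C" "\<And>x y. x \<in> C \<Longrightarrow> y \<in> C \<Longrightarrow> x + y \<in> C" "\<And>x y. x \<in> C \<Longrightarrow> y \<in> C \<Longrightarrow> x * y \<in> C"
  shows "int_combs n C b \<subseteq> int_combs n C b'"
proof
  fix v assume "v \<in> int_combs n C b"
  then obtain c where c: "\<And>m. m < n \<Longrightarrow> c m \<in> C" "v = (\<Sum>m<n. of_int (c m) *s b m)"
    by (auto simp: int_combs_def)
  have "\<exists>d. m < n \<longrightarrow> (\<forall>l<n. d l \<in> C) \<and> b m = (\<Sum>l<n. of_int (d l) *s b' l)" for m
    using b[of m] by (auto simp: int_combs_def)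
  then obtain d where d: "\<And>m l. m < n \<Longrightarrow> l < n \<Longrightarrow> d m l \<in> C"
    "\<And>m. m < n \<Longrightarrow> b m = (\<Sum>l<n. of_int (d m l) *s b' l)" by metis
  have "v = (\<Sum>m<n. \<Sum>l<n. of_int (c m * d m l) *s b' l)"
    unfolding c(2) by (intro sum.cong refl) (simp add: d(2) scale_sum_right)
  also have "\<dots> = (\<Sum>l<n. of_int (\<Sum>m<n. c m * d m l) *s b' l)"
    by (subst sum.swap) (simp add: scale_sum_left)
  finally have "v = (\<Sum>l<n. of_int (\<Sum>m<n. c m * d m l) *s b' l)" .
  moreover have "(\<Sum>m\<in>A. c m * d m l) \<in> C" if "l < n" "A \<subseteq> {..<n}" for l A
    using that(2) by (induction A rule: infinite_finite_induct) (auto simp: C c d that(1))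
  ultimately show "v \<in> int_combs n C b'"
    unfolding int_combs_def by (intro CollectI exI[of _ "\<lambda>l. \<Sum>m<n. c m * d m l"]) simp
qed

definition pos_basis :: "'v set \<Rightarrow> nat \<Rightarrow> (nat \<Rightarrow> 'v) \<Rightarrow> bool"
  where "pos_basis Q n b \<longleftrightarrow> (\<forall>m<n. b m \<in> Q) \<and> (\<forall>c. (\<Sum>m<n. c m *s b m) = 0 \<longrightarrow> (\<forall>m<n. c m = 0)) \<and>
    span (b ` {..<n}) = UNIV"

lemma span_family: "v \<in> span (b ` {..<n::nat}) \<Longrightarrow> \<exists>c. v = (\<Sum>m<n. c m *s b m)"
proof (induction rule: span_induct_alt)
  case base
  then show ?case by (intro exI[of _ "\<lambda>_. 0"]) simp
next
  case (step a x y)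
  then obtain c k where c: "y = (\<Sum>m<n. c m *s b m)" and k: "k < n" "x = b k" by auto
  have "(\<Sum>m<n. (if m = k then a else 0) *s b m) = (\<Sum>m<n. if m = k then a *s b m else 0)"
    by (intro sum.cong) auto
  then have "a *s x + y = (\<Sum>m<n. (c m + (if m = k then a else 0)) *s b m)"
    using c k by (simp add: scale_left_distrib sum.distrib)
  then show ?case by (intro exI[of _ "\<lambda>m. c m + (if m = k then a else 0)"])
qed

lemma independent_family:
  assumes indep: "\<And>c. (\<Sum>m<k. c m *s b m) = 0 \<Longrightarrow> \<forall>m<k. c m = 0"
  shows "inj_on b {..<k::nat}" "independent (b ` {..<k})"
proof -
  show inj: "inj_on b {..<k}"
  proof (rule inj_onI)
    fix i j assume ij: "i \<in> {..<k}" "j \<in> {..<k}" "b i = b j"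
    show "i = j"
    proof (rule ccontr)
      assume ne: "i \<noteq> j"
      \<comment> \<open>Two equal vectors would satisfy the relation with coefficients 1 and
        -1.\<close>
      let ?c = "\<lambda>m. (if m = i then 1 else 0) - (if m = j then 1 else 0)"
      have "(\<Sum>m<k. ?c m *s b m) = (\<Sum>m<k. if m = i then b m else 0) - (\<Sum>m<k. if m = j then b m else 0)"
        unfolding sum_subtractf[symmetric] by (intro sum.cong) (auto simp: scale_left_diff_distrib)
      also have "\<dots> = 0" using ij by simp
      finally show False
        using indep[of ?c] ij ne by auto
    qed
  qed
  show "independent (b ` {..<k})"
    unfolding independent_explicit
  proof (intro conjI allI impI ballI)
    fix c v assume c: "(\<Sum>v\<in>b ` {..<k}. c v *s v) = 0" and v: "v \<in> b ` {..<k}"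
    have "(\<Sum>m<k. c (b m) *s b m) = 0"
      using c by (simp add: sum.reindex[OF inj])
    then show "c v = 0" using indep[of "\<lambda>m. c (b m)"] v by auto
  qed simp
qed

text \<open>Since \<open>F\<close> spans \<open>V\<close>, so does a cone basis for
  \<open>F\<close>, which therefore has \<open>n\<close> members. Dividing it by a common
  denominator of the finitely many coefficients makes them integers.\<close>

lemma pos_basis_exists:
  assumes Q: "riesz_cone scale Basis Q" and lin: "lineality Q = {0}" and n: "dim UNIV = n"
    and F: "finite F" "F \<subseteq> Q" "span F = UNIV"
  shows "\<exists>b. pos_basis Q n b \<and> F \<subseteq> int_combs n {0..} b"
proof -
  interpret riesz_cone scale Basis Q by (rule Q)
  obtain k b where kb: "cone_basis Q {0} F k b"
    using cone_basis_exists[OF Q F(1,2)] unfolding lin by blast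
  have b: "\<And>i. i < k \<Longrightarrow> b i \<in> Q" "\<And>c. (\<Sum>i<k. c i *s b i) = 0 \<Longrightarrow> \<forall>i<k. c i = 0"
    "\<And>x. x \<in> F \<Longrightarrow> \<exists>c. (\<forall>i<k. 0 \<le> c i) \<and> x = (\<Sum>i<k. c i *s b i)"
    using kb by (simp_all add: cone_basis_def)
  have "F \<subseteq> span (b ` {..<k})"
  proof
    fix x assume "x \<in> F"
    then obtain c where "x = (\<Sum>i<k. c i *s b i)" using b(3) by blast
    then show "x \<in> span (b ` {..<k})"
      by (auto intro!: span_sum span_scale intro: span_base)
  qed
  then have spn: "span (b ` {..<k}) = UNIV"
    using span_minimal[OF _ subspace_span, of F] F(3) by blast
  have "dim UNIV = card (b ` {..<k})"
    using independent_family(2)[of b k] b(2) spn by (intro dim_unique) auto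
  also have "\<dots> = k"
    using card_image[OF independent_family(1)[of b k]] b(2) by simp
  finally have k: "k = n" using n by simp
  obtain c where c: "\<And>x i. x \<in> F \<Longrightarrow> i < k \<Longrightarrow> 0 \<le> c x i" "\<And>x. x \<in> F \<Longrightarrow> x = (\<Sum>i<k. c x i *s b i)"
    using b(3) by metis
  obtain d where d: "0 < d" "\<And>q. q \<in> (\<lambda>(x, i). c x i) ` (F \<times> {..<k}) \<Longrightarrow> \<exists>z. q * of_int d = of_int z"
    using common_denominator[of "(\<lambda>(x, i). c x i) ` (F \<times> {..<k})"] F(1) by blast
  let ?b = "\<lambda>i. (1 / of_int d) *s b i"
  have scaled: "(\<Sum>i<k. a i *s ?b i) = (\<Sum>i<k. (a i / of_int d) *s b i)" for a
    by simp
  have "pos_basis Q n ?b"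
    unfolding pos_basis_def
  proof (intro conjI allI impI)
    show "?b m \<in> Q" if "m < n" for m
      using that b d k by (intro scale_mem) auto
    show "a m = 0" if "(\<Sum>m<n. a m *s ?b m) = 0" "m < n" for a m
      using that b(2)[of "\<lambda>m. a m / of_int d"] d k scaled[of a] by auto
    have "b i = of_int d *s ?b i" for i using d by simp
    then have "b ` {..<k} \<subseteq> span (?b ` {..<k})"
      by (metis (no_types, lifting) image_subsetI imageI span_base span_scale)
    then show "span (?b ` {..<n}) = UNIV"
      using span_minimal[OF _ subspace_span, of "b ` {..<k}"] spn k by blast
  qed
  moreover have "x \<in> int_combs n {0..} ?b" if x: "x \<in> F" for x
  proof -
    have "\<exists>z. i < k \<longrightarrow> c x i * of_int d = of_int z" for i
      using d(2)[of "c x i"] x by force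
    then obtain z where z: "\<And>i. i < k \<Longrightarrow> c x i * of_int d = of_int (z i)" by metis
    have z0: "0 \<le> z i" if "i < k" for i
    proof -
      have "(0::rat) \<le> of_int (z i)"
        using z[OF that] c(1)[OF x that] d(1) by (metis mult_nonneg_nonneg of_int_0_le_iff less_imp_le)
      then show ?thesis by simp
    qed
    have "x = (\<Sum>i<k. c x i *s b i)" by (rule c(2)[OF x])
    also have "\<dots> = (\<Sum>i<k. of_int (z i) *s ?b i)"
      using d(1) by (intro sum.cong) (auto simp: z[symmetric])
    finally show ?thesis
      using z0 k unfolding int_combs_def by auto
  qed
  ultimately show ?thesis by blast
qed

text \<open>A finite-dimensional rational space is countable, so \<open>Q\<close> can be enumerated.
  Each basis is chosen to cover the previous one together with the next element of the
  enumeration.\<close>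

lemma pos_basis_sequence:
  assumes Q: "riesz_cone scale Basis Q" and lin: "lineality Q = {0}" and n: "dim UNIV = n"
  obtains B where "\<And>i. pos_basis Q n (B i)" "\<And>i m. m < n \<Longrightarrow> B i m \<in> int_combs n {0..} (B (Suc i))"
    "\<And>v. v \<in> Q \<Longrightarrow> \<exists>i. v \<in> int_combs n {0..} (B i)"
proof -
  interpret riesz_cone scale Basis Q by (rule Q)
  \<comment> \<open>Splitting \<open>Basis\<close> into differences of positive vectors gives a
    first spanning set inside \<open>Q\<close>.\<close>
  obtain p q where pq: "\<And>v. p v \<in> Q" "\<And>v. q v \<in> Q" "\<And>v. v = p v - q v"
    using generating by metis
  have "Basis \<subseteq> span (p ` Basis \<union> q ` Basis)"
  proof
    fix x assume "x \<in> Basis"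
    then have "p x - q x \<in> span (p ` Basis \<union> q ` Basis)"
      by (intro span_diff span_base) auto
    then show "x \<in> span (p ` Basis \<union> q ` Basis)" using pq(3)[of x] by simp
  qed
  then have "span (p ` Basis \<union> q ` Basis) = UNIV"
    using span_minimal[OF _ subspace_span, of Basis] span_Basis by blast
  then obtain b0 where b0: "pos_basis Q n b0"
    using pos_basis_exists[OF Q lin n, of "p ` Basis \<union> q ` Basis"] finite_Basis pq(1,2) by blast
  have "countable (UNIV :: 'v set)"
  proof (rule countable_subset)
    show "UNIV \<subseteq> range (\<lambda>qs :: rat list. \<Sum>m<n. (qs ! m) *s b0 m)"
    proof
      fix v
      obtain c where "v = (\<Sum>m<n. c m *s b0 m)"
        using span_family[of v b0 n] b0 by (auto simp: pos_basis_def)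
      then have "v = (\<Sum>m<n. (map c [0..<n] ! m) *s b0 m)" by simp
      then show "v \<in> range (\<lambda>qs :: rat list. \<Sum>m<n. (qs ! m) *s b0 m)" by (rule range_eqI)
    qed
  qed simp
  then have "countable Q" by (rule countable_subset[rotated]) simp
  \<comment> \<open>The enumeration may repeat elements, so the case of a finite \<open>Q\<close> is
    included.\<close>
  then have e: "range (from_nat_into Q) = Q"
    using zero_mem by (intro range_from_nat_into) auto
  have "\<exists>B. \<forall>i. pos_basis Q n (B i) \<and>
    ((\<forall>m<n. B i m \<in> int_combs n {0..} (B (Suc i))) \<and> from_nat_into Q i \<in> int_combs n {0..} (B (Suc i)))"
  proof (rule dependent_nat_choice)
    show "\<exists>b. pos_basis Q n b" using b0 by blast
    fix b and i :: nat assume b: "pos_basis Q n b"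
    have "span (insert (from_nat_into Q i) (b ` {..<n})) = UNIV"
      using b span_mono[of "b ` {..<n}" "insert (from_nat_into Q i) (b ` {..<n})"] by (auto simp: pos_basis_def)
    moreover have "insert (from_nat_into Q i) (b ` {..<n}) \<subseteq> Q"
      using b e by (auto simp: pos_basis_def)
    ultimately obtain b' where b': "pos_basis Q n b'" "insert (from_nat_into Q i) (b ` {..<n}) \<subseteq> int_combs n {0..} b'"
      using pos_basis_exists[OF Q lin n, of "insert (from_nat_into Q i) (b ` {..<n})"] by auto
    then show "\<exists>b'. pos_basis Q n b' \<and> (\<forall>m<n. b m \<in> int_combs n {0..} b') \<and> from_nat_into Q i \<in> int_combs n {0..} b'"
      by (intro exI[of _ b']) auto
  qed
  then obtain B where B: "\<And>i. pos_basis Q n (B i)" "\<And>i m. m < n \<Longrightarrow> B i m \<in> int_combs n {0..} (B (Suc i))"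
    "\<And>i. from_nat_into Q i \<in> int_combs n {0..} (B (Suc i))" by blast
  have "\<exists>i. v \<in> int_combs n {0..} (B i)" if "v \<in> Q" for v
  proof -
    have "v \<in> range (from_nat_into Q)" using that e by simp
    then show ?thesis using B(3) by auto
  qed
  then show ?thesis using that B by blast
qed

text \<open>The bases embed the integer vectors with increasing images. Their positive parts exhaust
  \<open>Q\<close> by construction, and the lattices exhaust \<open>V\<close> because every vector
  is a difference of positive ones.\<close>

theorem limit_of_int_powers:
  assumes Q: "riesz_cone scale Basis Q" and lin: "lineality Q = {0}" and n: "dim UNIV = n"
  shows "\<exists>\<phi> :: nat \<Rightarrow> nat \<Rightarrow> (nat \<Rightarrow> int) \<Rightarrow> (nat \<Rightarrow> int).
    inductive_system {1..} (\<lambda>_. int_power_group n) (\<lambda>_. int_power_pos n) \<phi> \<and>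
    ordered_iso (limit_group {1..} (\<lambda>_. int_power_group n) \<phi>)
      (limit_pos {1..} (\<lambda>_. int_power_group n) (\<lambda>_. int_power_pos n) \<phi>) additive_group Q \<noteq> {}"
proof -
  interpret riesz_cone scale Basis Q by (rule Q)
  obtain B where B: "\<And>i. pos_basis Q n (B i)" "\<And>i m. m < n \<Longrightarrow> B i m \<in> int_combs n {0..} (B (Suc i))"
    "\<And>v. v \<in> Q \<Longrightarrow> \<exists>i. v \<in> int_combs n {0..} (B i)"
    using pos_basis_sequence[OF assms] by blast
  define r where "r i x = (\<Sum>m<n. of_int (x m) *s B i m)" for i and x :: "nat \<Rightarrow> int"
  have carrier: "carrier (int_power_group n) = (\<Pi>\<^sub>E m\<in>{..<n}. UNIV)"
    by (simp add: int_power_group_def)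
  have r_carrier: "r i ` carrier (int_power_group n) = int_combs n UNIV (B i)" for i
  proof (intro equalityI subsetI)
    fix v assume "v \<in> int_combs n UNIV (B i)"
    then obtain c where "v = (\<Sum>m<n. of_int (c m) *s B i m)" by (auto simp: int_combs_def)
    then have "v = r i (restrict c {..<n})" by (simp add: r_def)
    then show "v \<in> r i ` carrier (int_power_group n)" by (auto simp: carrier)
  qed (auto simp: int_combs_def r_def)
  have r_pos: "r i ` int_power_pos n = int_combs n {0..} (B i)" for i
  proof (intro equalityI subsetI)
    fix v assume "v \<in> int_combs n {0..} (B i)"
    then obtain c where "\<forall>m<n. 0 \<le> c m" "v = (\<Sum>m<n. of_int (c m) *s B i m)" by (auto simp: int_combs_def)
    then have "v = r i (restrict c {..<n})" "restrict c {..<n} \<in> int_power_pos n"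
      by (auto simp: r_def int_power_pos_def carrier)
    then show "v \<in> r i ` int_power_pos n" by blast
  qed (auto simp: int_combs_def r_def int_power_pos_def)
  have mono_pos: "int_combs n {0..} (B i) \<subseteq> int_combs n {0..} (B (Suc i))" for i
    using B(2) by (intro int_combs_mono) auto
  have "int_combs n {0..} b \<subseteq> int_combs n UNIV b" for b
    by (auto simp: int_combs_def)
  then have mono_carrier: "int_combs n UNIV (B i) \<subseteq> int_combs n UNIV (B (Suc i))" for i
    using B(2) by (intro int_combs_mono) auto
  show ?thesis
  proof (rule directed_union_limit[where r = r])
    show "ordered_group (int_power_group n) (int_power_pos n)"
      by (rule ordered_group_int_power)
    show "r i (x \<otimes>\<^bsub>int_power_group n\<^esub> y) = r i x + r i y" for i x y
      by (simp add: r_def int_power_group_def scale_left_distrib sum.distrib)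
    show "inj_on (r i) (carrier (int_power_group n))" for i
    proof (rule inj_onI)
      fix x y assume xy: "x \<in> carrier (int_power_group n)" "y \<in> carrier (int_power_group n)" and eq: "r i x = r i y"
      have "(\<Sum>m<n. (of_int (x m) - of_int (y m)) *s B i m) = 0"
        using eq by (simp add: r_def scale_left_diff_distrib sum_subtractf)
      then have "\<forall>m<n. of_int (x m) - of_int (y m) = (0 :: rat)"
        using B(1)[of i] unfolding pos_basis_def by (elim conjE allE[of _ "\<lambda>m. of_int (x m) - of_int (y m)"]) simp
      then show "x = y"
        by (intro PiE_ext[OF xy[unfolded carrier]]) simp
    qed
    show "r i ` carrier (int_power_group n) \<subseteq> r (Suc i) ` carrier (int_power_group n)" for i
      unfolding r_carrier by (rule mono_carrier)
    show "r i ` int_power_pos n \<subseteq> r (Suc i) ` int_power_pos n" for i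
      unfolding r_pos by (rule mono_pos)
    have latQ: "int_combs n {0..} (B i) \<subseteq> Q" for i
      using B(1)[of i] by (auto simp: int_combs_def pos_basis_def intro!: sum_mem scale_mem)
    show "(\<Union>i. r i ` int_power_pos n) = Q"
      unfolding r_pos using latQ B(3) by blast
    show "(\<Union>i. r i ` carrier (int_power_group n)) = UNIV"
    proof -
      have "\<exists>i. v \<in> int_combs n UNIV (B i)" for v
      proof -
        obtain x y where xy: "x \<in> Q" "y \<in> Q" "v = x - y" using generating by blast
        obtain i j where ij: "x \<in> int_combs n {0..} (B i)" "y \<in> int_combs n {0..} (B j)"
          using B(3) xy by blast
        have mono: "int_combs n {0..} (B i) \<subseteq> int_combs n {0..} (B j)" if "i \<le> j" for i j
          by (rule lift_Suc_mono_le[of "\<lambda>i. int_combs n {0..} (B i)", OF mono_pos that])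
        \<comment> \<open>Both positive parts are moved to a common stage before
          subtracting.\<close>
        let ?k = "max i j"
        have "x \<in> int_combs n {0..} (B ?k)" "y \<in> int_combs n {0..} (B ?k)"
          using ij mono[of i ?k] mono[of j ?k] by auto
        then obtain c d where "x = (\<Sum>m<n. of_int (c m) *s B ?k m)" "y = (\<Sum>m<n. of_int (d m) *s B ?k m)"
          by (auto simp: int_combs_def)
        then have "v = (\<Sum>m<n. of_int (c m - d m) *s B ?k m)"
          using xy(3) by (simp add: scale_left_diff_distrib sum_subtractf)
        then have "v \<in> int_combs n UNIV (B ?k)"
          unfolding int_combs_def by (intro CollectI exI[of _ "\<lambda>m. c m - d m"]) simp
        then show ?thesis by blast
      qed
      then show ?thesis unfolding r_carrier by blast
    qed
  qed
qed

end

theorem corollary5p1: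
  fixes scale :: "rat \<Rightarrow> 'v::ab_group_add \<Rightarrow> 'v" and pos :: "'v set" and n :: nat
  assumes "ordered_rat_vector_space scale pos"
    and "\<exists>B. finite_dimensional_vector_space scale B"
    and "vector_space.dim scale UNIV = n"
    and "directed_cone pos"
    and "riesz_interpolation pos"
  shows "\<exists>\<phi> :: nat \<Rightarrow> nat \<Rightarrow> (nat \<Rightarrow> int) \<Rightarrow> (nat \<Rightarrow> int).
    inductive_system {1..} (\<lambda>_. int_power_group n) (\<lambda>_. int_power_pos n) \<phi> \<and>
    ordered_iso
      (limit_group {1..} (\<lambda>_. int_power_group n) \<phi>)
      (limit_pos {1..} (\<lambda>_. int_power_group n) (\<lambda>_. int_power_pos n) \<phi>)
      additive_group pos \<noteq> {}"
proof -
  interpret ordered_rat_vector_space scale pos by fact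
  obtain B where "finite_dimensional_vector_space scale B" using assms(2) by blast
  then interpret F: rat_space scale B by (simp add: rat_space_def)
  have zero: "0 \<in> pos" using pos_Int_neg by blast
  have "riesz_cone scale B pos"
  proof
    show "\<exists>x\<in>pos. \<exists>y\<in>pos. v = x - y" for v
    proof -
      \<comment> \<open>An upper bound \<open>z\<close> of \<open>v\<close> and 0 writes
        \<open>v\<close> as the difference of \<open>z\<close> and \<open>z - v\<close>.\<close>
      obtain z where "z - v \<in> pos" "z - 0 \<in> pos"
        using assms(4) unfolding directed_cone_def cone_le_def by blast
      then show ?thesis by (intro bexI[of _ "z - 0"] bexI[of _ "z - v"]) simp_all
    qed
  qed (use zero pos_add pos_scale assms(5) in auto)
  moreover have "lineality pos = {0}"
  proof -
    have "x = 0" if "x \<in> pos" "- x \<in> pos" for x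
    proof -
      have "x \<in> pos \<inter> uminus ` pos"
        using that by (auto intro: image_eqI[of x uminus "- x"])
      then show ?thesis using pos_Int_neg by simp
    qed
    then show ?thesis using zero by (auto simp: lineality_def)
  qed
  ultimately show ?thesis
    using assms(3) by (rule F.limit_of_int_powers)
qed

end
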